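(* Let $L$ be an oriented 1-dimensional link and $D$ a diagram of $L$ which is connected and has at least one crossing. Let $S_{D}$ be a canonical Seifert surface of $L$ derived from $D$ via the Seifert algorithm, and let $\overline{S_{D}}$ be the closed surface obtained from $S_{D}$ by filling in its boundary circles with disks. Let $G$ be a group, $\varphi$ an automorphism of $G$, $H$ a subgroup of $G$ with $\varphi(h)=h$ for all $h\in H$, $X=(G,H,\varphi)$ the associated generalized Alexander quandle, and $g\in G$ the fixed element used to define $\psi$. Then for each $(X,\mathbb{Z})$-coloring $(\mathscr{A},\mathscr{R})$ of $D$, the relative group 2-cycle $\psi(C(\mathscr{A},\mathscr{R}))\in C_{2}(G/H)$ represents a triangulation of $\overline{S_{D}}$.
   Context: Quandle: $X=(G,H,\varphi)$ is the set $H\backslash G$ of right cosets with $Hg\ast Hk=H\varphi(gk^{-1})k$. Chain groups: $C^{R}_{2}(X)_{\mathbb{Z}}$ is the free $\mathbb{Z}$-module on $\mathbb{Z}\times X^{2}$, with generators $(u;x,y)$. $G/H$ is the set of left cosets; $C_{m}(G/H)$ is the free $\mathbb{Z}$-module on $(G/H)^{m+1}/\sim$, where $\sim$ is the orbit relation of the diagonal left $G$-action, with boundary $\partial(g_{0}H,\dots,g_{m}H)=\sum_{i=0}^{m}(-1)^{i}(g_{0}H,\dots,\widehat{g_{i}H},\dots,g_{m}H)$. Map $\psi:C^{R}_{2}(X)_{\mathbb{Z}}\to C_{2}(G/H)$ (for the fixed $g\in G$): $$\psi(u;Hg_{1},Hg_{2})=-\bigl(\varphi^{-u}(g)^{-1}H,\varphi^{-u}(g_{1})^{-1}H,\varphi^{-u}(g_{2})^{-1}H\bigr)+\bigl(\varphi^{-u-1}(g)^{-1}H,\varphi^{-u-1}(\varphi(g_{1}g_{2}^{-1})g_{2})^{-1}H,\varphi^{-u-1}(g_{2})^{-1}H\bigr).$$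 Colorings: give each arc of $D$ the normal direction such that (tangent, normal) is a positively oriented frame of the plane. An $(X,\mathbb{Z})$-coloring $(\mathscr{A},\mathscr{R})$ of $D$ consists of maps $\mathscr{A}:\{\text{arcs of }D\}\to X$ and $\mathscr{R}:\{\text{regions of }D\}\to\mathbb{Z}$ such that (i) at each crossing, if $b$ is the over arc and $a$, $c$ are the under arcs, with the normal of $b$ pointing from the side of $a$ to the side of $c$, then $\mathscr{A}(a)\ast\mathscr{A}(b)=\mathscr{A}(c)$; (ii) if $r$, $s$ are the regions on the two sides of an arc, whose normal points from $r$ to $s$, then $\mathscr{R}(s)=\mathscr{R}(r)+1$. The cycle $C(\mathscr{A},\mathscr{R})\in C^{R}_{2}(X)_{\mathbb{Z}}$ is the sum over all crossings of $\varepsilon(\mathscr{R}(r);\mathscr{A}(a),\mathscr{A}(b))$, where $\varepsilon=\pm1$ is the sign of the crossing, $r$ is the one of the four local regions at the crossing out of which the normals of both strands point, $b$ is the over arc, and $a$ is the under arc adjacent to $r$. Canonical Seifert surface: smooth every crossing of $D$ compatibly with the orientation, take disjoint disks bounded by the resulting Seifert circles, and join them by one half-twisted band for each crossing, so that the boundary is $L$. "Represents a triangulation": write $\psi(C(\mathscr{A},\mathscr{R}))$ as the signed sum of the generators appearing when the definitions are expanded (two triangles for each crossing, without cancelling). This sum represents a triangulation of a closed surface $M$ if, taking one triangle with ordered, $G/H$-labeled vertices for each term (labels up to the diagonal $G$-action), one can pair up all edges of all the triangles so that paired edges (with their vertex order and labels) define the same element of $(G/H)^{2}/\sim$ and occur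 with opposite signs in the boundary, and so that the space obtained by gluing paired edges by the order-preserving affine identification is homeomorphic to $M$. (Triangulation is meant in this generalized sense; the quotient need not be a simplicial complex.) *)

theory Defs
  imports
    "HOL-Analysis.Analysis"
    "HOL-Homology.Simplices"
    "HOL-Algebra.Bij"
    "HOL-Algebra.Left_Coset"
    "HOL-Combinatorics.Orbits"
begin

section \<open>Oriented links and their diagrams\<close>

text \<open>
  Three-space is \<^typ>\<open>complex \<times> real\<close>: the plane of the diagram together with the height over it.
  An oriented link with \<open>n\<close> components is given by 1-periodic regular \<open>C\<^sup>1\<close> parametrizations
  \<open>\<Gamma> 0, \<dots>, \<Gamma> (n - 1)\<close>, the orientation being that of increasing parameter.
\<close>

type_synonym link_param = "nat \<Rightarrow> real \<Rightarrow> complex \<times> real"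

definition oriented_link :: "nat \<Rightarrow> link_param \<Rightarrow> bool" where
  "oriented_link n \<Gamma> \<longleftrightarrow>
     (\<forall>i<n. (\<forall>t. \<Gamma> i (t + 1) = \<Gamma> i t) \<and> \<Gamma> i C1_differentiable_on UNIV \<and>
            (\<forall>t. vector_derivative (\<Gamma> i) (at t) \<noteq> 0)) \<and>
     inj_on (\<lambda>(i, t). \<Gamma> i t) ({..<n} \<times> {0..<1})"

definition link_set :: "nat \<Rightarrow> link_param \<Rightarrow> (complex \<times> real) set" where
  "link_set n \<Gamma> = (\<Union>i<n. range (\<Gamma> i))"

text \<open>A \<open>passage\<close> is a component together with a parameter in \<open>[0, 1)\<close>.\<close>

type_synonym passage = "nat \<times> real"

definition space_point :: "link_param \<Rightarrow> passage \<Rightarrow> complex \<times> real" where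
  "space_point \<Gamma> p = \<Gamma> (fst p) (snd p)"

definition plane_point :: "link_param \<Rightarrow> passage \<Rightarrow> complex" where
  "plane_point \<Gamma> p = fst (space_point \<Gamma> p)"

definition tangent :: "link_param \<Rightarrow> passage \<Rightarrow> complex" where
  "tangent \<Gamma> p = vector_derivative (\<lambda>t. fst (\<Gamma> (fst p) t)) (at (snd p))"

text \<open>The frame (tangent, normal) is positively oriented.\<close>

definition normal :: "link_param \<Rightarrow> passage \<Rightarrow> complex" where
  "normal \<Gamma> p = \<i> * tangent \<Gamma> p"

text \<open>A crossing is recorded as the pair (over passage, under passage).\<close>

definition crossings :: "nat \<Rightarrow> link_param \<Rightarrow> (passage \<times> passage) set" where
  "crossings n \<Gamma> = {(p, q). p \<in> {..<n} \<times> {0..<1} \<and> q \<in> {..<n} \<times> {0..<1} \<and>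
     plane_point \<Gamma> p = plane_point \<Gamma> q \<and> snd (space_point \<Gamma> p) > snd (space_point \<Gamma> q)}"

text \<open>
  The projection of the link to the plane is regular, that is, it defines a link diagram: it is an
  immersion whose only multiple points are finitely many transverse double points.
\<close>

definition regular_projection :: "nat \<Rightarrow> link_param \<Rightarrow> bool" where
  "regular_projection n \<Gamma> \<longleftrightarrow>
     (\<forall>i<n. \<forall>t. vector_derivative (\<lambda>t. fst (\<Gamma> i t)) (at t) \<noteq> 0) \<and>
     (\<forall>z. finite {p \<in> {..<n} \<times> {0..<1}. plane_point \<Gamma> p = z} \<and>
          card {p \<in> {..<n} \<times> {0..<1}. plane_point \<Gamma> p = z} \<le> 2) \<and>
     finite (crossings n \<Gamma>) \<and>
     (\<forall>(p, q) \<in> crossings n \<Gamma>. Im (cnj (tangent \<Gamma> p) * tangent \<Gamma> q) \<noteq> 0)"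

definition diagram_set :: "nat \<Rightarrow> link_param \<Rightarrow> complex set" where
  "diagram_set n \<Gamma> = fst ` link_set n \<Gamma>"

text \<open>
  \<open>Im (cnj v * w)\<close> is the determinant of \<open>(v, w)\<close>.  A crossing is positive if the tangents of its
  over and its under strand form, in this order, a positive frame.
\<close>

definition crossing_sign :: "link_param \<Rightarrow> passage \<times> passage \<Rightarrow> int" where
  "crossing_sign \<Gamma> c =
     (if Im (cnj (tangent \<Gamma> (fst c)) * tangent \<Gamma> (snd c)) > 0 then 1 else - 1)"


section \<open>Arcs and regions\<close>

text \<open>
  Arcs are taken on the link itself, as the connected components left after removing the
  under-crossing points; on the planar image an arc may cross other arcs or itself.
\<close>

definition cut_link :: "nat \<Rightarrow> link_param \<Rightarrow> (complex \<times> real) set" where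
  "cut_link n \<Gamma> = link_set n \<Gamma> - space_point \<Gamma> ` snd ` crossings n \<Gamma>"

definition arcs :: "nat \<Rightarrow> link_param \<Rightarrow> (complex \<times> real) set set" where
  "arcs n \<Gamma> = components (cut_link n \<Gamma>)"

definition regions :: "nat \<Rightarrow> link_param \<Rightarrow> complex set set" where
  "regions n \<Gamma> = components (- diagram_set n \<Gamma>)"

text \<open>The arc through an over passage, and the arcs entering and leaving an under passage.\<close>

definition arc_through :: "nat \<Rightarrow> link_param \<Rightarrow> passage \<Rightarrow> (complex \<times> real) set" where
  "arc_through n \<Gamma> p = (THE A. A \<in> arcs n \<Gamma> \<and> space_point \<Gamma> p \<in> A)"

definition arc_in :: "nat \<Rightarrow> link_param \<Rightarrow> passage \<Rightarrow> (complex \<times> real) set" where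
  "arc_in n \<Gamma> p = (THE A. A \<in> arcs n \<Gamma> \<and> (\<forall>\<^sub>F t in at_left (snd p). \<Gamma> (fst p) t \<in> A))"

definition arc_out :: "nat \<Rightarrow> link_param \<Rightarrow> passage \<Rightarrow> (complex \<times> real) set" where
  "arc_out n \<Gamma> p = (THE A. A \<in> arcs n \<Gamma> \<and> (\<forall>\<^sub>F t in at_right (snd p). \<Gamma> (fst p) t \<in> A))"

definition over_arc :: "nat \<Rightarrow> link_param \<Rightarrow> passage \<times> passage \<Rightarrow> (complex \<times> real) set" where
  "over_arc n \<Gamma> c = arc_through n \<Gamma> (fst c)"

text \<open>
  The normal of the over arc points from the side of \<open>under_arc_source\<close> to the side of
  \<open>under_arc_target\<close>.
\<close>

definition under_arc_source :: "nat \<Rightarrow> link_param \<Rightarrow> passage \<times> passage \<Rightarrow> (complex \<times> real) set" where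
  "under_arc_source n \<Gamma> c =
     (if tangent \<Gamma> (snd c) \<bullet> normal \<Gamma> (fst c) > 0 then arc_in n \<Gamma> (snd c) else arc_out n \<Gamma> (snd c))"

definition under_arc_target :: "nat \<Rightarrow> link_param \<Rightarrow> passage \<times> passage \<Rightarrow> (complex \<times> real) set" where
  "under_arc_target n \<Gamma> c =
     (if tangent \<Gamma> (snd c) \<bullet> normal \<Gamma> (fst c) > 0 then arc_out n \<Gamma> (snd c) else arc_in n \<Gamma> (snd c))"

text \<open>The region met immediately when leaving the point \<open>z\<close> of the diagram in direction \<open>d\<close>.\<close>

definition region_towards :: "nat \<Rightarrow> link_param \<Rightarrow> complex \<Rightarrow> complex \<Rightarrow> complex set" where
  "region_towards n \<Gamma> z d =
     (THE R. R \<in> regions n \<Gamma> \<and> (\<forall>\<^sub>F e in at_right (0::real). z + of_real e * d \<in> R))"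

text \<open>
  The local region at a crossing out of which both normals point.  The two normals have to be
  scaled to unit length, so that the direction has negative inner product with each of them.
\<close>

definition source_region :: "nat \<Rightarrow> link_param \<Rightarrow> passage \<times> passage \<Rightarrow> complex set" where
  "source_region n \<Gamma> c =
     region_towards n \<Gamma> (plane_point \<Gamma> (fst c)) (- (sgn (normal \<Gamma> (fst c)) + sgn (normal \<Gamma> (snd c))))"


section \<open>Generalized Alexander quandles and colorings\<close>

text \<open>
  The underlying set of the quandle is \<open>rcosets\<^bsub>G\<^esub> H\<close>, the set of right cosets
  \<open>H #>\<^bsub>G\<^esub> x\<close>.  Formulas stated on representatives use \<open>coset_rep\<close>; independence of the choice
  is shown below.
\<close>

definition coset_rep :: "'g set \<Rightarrow> 'g" where
  "coset_rep A = (SOME x. x \<in> A)"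

definition quandle_op ::
    "('g, 'm) monoid_scheme \<Rightarrow> 'g set \<Rightarrow> ('g \<Rightarrow> 'g) \<Rightarrow> 'g set \<Rightarrow> 'g set \<Rightarrow> 'g set" where
  "quandle_op G H \<phi> A B =
     H #>\<^bsub>G\<^esub> (\<phi> (coset_rep A \<otimes>\<^bsub>G\<^esub> inv\<^bsub>G\<^esub> (coset_rep B)) \<otimes>\<^bsub>G\<^esub> coset_rep B)"

definition XZ_coloring ::
    "('g, 'm) monoid_scheme \<Rightarrow> 'g set \<Rightarrow> ('g \<Rightarrow> 'g) \<Rightarrow> nat \<Rightarrow> link_param \<Rightarrow>
     ((complex \<times> real) set \<Rightarrow> 'g set) \<Rightarrow> (complex set \<Rightarrow> int) \<Rightarrow> bool" where
  "XZ_coloring G H \<phi> n \<Gamma> \<A> \<R> \<longleftrightarrow>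
     \<A> ` arcs n \<Gamma> \<subseteq> rcosets\<^bsub>G\<^esub> H \<and>
     (\<forall>c \<in> crossings n \<Gamma>.
        quandle_op G H \<phi> (\<A> (under_arc_source n \<Gamma> c)) (\<A> (over_arc n \<Gamma> c)) =
        \<A> (under_arc_target n \<Gamma> c)) \<and>
     (\<forall>p \<in> {..<n} \<times> {0..<1}. p \<notin> fst ` crossings n \<Gamma> \<union> snd ` crossings n \<Gamma> \<longrightarrow>
        \<R> (region_towards n \<Gamma> (plane_point \<Gamma> p) (normal \<Gamma> p)) =
        \<R> (region_towards n \<Gamma> (plane_point \<Gamma> p) (- normal \<Gamma> p)) + 1)"

definition crossing_generator ::
    "nat \<Rightarrow> link_param \<Rightarrow> ((complex \<times> real) set \<Rightarrow> 'g set) \<Rightarrow> (complex set \<Rightarrow> int) \<Rightarrow>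
     passage \<times> passage \<Rightarrow> int \<times> 'g set \<times> 'g set" where
  "crossing_generator n \<Gamma> \<A> \<R> c =
     (\<R> (source_region n \<Gamma> c), \<A> (under_arc_source n \<Gamma> c), \<A> (over_arc n \<Gamma> c))"

definition coloring_cycle ::
    "nat \<Rightarrow> link_param \<Rightarrow> ((complex \<times> real) set \<Rightarrow> 'g set) \<Rightarrow> (complex set \<Rightarrow> int) \<Rightarrow>
     (int \<times> 'g set \<times> 'g set) \<Rightarrow>\<^sub>0 int" where
  "coloring_cycle n \<Gamma> \<A> \<R> =
     (\<Sum>c \<in> crossings n \<Gamma>. frag_cmul (crossing_sign \<Gamma> c) (frag_of (crossing_generator n \<Gamma> \<A> \<R> c)))"


section \<open>Relative group chains and the map \<open>\<psi>\<close>\<close>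

text \<open>
  The class of a tuple of left cosets modulo the diagonal left action.  An element of \<open>C\<^sub>m(G/H)\<close> is
  an integral combination (type \<^typ>\<open>'g set list set \<Rightarrow>\<^sub>0 int\<close>) of classes of tuples of length \<open>m + 1\<close>.
\<close>

definition tuple_class :: "('g, 'm) monoid_scheme \<Rightarrow> 'g set list \<Rightarrow> 'g set list set" where
  "tuple_class G xs = {map (\<lambda>A. k <#\<^bsub>G\<^esub> A) xs | k. k \<in> carrier G}"

definition tuple_face :: "nat \<Rightarrow> 'a list \<Rightarrow> 'a list" where
  "tuple_face i xs = take i xs @ drop (Suc i) xs"

text \<open>\<open>shifted_coset G H \<phi> k x\<close> is \<open>\<phi>\<^sup>k(x)\<^sup>-\<^sup>1H\<close> for an integer \<open>k\<close>.\<close>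

definition shifted_coset ::
    "('g, 'm) monoid_scheme \<Rightarrow> 'g set \<Rightarrow> ('g \<Rightarrow> 'g) \<Rightarrow> int \<Rightarrow> 'g \<Rightarrow> 'g set" where
  "shifted_coset G H \<phi> k x = inv\<^bsub>G\<^esub> ((\<phi> [^]\<^bsub>AutoGroup G\<^esub> k) x) <#\<^bsub>G\<^esub> H"

fun psi_negative_triangle ::
    "('g, 'm) monoid_scheme \<Rightarrow> 'g set \<Rightarrow> ('g \<Rightarrow> 'g) \<Rightarrow> 'g \<Rightarrow> int \<times> 'g set \<times> 'g set \<Rightarrow> 'g set list" where
  "psi_negative_triangle G H \<phi> g (u, A, B) =
     [shifted_coset G H \<phi> (- u) g,
      shifted_coset G H \<phi> (- u) (coset_rep A),
      shifted_coset G H \<phi> (- u) (coset_rep B)]"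

fun psi_positive_triangle ::
    "('g, 'm) monoid_scheme \<Rightarrow> 'g set \<Rightarrow> ('g \<Rightarrow> 'g) \<Rightarrow> 'g \<Rightarrow> int \<times> 'g set \<times> 'g set \<Rightarrow> 'g set list" where
  "psi_positive_triangle G H \<phi> g (u, A, B) =
     [shifted_coset G H \<phi> (- u - 1) g,
      shifted_coset G H \<phi> (- u - 1)
        (\<phi> (coset_rep A \<otimes>\<^bsub>G\<^esub> inv\<^bsub>G\<^esub> (coset_rep B)) \<otimes>\<^bsub>G\<^esub> coset_rep B),
      shifted_coset G H \<phi> (- u - 1) (coset_rep B)]"

definition psi ::
    "('g, 'm) monoid_scheme \<Rightarrow> 'g set \<Rightarrow> ('g \<Rightarrow> 'g) \<Rightarrow> 'g \<Rightarrow>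
     ((int \<times> 'g set \<times> 'g set) \<Rightarrow>\<^sub>0 int) \<Rightarrow> ('g set list set \<Rightarrow>\<^sub>0 int)" where
  "psi G H \<phi> g = frag_extend (\<lambda>x.
     - frag_of (tuple_class G (psi_negative_triangle G H \<phi> g x))
     + frag_of (tuple_class G (psi_positive_triangle G H \<phi> g x)))"

text \<open>
  The signed triangles of \<open>\<psi>(C(\<A>, \<R>))\<close> before cancellation, indexed by pairs of a crossing and a
  truth value that selects the positive or the negative term of \<open>\<psi>\<close>.
\<close>

fun expanded_sign :: "link_param \<Rightarrow> (passage \<times> passage) \<times> bool \<Rightarrow> int" where
  "expanded_sign \<Gamma> (c, b) = (if b then crossing_sign \<Gamma> c else - crossing_sign \<Gamma> c)"

fun expanded_triangle ::
    "('g, 'm) monoid_scheme \<Rightarrow> 'g set \<Rightarrow> ('g \<Rightarrow> 'g) \<Rightarrow> 'g \<Rightarrow> nat \<Rightarrow> link_param \<Rightarrow>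
     ((complex \<times> real) set \<Rightarrow> 'g set) \<Rightarrow> (complex set \<Rightarrow> int) \<Rightarrow>
     (passage \<times> passage) \<times> bool \<Rightarrow> 'g set list" where
  "expanded_triangle G H \<phi> g n \<Gamma> \<A> \<R> (c, b) =
     (if b then psi_positive_triangle G H \<phi> g (crossing_generator n \<Gamma> \<A> \<R> c)
           else psi_negative_triangle G H \<phi> g (crossing_generator n \<Gamma> \<A> \<R> c))"


section \<open>Quotient spaces and triangulations represented by signed sums\<close>

definition generated_equiv :: "('a \<times> 'a) set \<Rightarrow> ('a \<times> 'a) set" where
  "generated_equiv R = (R \<union> R\<inverse>)\<^sup>*"

text \<open>
  The quotient of a space by the equivalence relation generated by \<open>R\<close>, where \<open>R\<close> relates points of
  the space only.
\<close>

definition quotient_space :: "'a topology \<Rightarrow> ('a \<times> 'a) set \<Rightarrow> 'a set topology" where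
  "quotient_space X R = topology (\<lambda>U. U \<subseteq> topspace X // generated_equiv R \<and>
     openin X {x \<in> topspace X. generated_equiv R `` {x} \<in> U})"

text \<open>
  Edge \<open>(t, i)\<close> is the edge of triangle \<open>t\<close> opposite to its vertex \<open>i\<close>.  The map
  \<^term>\<open>simplical_face i\<close> is the order-preserving affine parametrization of this edge by the standard
  1-simplex.
\<close>

definition glued_triangles ::
    "'t set \<Rightarrow> ('t \<times> nat \<Rightarrow> 't \<times> nat) \<Rightarrow> ('t \<times> (nat \<Rightarrow> real)) set topology" where
  "glued_triangles T \<pi> =
     quotient_space
       (sum_topology (\<lambda>_. subtopology (powertop_real UNIV) (standard_simplex 2)) T)
       {((t, simplical_face i x), (t', simplical_face j x)) | t i t' j x.
          t \<in> T \<and> i \<in> {0, 1, 2} \<and> \<pi> (t, i) = (t', j) \<and> x \<in> standard_simplex 1}"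

text \<open>
  The signed sum \<open>\<Sum>t\<in>T. s t [\<tau> t]\<close> of labeled triangles, written without cancellation, is equal
  to the chain \<open>z\<close> and represents a triangulation of the closed surface \<open>M\<close>.  The edges are paired by a
  fixed-point free involution \<open>\<pi>\<close>; the edge \<open>(t, i)\<close> has sign \<open>s t * (- 1) ^ i\<close> in the boundary.
\<close>

definition represents_triangulation ::
    "('g, 'm) monoid_scheme \<Rightarrow> 'g set \<Rightarrow> ('g set list set \<Rightarrow>\<^sub>0 int) \<Rightarrow>
     't set \<Rightarrow> ('t \<Rightarrow> int) \<Rightarrow> ('t \<Rightarrow> 'g set list) \<Rightarrow> 'b topology \<Rightarrow> bool" where
  "represents_triangulation G H z T s \<tau> M \<longleftrightarrow>
     finite T \<and>
     (\<forall>t\<in>T. s t \<in> {- 1, 1} \<and> length (\<tau> t) = 3 \<and> set (\<tau> t) \<subseteq> lcosets\<^bsub>G\<^esub> H) \<and>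
     z = (\<Sum>t\<in>T. frag_cmul (s t) (frag_of (tuple_class G (\<tau> t)))) \<and>
     (\<exists>\<pi>. (\<forall>e \<in> T \<times> {0, 1, 2}. \<pi> e \<in> T \<times> {0, 1, 2} \<and> \<pi> e \<noteq> e \<and> \<pi> (\<pi> e) = e) \<and>
          (\<forall>t\<in>T. \<forall>i\<in>{0, 1, 2}. \<forall>t' j. \<pi> (t, i) = (t', j) \<longrightarrow>
             tuple_class G (tuple_face i (\<tau> t)) = tuple_class G (tuple_face j (\<tau> t')) \<and>
             s t * (- 1) ^ i = - (s t' * (- 1) ^ j)) \<and>
          glued_triangles T \<pi> homeomorphic_space M)"


section \<open>The canonical Seifert surface and its closure\<close>

definition passages :: "nat \<Rightarrow> link_param \<Rightarrow> passage set" where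
  "passages n \<Gamma> = fst ` crossings n \<Gamma> \<union> snd ` crossings n \<Gamma>"

definition other_passage :: "nat \<Rightarrow> link_param \<Rightarrow> passage \<Rightarrow> passage" where
  "other_passage n \<Gamma> p = (THE q. (p, q) \<in> crossings n \<Gamma> \<or> (q, p) \<in> crossings n \<Gamma>)"

definition crossing_of :: "nat \<Rightarrow> link_param \<Rightarrow> passage \<Rightarrow> passage \<times> passage" where
  "crossing_of n \<Gamma> p =
     (if p \<in> fst ` crossings n \<Gamma> then (p, other_passage n \<Gamma> p) else (other_passage n \<Gamma> p, p))"

text \<open>
  The next passage along the link; \<^const>\<open>frac\<close> reduces the parameter to \<open>[0, 1)\<close>.  The part of the
  diagram between \<open>p\<close> and the next passage is called the edge leaving \<open>p\<close>.
\<close>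

definition next_on_link :: "nat \<Rightarrow> link_param \<Rightarrow> passage \<Rightarrow> passage" where
  "next_on_link n \<Gamma> p =
     (fst p, frac (Inf {s. s > snd p \<and> (fst p, frac s) \<in> passages n \<Gamma>}))"

text \<open>
  The oriented smoothing: arriving at a crossing along the strand of the passage \<open>p\<close> one turns into
  the strand of the other passage.  The cycles of this map are the Seifert circles.
\<close>

definition next_on_seifert :: "nat \<Rightarrow> link_param \<Rightarrow> passage \<Rightarrow> passage" where
  "next_on_seifert n \<Gamma> p = next_on_link n \<Gamma> (other_passage n \<Gamma> p)"

text \<open>
  Points of the unit circle, used as boundary of a disk attached along a cycle of \<open>f\<close>.  A cycle of
  length \<open>m\<close> divides the circle into \<open>2 m\<close> segments: for each \<open>p\<close> in the cycle first the
  segment \<open>node_point f p\<close> for the passage \<open>p\<close> through its crossing, then the segment \<open>edge_point f p\<close>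
  for the edge leading to \<open>f p\<close>, both parametrized by \<open>[0, 1]\<close>.
\<close>

definition cycle_position :: "('p \<Rightarrow> 'p) \<Rightarrow> 'p \<Rightarrow> nat" where
  "cycle_position f p = funpow_dist f (SOME q. q \<in> orbit f p) p"

definition node_point :: "('p \<Rightarrow> 'p) \<Rightarrow> 'p \<Rightarrow> real \<Rightarrow> complex" where
  "node_point f p s =
     cis (2 * pi * (2 * real (cycle_position f p) + s) / (2 * real (card (orbit f p))))"

definition edge_point :: "('p \<Rightarrow> 'p) \<Rightarrow> 'p \<Rightarrow> real \<Rightarrow> complex" where
  "edge_point f p s =
     cis (2 * pi * (2 * real (cycle_position f p) + 1 + s) / (2 * real (card (orbit f p))))"

datatype piece =
    Seifert_Disk "passage set"
  | Band "passage \<times> passage"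
  | Capping_Disk "passage set"

definition surface_pieces :: "nat \<Rightarrow> link_param \<Rightarrow> piece set" where
  "surface_pieces n \<Gamma> =
     (\<lambda>p. Seifert_Disk (orbit (next_on_seifert n \<Gamma>) p)) ` passages n \<Gamma> \<union> Band ` crossings n \<Gamma>"

definition capping_pieces :: "nat \<Rightarrow> link_param \<Rightarrow> piece set" where
  "capping_pieces n \<Gamma> = (\<lambda>p. Capping_Disk (orbit (next_on_link n \<Gamma>) p)) ` passages n \<Gamma>"

fun piece_space :: "piece \<Rightarrow> complex topology" where
  "piece_space (Seifert_Disk _) = top_of_set (cball 0 1)"
| "piece_space (Capping_Disk _) = top_of_set (cball 0 1)"
| "piece_space (Band _) = top_of_set (cbox 0 (1 + \<i>))"

text \<open>
  The band of a crossing is the unit square.  Its bottom side is attached to the disk whose boundary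
  turns off the over strand, its top side to the disk whose boundary turns off the under strand.
  By the half twist the two remaining sides are parts of \<open>L\<close>: the over strand runs along the left
  side, from bottom to top, and the under strand runs along the right side, from top to bottom.
  The coordinates of \<open>band_point n \<Gamma> p x y\<close> are turned by a half rotation if \<open>p\<close> is an under passage,
  so that bottom and left refer to the strand \<open>p\<close> in either case.
\<close>

definition band_point :: "nat \<Rightarrow> link_param \<Rightarrow> passage \<Rightarrow> real \<Rightarrow> real \<Rightarrow> complex" where
  "band_point n \<Gamma> p x y =
     (if p \<in> fst ` crossings n \<Gamma> then Complex x y else Complex (1 - x) (1 - y))"

definition band_gluing :: "nat \<Rightarrow> link_param \<Rightarrow> ((piece \<times> complex) \<times> (piece \<times> complex)) set" where
  "band_gluing n \<Gamma> =
     {((Seifert_Disk (orbit (next_on_seifert n \<Gamma>) p), node_point (next_on_seifert n \<Gamma>) p s),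
       (Band (crossing_of n \<Gamma> p), band_point n \<Gamma> p s 0)) | p s. p \<in> passages n \<Gamma> \<and> s \<in> {0..1}}"

definition seifert_surface :: "nat \<Rightarrow> link_param \<Rightarrow> (piece \<times> complex) set topology" where
  "seifert_surface n \<Gamma> =
     quotient_space (sum_topology piece_space (surface_pieces n \<Gamma>)) (band_gluing n \<Gamma>)"

text \<open>
  The boundary circles of the Seifert surface are the components of \<open>L\<close>, each consisting alternately of
  sides of bands and of segments of the boundaries of Seifert disks.  The edge leaving \<open>p\<close> is
  reached on its Seifert circle by turning off the other passage of the same crossing.
\<close>

definition capping_gluing :: "nat \<Rightarrow> link_param \<Rightarrow> ((piece \<times> complex) \<times> (piece \<times> complex)) set" where
  "capping_gluing n \<Gamma> =
     {((Capping_Disk (orbit (next_on_link n \<Gamma>) p), node_point (next_on_link n \<Gamma>) p s),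
       (Band (crossing_of n \<Gamma> p), band_point n \<Gamma> p 0 s)) | p s. p \<in> passages n \<Gamma> \<and> s \<in> {0..1}} \<union>
     {((Capping_Disk (orbit (next_on_link n \<Gamma>) p), edge_point (next_on_link n \<Gamma>) p s),
       (Seifert_Disk (orbit (next_on_seifert n \<Gamma>) (other_passage n \<Gamma> p)),
        edge_point (next_on_seifert n \<Gamma>) (other_passage n \<Gamma> p) s)) | p s.
      p \<in> passages n \<Gamma> \<and> s \<in> {0..1}}"

text \<open>
  The closed surface: \<^const>\<open>seifert_surface\<close> with its boundary circles filled in by disks.  All
  identifications are made in one step.
\<close>

definition closed_seifert_surface :: "nat \<Rightarrow> link_param \<Rightarrow> (piece \<times> complex) set topology" where
  "closed_seifert_surface n \<Gamma> =
     quotient_space (sum_topology piece_space (surface_pieces n \<Gamma> \<union> capping_pieces n \<Gamma>))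
       (band_gluing n \<Gamma> \<union> capping_gluing n \<Gamma>)"


section \<open>Consistency of the definitions\<close>

lemma openin_quotient_space:
  "openin (quotient_space X R) U \<longleftrightarrow> U \<subseteq> topspace X // generated_equiv R \<and>
     openin X {x \<in> topspace X. generated_equiv R `` {x} \<in> U}"
proof -
  let ?q = "\<lambda>x. generated_equiv R `` {x}"
  have "{x \<in> topspace X. ?q x \<in> S \<inter> T} = {x \<in> topspace X. ?q x \<in> S} \<inter> {x \<in> topspace X. ?q x \<in> T}"
    "{x \<in> topspace X. ?q x \<in> \<Union>\<K>} = (\<Union>K\<in>\<K>. {x \<in> topspace X. ?q x \<in> K})" for S T \<K>
    by auto
  then have "istopology (\<lambda>U. U \<subseteq> topspace X // generated_equiv R \<and>
     openin X {x \<in> topspace X. ?q x \<in> U})"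
    unfolding istopology_def by (auto intro!: openin_Union)
  then show ?thesis
    by (simp add: quotient_space_def)
qed

lemma topspace_quotient_space:
  "topspace (quotient_space X R) = topspace X // generated_equiv R"
proof -
  have "{x \<in> topspace X. generated_equiv R `` {x} \<in> topspace X // generated_equiv R} = topspace X"
    by (auto intro: quotientI)
  then have "openin (quotient_space X R) (topspace X // generated_equiv R)"
    by (simp add: openin_quotient_space)
  then show ?thesis
    by (metis openin_quotient_space openin_subset openin_topspace subset_antisym)
qed

lemma quotient_map_quotient_space:
  "quotient_map X (quotient_space X R) (\<lambda>x. generated_equiv R `` {x})"
  by (auto simp: quotient_map_def topspace_quotient_space openin_quotient_space quotient_def)

lemma coset_rep_rcoset:
  assumes "group G" "subgroup H G" "x \<in> carrier G"
  obtains h where "h \<in> H" "coset_rep (H #>\<^bsub>G\<^esub> x) = h \<otimes>\<^bsub>G\<^esub> x"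
proof -
  have "x \<in> H #>\<^bsub>G\<^esub> x"
    by (rule group.rcos_self[OF assms(1,3,2)])
  then have "coset_rep (H #>\<^bsub>G\<^esub> x) \<in> H #>\<^bsub>G\<^esub> x"
    unfolding coset_rep_def by (rule someI)
  then show thesis
    using that by (auto simp: r_coset_def)
qed

lemma auto_mult:
  assumes "f \<in> auto G" "x \<in> carrier G" "y \<in> carrier G"
  shows "f (x \<otimes>\<^bsub>G\<^esub> y) = f x \<otimes>\<^bsub>G\<^esub> f y" "f x \<in> carrier G"
  using assms by (auto simp: auto_def hom_def)

lemma quandle_op_rcosets:
  assumes G: "group G" and H: "subgroup H G" and f: "\<phi> \<in> auto G" and fH: "\<And>h. h \<in> H \<Longrightarrow> \<phi> h = h"
    and x: "x \<in> carrier G" and y: "y \<in> carrier G"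
  shows "quandle_op G H \<phi> (H #>\<^bsub>G\<^esub> x) (H #>\<^bsub>G\<^esub> y) =
         H #>\<^bsub>G\<^esub> (\<phi> (x \<otimes>\<^bsub>G\<^esub> inv\<^bsub>G\<^esub> y) \<otimes>\<^bsub>G\<^esub> y)"
proof -
  interpret group G by (rule G)
  obtain h where h: "h \<in> H" and rx: "coset_rep (H #>\<^bsub>G\<^esub> x) = h \<otimes>\<^bsub>G\<^esub> x"
    using coset_rep_rcoset[OF G H x] .
  obtain k where k: "k \<in> H" and ry: "coset_rep (H #>\<^bsub>G\<^esub> y) = k \<otimes>\<^bsub>G\<^esub> y"
    using coset_rep_rcoset[OF G H y] .
  have hk: "h \<in> carrier G" "k \<in> carrier G"
    using h k H subgroup.mem_carrier by fastforce+
  have ik: "inv\<^bsub>G\<^esub> k \<in> H" using H k by (simp add: subgroup.m_inv_closed)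
  have fxy: "\<phi> (x \<otimes>\<^bsub>G\<^esub> inv\<^bsub>G\<^esub> y) \<in> carrier G"
    using x y by (intro auto_mult(2)[OF f]) auto
  have "(h \<otimes>\<^bsub>G\<^esub> x) \<otimes>\<^bsub>G\<^esub> inv\<^bsub>G\<^esub> (k \<otimes>\<^bsub>G\<^esub> y) = h \<otimes>\<^bsub>G\<^esub> ((x \<otimes>\<^bsub>G\<^esub> inv\<^bsub>G\<^esub> y) \<otimes>\<^bsub>G\<^esub> inv\<^bsub>G\<^esub> k)"
    using hk x y by (simp add: inv_mult_group m_assoc)
  then have "\<phi> ((h \<otimes>\<^bsub>G\<^esub> x) \<otimes>\<^bsub>G\<^esub> inv\<^bsub>G\<^esub> (k \<otimes>\<^bsub>G\<^esub> y)) =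
      h \<otimes>\<^bsub>G\<^esub> (\<phi> (x \<otimes>\<^bsub>G\<^esub> inv\<^bsub>G\<^esub> y) \<otimes>\<^bsub>G\<^esub> inv\<^bsub>G\<^esub> k)"
    using hk x y by (simp add: auto_mult[OF f] fH h ik)
  then have "\<phi> ((h \<otimes>\<^bsub>G\<^esub> x) \<otimes>\<^bsub>G\<^esub> inv\<^bsub>G\<^esub> (k \<otimes>\<^bsub>G\<^esub> y)) \<otimes>\<^bsub>G\<^esub> (k \<otimes>\<^bsub>G\<^esub> y) =
      h \<otimes>\<^bsub>G\<^esub> (\<phi> (x \<otimes>\<^bsub>G\<^esub> inv\<^bsub>G\<^esub> y) \<otimes>\<^bsub>G\<^esub> (inv\<^bsub>G\<^esub> k \<otimes>\<^bsub>G\<^esub> k) \<otimes>\<^bsub>G\<^esub> y)"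
    using hk x y fxy by (simp add: m_assoc inv_solve_left')
  also have "\<dots> = h \<otimes>\<^bsub>G\<^esub> (\<phi> (x \<otimes>\<^bsub>G\<^esub> inv\<^bsub>G\<^esub> y) \<otimes>\<^bsub>G\<^esub> y)"
    using hk x y fxy by simp
  finally show ?thesis
    unfolding quandle_op_def rx ry
    using coset_mult_assoc[of H h "\<phi> (x \<otimes>\<^bsub>G\<^esub> inv\<^bsub>G\<^esub> y) \<otimes>\<^bsub>G\<^esub> y"] coset_join2[OF hk(1) H h] hk y fxy
    by (simp add: subgroup.subset[OF H])
qed

lemma subgroup_fixing:
  assumes "group G" "subgroup H G"
  shows "subgroup {f \<in> auto G. \<forall>h\<in>H. f h = h} (AutoGroup G)"
proof -
  have A: "group (AutoGroup G)" by (rule group.AutoGroup[OF assms(1)])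
  have H: "\<And>h. h \<in> H \<Longrightarrow> h \<in> carrier G" using assms(2) subgroup.mem_carrier by fastforce
  have c: "carrier (AutoGroup G) = auto G" by (simp add: AutoGroup_def)
  have B: "f \<in> Bij (carrier G)" if "f \<in> auto G" for f using that by (simp add: auto_def)
  have m: "f \<otimes>\<^bsub>AutoGroup G\<^esub> f' = compose (carrier G) f f'" if "f \<in> auto G" "f' \<in> auto G" for f f'
    using that by (simp add: AutoGroup_def BijGroup_def B)
  have o: "\<one>\<^bsub>AutoGroup G\<^esub> = (\<lambda>x\<in>carrier G. x)" by (simp add: AutoGroup_def BijGroup_def)
  show ?thesis
  proof (rule group.subgroupI[OF A])
    show "{f \<in> auto G. \<forall>h\<in>H. f h = h} \<subseteq> carrier (AutoGroup G)" by (auto simp: c)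
    have "\<one>\<^bsub>AutoGroup G\<^esub> \<in> auto G" using group.is_monoid[OF A] monoid.one_closed c by metis
    then show "{f \<in> auto G. \<forall>h\<in>H. f h = h} \<noteq> {}"
      using H by (auto simp: o intro!: exI[of _ "\<lambda>x\<in>carrier G. x"])
  next
    fix f assume f: "f \<in> {f \<in> auto G. \<forall>h\<in>H. f h = h}"
    then have i: "inv\<^bsub>AutoGroup G\<^esub> f \<in> auto G" using group.inv_closed[OF A] c by auto
    have "compose (carrier G) (inv\<^bsub>AutoGroup G\<^esub> f) f = (\<lambda>x\<in>carrier G. x)"
      using f i m o group.l_inv[OF A, of f] c by auto
    then have *: "compose (carrier G) (inv\<^bsub>AutoGroup G\<^esub> f) f h = h" if "h \<in> H" for h
      using H[OF that] by simp
    have "(inv\<^bsub>AutoGroup G\<^esub> f) h = h" if "h \<in> H" for h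
      using *[OF that] f H[OF that] that by (simp add: compose_eq)
    with i show "inv\<^bsub>AutoGroup G\<^esub> f \<in> {f \<in> auto G. \<forall>h\<in>H. f h = h}" by auto
  next
    fix f f' assume "f \<in> {f \<in> auto G. \<forall>h\<in>H. f h = h}" "f' \<in> {f \<in> auto G. \<forall>h\<in>H. f h = h}"
    moreover from this have "f \<otimes>\<^bsub>AutoGroup G\<^esub> f' \<in> auto G"
      using monoid.m_closed[OF group.is_monoid[OF A], of f f'] c by auto
    ultimately show "f \<otimes>\<^bsub>AutoGroup G\<^esub> f' \<in> {f \<in> auto G. \<forall>h\<in>H. f h = h}"
      using H by (auto simp: m compose_def)
  qed
qed

lemma shifted_coset_coset_rep:
  assumes G: "group G" and H: "subgroup H G" and f: "\<phi> \<in> auto G" and fH: "\<And>h. h \<in> H \<Longrightarrow> \<phi> h = h"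
    and x: "x \<in> carrier G"
  shows "shifted_coset G H \<phi> k (coset_rep (H #>\<^bsub>G\<^esub> x)) = shifted_coset G H \<phi> k x"
proof -
  interpret group G by (rule G)
  obtain h where h: "h \<in> H" and r: "coset_rep (H #>\<^bsub>G\<^esub> x) = h \<otimes>\<^bsub>G\<^esub> x"
    using coset_rep_rcoset[OF G H x] .
  let ?F = "\<phi> [^]\<^bsub>AutoGroup G\<^esub> k"
  have "?F \<in> {f \<in> auto G. \<forall>h\<in>H. f h = h}"
    using group.subgroup_int_pow_closed[OF group.AutoGroup[OF G] subgroup_fixing[OF G H]] f fH by auto
  then have F: "?F \<in> auto G" and Fh: "?F h = h" using h by auto
  have hc: "h \<in> carrier G" and ih: "inv\<^bsub>G\<^esub> h \<in> H"
    using H h subgroup.mem_carrier subgroup.m_inv_closed by fastforce+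
  have "inv\<^bsub>G\<^esub> (?F (h \<otimes>\<^bsub>G\<^esub> x)) <#\<^bsub>G\<^esub> H = (inv\<^bsub>G\<^esub> (?F x) \<otimes>\<^bsub>G\<^esub> inv\<^bsub>G\<^esub> h) <#\<^bsub>G\<^esub> H"
    using auto_mult[OF F] hc x by (simp add: Fh inv_mult_group)
  also have "\<dots> = inv\<^bsub>G\<^esub> (?F x) <#\<^bsub>G\<^esub> (inv\<^bsub>G\<^esub> h <#\<^bsub>G\<^esub> H)"
    using auto_mult(2)[OF F x] hc by (simp add: lcos_m_assoc subgroup.subset[OF H])
  also have "inv\<^bsub>G\<^esub> h <#\<^bsub>G\<^esub> H = H"
    using H ih hc by (intro coset_join3) auto
  finally show ?thesis
    by (simp add: shifted_coset_def r)
qed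

end

theory Submission
  imports Defs
begin

text \<open>
  Each crossing contributes two triangles, glued along their common side to a quadrilateral whose
  corners are the centers of the two Seifert disks and of the two capping disks that meet the band
  of the crossing; the sides of the quadrilateral are the four semi-edges of the diagram at the
  crossing.  Joining the two ends of every edge of the diagram therefore reproduces the closed Seifert
  surface, cut along paths that run from the center of a Seifert disk through the midpoint of an
  edge to the center of a capping disk.  Both spaces are exhibited as the quotient of one space
  of flags, so that only equivalence relations have to be compared.

  The labels agree because the arc and the region on the right of a strand do not change along an
  edge, and the signs because every outgoing semi-edge has sign \<open>1\<close> and every incoming one \<open>- 1\<close>.
\<close>

section \<open>Quotients of topological sums\<close>

text \<open>The obstacle is that neither decomposition of the surface refines the other: sides of
  triangles run through disks and bands, and boundaries of disks and bands run through triangles.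
  The flags are a common refinement. A triangle consists of two flags, and each of the three
  quadrilaterals of a flag is half a sector of a disk or a quarter of a band; the normalization by
  the maximum makes these quadrilaterals unit squares. Both maps out of the flags lead from a
  compact space onto a Hausdorff space, hence they are quotient maps, and the comparison is reduced
  to listing which points of the flags have the same image. This half of the proof knows only
  passages and two permutations of them. The labels, by contrast, come from arcs and regions, which
  are components of complements. The picture of a crossing is derived from strict differentiability:
  thin cones of transversal directions and images of small quadrants are connected and miss the
  diagram, so each of them lies in a single region.\<close>

lemma equiv_generated_equiv: "equiv UNIV (generated_equiv R)"
  unfolding generated_equiv_def
  by (intro equivI refl_rtrancl sym_rtrancl sym_Un_converse trans_rtrancl) auto

lemma generated_equiv_refl [simp, intro]: "(x, x) \<in> generated_equiv R"
  by (simp add: generated_equiv_def)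

lemma generated_equiv_sym: "(x, y) \<in> generated_equiv R \<Longrightarrow> (y, x) \<in> generated_equiv R"
  by (meson equiv_generated_equiv equivE symD)

lemma generated_equiv_trans:
  "(x, y) \<in> generated_equiv R \<Longrightarrow> (y, z) \<in> generated_equiv R \<Longrightarrow> (x, z) \<in> generated_equiv R"
  by (meson equiv_generated_equiv equivE transD)

lemma generated_equiv_base: "(x, y) \<in> R \<Longrightarrow> (x, y) \<in> generated_equiv R"
  by (auto simp: generated_equiv_def)

lemma generated_equiv_class_eq:
  "generated_equiv R `` {x} = generated_equiv R `` {y} \<longleftrightarrow> (x, y) \<in> generated_equiv R"
  by (rule equiv_class_eq_iff[OF equiv_generated_equiv, of x y R, simplified, symmetric])

lemma generated_equiv_induct [consumes 1, case_names refl fwd bwd]: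
  assumes "(x, y) \<in> generated_equiv R" and "P x"
    and "\<And>y z. (x, y) \<in> generated_equiv R \<Longrightarrow> (y, z) \<in> R \<Longrightarrow> P y \<Longrightarrow> P z"
    and "\<And>y z. (x, y) \<in> generated_equiv R \<Longrightarrow> (z, y) \<in> R \<Longrightarrow> P y \<Longrightarrow> P z"
  shows "P y"
  using assms(1) unfolding generated_equiv_def
proof (induction rule: rtrancl_induct)
  case (step y z)
  then show ?case using assms(3)[of y z] assms(4)[of y z] by (auto simp: generated_equiv_def)
qed (rule assms(2))

section \<open>Homeomorphisms between quotients of a common space\<close>

lemma quotient_maps_same_kernel_homeomorphic:
  assumes f: "quotient_map X Y f" and g: "quotient_map X Z g"
    and ker: "\<And>x x'. x \<in> topspace X \<Longrightarrow> x' \<in> topspace X \<Longrightarrow> f x = f x' \<longleftrightarrow> g x = g x'"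
  shows "Y homeomorphic_space Z"
proof -
  obtain h where h: "continuous_map Y Z h" "\<And>x. x \<in> topspace X \<Longrightarrow> h (f x) = g x"
    using quotient_map_lift_exists[OF f quotient_imp_continuous_map[OF g]] ker by metis
  obtain k where k: "continuous_map Z Y k" "\<And>x. x \<in> topspace X \<Longrightarrow> k (g x) = f x"
    using quotient_map_lift_exists[OF g quotient_imp_continuous_map[OF f]] ker by metis
  have "homeomorphic_maps Y Z h k"
    unfolding homeomorphic_maps_def
    using h k quotient_imp_surjective_map[OF f] quotient_imp_surjective_map[OF g] by force
  then show ?thesis
    by (auto simp: homeomorphic_space_def)
qed

text \<open>A quotient of the quotient \<open>X\<close> is a quotient of \<open>Y\<close>, so only
  kernels are compared. \<open>push\<close> gives one inclusion. For the other one a chain of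
  \<open>R\<close>-steps is lifted to \<open>Y\<close> step by step, and \<open>ker\<close>
  reconciles the end of one lifted step with the start of the next.\<close>

lemma homeomorphic_space_quotient_space:
  assumes f: "quotient_map Y X f"
    and ker: "\<And>y y'. y \<in> topspace Y \<Longrightarrow> y' \<in> topspace Y \<Longrightarrow> f y = f y' \<Longrightarrow> (y, y') \<in> generated_equiv E"
    and lift: "\<And>u u'. (u, u') \<in> R \<Longrightarrow>
      \<exists>y\<in>topspace Y. \<exists>y'\<in>topspace Y. f y = u \<and> f y' = u' \<and> (y, y') \<in> generated_equiv E"
    and push: "\<And>y y'. (y, y') \<in> E \<Longrightarrow> (f y, f y') \<in> generated_equiv R"
  shows "quotient_space Y E homeomorphic_space quotient_space X R"
proof (rule quotient_maps_same_kernel_homeomorphic[OF quotient_map_quotient_space])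
  show "quotient_map Y (quotient_space X R) ((\<lambda>x. generated_equiv R `` {x}) \<circ> f)"
    by (rule quotient_map_compose[OF f quotient_map_quotient_space])
next
  fix y y' assume y: "y \<in> topspace Y" and y': "y' \<in> topspace Y"
  have fwd: "(f y, f y') \<in> generated_equiv R" if "(y, y') \<in> generated_equiv E"
    using that by (induction rule: generated_equiv_induct)
      (blast intro: generated_equiv_trans push generated_equiv_sym)+
  \<comment> \<open>Quantifying over all preimages \<open>v\<close> makes the induction independent
    of the lifts chosen for single steps.\<close>
  have "\<forall>v\<in>topspace Y. f v = u \<longrightarrow> (y, v) \<in> generated_equiv E" if "(f y, u) \<in> generated_equiv R" for u
    using that
  proof (induction rule: generated_equiv_induct)
    case refl
    then show ?case using ker y by auto
  next
    case (fwd u u')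
    with lift[of u u'] show ?case by (metis generated_equiv_trans ker)
  next
    case (bwd u u')
    with lift[of u' u] show ?case by (metis generated_equiv_trans generated_equiv_sym ker)
  qed
  with fwd y' show "generated_equiv E `` {y} = generated_equiv E `` {y'} \<longleftrightarrow>
      ((\<lambda>x. generated_equiv R `` {x}) \<circ> f) y = ((\<lambda>x. generated_equiv R `` {x}) \<circ> f) y'"
    by (auto simp: generated_equiv_class_eq)
qed

section \<open>Topological sums of compact and of Hausdorff spaces\<close>

lemma continuous_map_from_sum_topology:
  assumes "\<And>i. i \<in> I \<Longrightarrow> continuous_map (X i) Z (\<lambda>x. f (i, x))"
  shows "continuous_map (sum_topology X I) Z f"
proof -
  have "openin (X i) {x \<in> topspace (X i). f (i, x) \<in> U}" if "openin Z U" "i \<in> I" for U i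
    using assms that by (simp add: continuous_map_def)
  moreover have "{x. (i, x) \<in> {x \<in> Sigma I (topspace \<circ> X). f x \<in> U}} =
      {x \<in> topspace (X i). f (i, x) \<in> U}" if "i \<in> I" for i U
    using that by auto
  moreover have "f x \<in> topspace Z" if "x \<in> Sigma I (topspace \<circ> X)" for x
    using assms that by (force simp: continuous_map_def)
  ultimately show ?thesis
    by (auto simp: continuous_map_def openin_sum_topology)
qed

lemma compact_space_sum_topology:
  assumes "finite I" and "\<And>i. i \<in> I \<Longrightarrow> compact_space (X i)"
  shows "compact_space (sum_topology X I)"
proof -
  have "compactin (sum_topology X I) (\<Union>((\<lambda>i. (\<lambda>x. (i, x)) ` topspace (X i)) ` I))"
    using assms by (intro compactin_Union)
      (auto intro!: image_compactin continuous_map_component_injection simp: compact_space_def)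
  moreover have "\<Union>((\<lambda>i. (\<lambda>x. (i, x)) ` topspace (X i)) ` I) = topspace (sum_topology X I)"
    by auto
  ultimately show ?thesis
    by (simp add: compact_space_def)
qed

lemma Hausdorff_space_sum_topology:
  assumes "\<And>i. i \<in> I \<Longrightarrow> Hausdorff_space (X i)"
  shows "Hausdorff_space (sum_topology X I)"
  unfolding Hausdorff_space_def
proof (intro allI impI, elim conjE)
  fix u v assume u: "u \<in> topspace (sum_topology X I)" and v: "v \<in> topspace (sum_topology X I)" and ne: "u \<noteq> v"
  obtain i x j y where uv: "u = (i, x)" "v = (j, y)" by fastforce
  show "\<exists>U V. openin (sum_topology X I) U \<and> openin (sum_topology X I) V \<and> u \<in> U \<and> v \<in> V \<and> disjnt U V"
  proof (cases "i = j")
    case True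
    then have "Hausdorff_space (X i)" "x \<in> topspace (X i)" "y \<in> topspace (X i)" "x \<noteq> y" "i \<in> I"
      using assms u v ne uv by auto
    then obtain U V where *: "openin (X i) U" "openin (X i) V" "x \<in> U" "y \<in> V" "disjnt U V"
      unfolding Hausdorff_space_def by metis
    moreover have "openin (sum_topology X I) ((\<lambda>x. (i, x)) ` W)" if "openin (X i) W" for W
      using open_map_component_injection[OF \<open>i \<in> I\<close>] that by (auto simp: open_map_def)
    ultimately show ?thesis
      using True uv
      by (intro exI[of _ "(\<lambda>x. (i, x)) ` U"] exI[of _ "(\<lambda>x. (i, x)) ` V"]) (auto simp: disjnt_def)
  next
    case False
    moreover have "openin (sum_topology X I) ((\<lambda>x. (k, x)) ` topspace (X k))" if "k \<in> I" for k
      using open_map_component_injection[OF that] by (auto simp: open_map_def)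
    ultimately show ?thesis
      using u v uv
      by (intro exI[of _ "(\<lambda>x. (i, x)) ` topspace (X i)"] exI[of _ "(\<lambda>x. (j, x)) ` topspace (X j)"])
        (auto simp: disjnt_def)
  qed
qed

text \<open>Such a map is closed. This is how the two maps out of the flags are recognized as
  quotient maps.\<close>

lemma quotient_map_compact_Hausdorff:
  assumes "compact_space X" "Hausdorff_space Y" "continuous_map X Y f" "f ` topspace X = topspace Y"
  shows "quotient_map X Y f"
  using assms continuous_imp_closed_map continuous_closed_imp_quotient_map by blast

section \<open>Disks attached along the cycles of a permutation\<close>

text \<open>\<open>orbit f p\<close> collects the iterates of positive order, so \<open>p\<close>
  itself belongs to it only because a permutation of a finite set returns to its start.\<close>

lemma bij_betw_self_in_orbit:
  assumes "finite P" "bij_betw f P P" "p \<in> P"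
  shows "p \<in> orbit f p" and "orbit f p \<subseteq> P"
proof -
  have maps: "f x \<in> P" if "x \<in> P" for x using assms(2) that bij_betwE by blast
  have orb: "orbit f x \<subseteq> P" if "x \<in> P" for x
  proof
    fix y assume "y \<in> orbit f x" then show "y \<in> P" by induction (use maps that in auto)
  qed
  then show "orbit f p \<subseteq> P" using assms(3) .
  have it: "(f ^^ k) x \<in> P" if "x \<in> P" for k x using that by (induction k) (auto intro: maps)
  have "\<not> inj_on (\<lambda>k. (f ^^ k) p) UNIV"
    using finite_imageD[of "\<lambda>k. (f ^^ k) p" UNIV] it[OF assms(3)] finite_subset[OF _ assms(1)]
    by (metis image_subsetI infinite_UNIV_nat)
  then obtain a b where "a < b" "(f ^^ a) p = (f ^^ b) p"
    unfolding inj_on_def by (metis linorder_neqE_nat)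
  \<comment> \<open>Injectivity cancels one application of \<open>f\<close> at a time, until a
    coincidence of two iterates becomes a return to \<open>p\<close>.\<close>
  moreover have "a < b \<Longrightarrow> (f ^^ a) p = (f ^^ b) p \<Longrightarrow> \<exists>k>0. (f ^^ k) p = p" for a b
  proof (induction a arbitrary: b)
    case (Suc a)
    then obtain b' where b: "b = Suc b'" by (cases b) auto
    with Suc.prems have "f ((f ^^ a) p) = f ((f ^^ b') p)" by simp
    then have "(f ^^ a) p = (f ^^ b') p"
      using assms(2) it[OF assms(3)] by (auto simp: bij_betw_def inj_on_def)
    then show ?case using Suc b by simp
  qed auto
  ultimately obtain k where "k > 0" "(f ^^ k) p = p" by blast
  then show "p \<in> orbit f p" by (auto simp: orbit_altdef) metis
qed

lemma bij_betw_orbit_eq: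
  assumes "finite P" "bij_betw f P P" "p \<in> P" "q \<in> orbit f p"
  shows "orbit f q = orbit f p"
  using bij_betw_self_in_orbit[OF assms(1-3)] assms(4)
  by (meson cyclic_on_def orbit_cyclic_eq3)

lemma card_orbit_pos:
  assumes "finite P" "bij_betw f P P" "p \<in> P"
  shows "card (orbit f p) > 0"
  using bij_betw_self_in_orbit[OF assms] finite_orbit by (auto simp: card_gt_0_iff)

text \<open>The base point chosen by \<open>SOME\<close> depends only on the orbit as a set, hence
  it is the same \<open>r\<close> for all elements of the orbit. Positions count the steps from
  \<open>r\<close>, modulo the length of the cycle.\<close>

lemma cycle_position_enumerates:
  assumes "finite P" "bij_betw f P P" "p \<in> P"
  shows "\<exists>r. (\<forall>q \<in> orbit f p. cycle_position f q < card (orbit f p) \<and> (f ^^ cycle_position f q) r = q) \<and>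
    (\<forall>k. (f ^^ k) r \<in> orbit f p \<and> cycle_position f ((f ^^ k) r) = k mod card (orbit f p))"
proof -
  define r where "r = (SOME q. q \<in> orbit f p)"
  define m where "m = card (orbit f p)"
  note self = bij_betw_self_in_orbit(1)[OF assms]
  have r: "r \<in> orbit f p" unfolding r_def using self by (rule someI)
  have orb: "orbit f r = orbit f p" by (rule bij_betw_orbit_eq[OF assms r])
  have cp: "cycle_position f q = funpow_dist f r q" if "q \<in> orbit f p" for q
    using bij_betw_orbit_eq[OF assms that] by (simp add: cycle_position_def r_def)
  have self_r: "r \<in> orbit f r" using r orb by simp
  have m: "m = funpow_dist1 f r r"
    unfolding m_def orb[symmetric]
    by (subst orbit_conv_funpow_dist1[OF self_r]) (use inj_on_funpow_dist1[OF self_r] in \<open>simp add: card_image\<close>)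
  have per: "(f ^^ m) r = r" unfolding m by (rule funpow_dist1_prop[OF self_r])
  \<comment> \<open>The iterates before the first return are distinct, so no smaller exponent
    reaches the same element.\<close>
  have small: "cycle_position f ((f ^^ k) r) = k" if "k < m" for k
  proof -
    have "(f ^^ k) r \<in> orbit f p" using funpow_in_orbit[OF r] .
    then have "cycle_position f ((f ^^ k) r) = (LEAST j. (f ^^ j) r = (f ^^ k) r)"
      by (simp add: cp funpow_dist_def)
    also have "\<dots> = k"
    proof (rule Least_equality)
      fix j assume "(f ^^ j) r = (f ^^ k) r"
      then show "k \<le> j"
        using inj_on_funpow_dist1[OF self_r] that m unfolding inj_on_def
        by (metis atLeastLessThan_iff le0 le_less_trans less_imp_le_nat nat_le_linear not_le)
    qed simp
    finally show ?thesis .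
  qed
  have red: "(f ^^ k) r = (f ^^ (k mod m)) r" for k
    using per by (simp add: funpow_mod_eq)
  show ?thesis
  proof (intro exI[of _ r] conjI ballI allI)
    fix q assume q: "q \<in> orbit f p"
    then have "q \<in> orbit f r" by (simp add: orb)
    then obtain k where "q = (f ^^ k) r" by (auto simp: orbit_altdef)
    then have "q = (f ^^ (k mod m)) r" "k mod m < m" using red m by auto
    then show "cycle_position f q < card (orbit f p)" "(f ^^ cycle_position f q) r = q"
      using small[of "k mod m"] m_def by simp_all
  next
    fix k
    have "k mod m < m" using m by simp
    then show "(f ^^ k) r \<in> orbit f p" "cycle_position f ((f ^^ k) r) = k mod card (orbit f p)"
      using small[of "k mod m"] red[of k] funpow_in_orbit[OF r] m_def by simp_all
  qed
qed

lemma cycle_position_inj: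
  assumes "finite P" "bij_betw f P P" "p \<in> P" "q \<in> orbit f p" "cycle_position f p = cycle_position f q"
  shows "p = q"
  using cycle_position_enumerates[OF assms(1-3)] assms(4,5) bij_betw_self_in_orbit(1)[OF assms(1-3)] by metis

lemma cycle_position_less:
  assumes "finite P" "bij_betw f P P" "p \<in> P"
  shows "cycle_position f p < card (orbit f p)"
  using cycle_position_enumerates[OF assms] bij_betw_self_in_orbit(1)[OF assms] by metis

lemma cycle_position_step:
  assumes P: "finite P" "bij_betw f P P" "p \<in> P"
  shows "cycle_position f (f p) = Suc (cycle_position f p) mod card (orbit f p)"
proof -
  obtain r where r: "\<And>k. (f ^^ k) r \<in> orbit f p \<and> cycle_position f ((f ^^ k) r) = k mod card (orbit f p)"
    and r2: "(f ^^ cycle_position f p) r = p"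
    using cycle_position_enumerates[OF P] bij_betw_self_in_orbit(1)[OF P] by metis
  show ?thesis
    using r[of "Suc (cycle_position f p)"] r2 by simp
qed

section \<open>Polar coordinates on a disk attached along a cycle\<close>

text \<open>Angles are counted in units of which \<open>N\<close> make a full turn. Below,
  \<open>N\<close> is twice the length of a cycle, so that one unit is one segment of the
  boundary.\<close>

lemma cis_turn_eq_iff:
  fixes N :: real
  assumes "N > 0"
  shows "cis (2 * pi * a / N) = cis (2 * pi * b / N) \<longleftrightarrow> (\<exists>k::int. a = b + N * k)"
proof -
  have "cis (2 * pi * a / N) = cis (2 * pi * b / N) \<longleftrightarrow>
      (\<exists>k::int. 2 * pi * a / N = 2 * pi * b / N + 2 * pi * k)"
    using sin_cos_eq_iff[of "2 * pi * a / N" "2 * pi * b / N"] by (auto simp: complex_eq_iff)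
  also have "\<dots> \<longleftrightarrow> (\<exists>k::int. a = b + N * k)"
  proof (intro ex_cong1)
    fix k :: int
    have "2 * pi * a / N = 2 * pi * b / N + 2 * pi * k \<longleftrightarrow> (2 * pi) * a = (2 * pi) * (b + N * k)"
      using assms by (simp add: field_simps)
    also have "\<dots> \<longleftrightarrow> a = b + N * k" by (subst mult_left_cancel) auto
    finally show "2 * pi * a / N = 2 * pi * b / N + 2 * pi * k \<longleftrightarrow> a = b + N * k" .
  qed
  finally show ?thesis .
qed

text \<open>
  Polar coordinates on half a sector: \<open>\<rho>\<close> is the radius, and the angular offset \<open>\<delta> \<in> [- 1/2, 1/2]\<close>
  is measured from an endpoint of the node segment of \<open>p\<close> (its final one if \<open>e\<close> holds), positive values
  pointing into the adjacent edge segment.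
\<close>

definition sector_point :: "('p \<Rightarrow> 'p) \<Rightarrow> 'p \<Rightarrow> bool \<Rightarrow> real \<Rightarrow> real \<Rightarrow> complex" where
  "sector_point f p e \<rho> \<delta> = of_real \<rho> *
     cis (2 * pi * (2 * real (cycle_position f p) + (if e then 1 + \<delta> else - \<delta>)) / (2 * real (card (orbit f p))))"

lemma norm_sector_point: "norm (sector_point f p e \<rho> \<delta>) = \<bar>\<rho>\<bar>"
  by (simp add: sector_point_def norm_mult)

lemma even_int_between:
  fixes j :: int
  assumes "even j" "\<bar>real_of_int j\<bar> \<le> 1"
  shows "j = 0"
  using assms by (cases "j \<le> -1 \<or> j \<ge> 1") (auto elim!: evenE)

text \<open>Half sectors meet only at the center, along the midline of a node segment
  (\<open>\<delta> = - 1/2\<close>, the two halves of one node) and along the midline of an edge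
  segment (\<open>\<delta> = 1/2\<close>, the final half of a node and the initial half of its
  successor). The reason is that equal angles, in units of segments, differ by a multiple of
  \<open>2 m\<close>.\<close>

lemma sector_point_eqD:
  assumes P: "finite P" "bij_betw f P P" "p \<in> P" and orb: "orbit f p = orbit f q" and q: "q \<in> P"
    and eq: "sector_point f p e \<rho> \<delta> = sector_point f q e' \<rho>' \<delta>'"
    and \<rho>: "0 \<le> \<rho>" "0 \<le> \<rho>'" and \<delta>: "\<bar>\<delta>\<bar> \<le> 1/2" "\<bar>\<delta>'\<bar> \<le> 1/2"
  shows "\<rho> = \<rho>' \<and> (\<rho> = 0 \<or> \<delta> = \<delta>' \<and>
     (p = q \<and> e = e' \<or> \<delta> = - 1/2 \<and> p = q \<or> \<delta> = 1/2 \<and> (e \<and> \<not> e' \<and> q = f p \<or> \<not> e \<and> e' \<and> p = f q)))"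
proof -
  define m where "m = card (orbit f p)"
  define c c' where "c = cycle_position f p" and "c' = cycle_position f q"
  have m0: "m > 0" unfolding m_def by (rule card_orbit_pos[OF P])
  have c: "c < m" "c' < m"
    using cycle_position_less[OF P] cycle_position_less[OF P(1,2) q] orb by (auto simp: m_def c_def c'_def)
  have qp: "q \<in> orbit f p" "p \<in> orbit f q"
    using orb bij_betw_self_in_orbit[OF P] bij_betw_self_in_orbit[OF P(1,2) q] by auto
  have mod_eq: "a = b" if "int a - int b = int m * k" "a < m" "b < m" for a b and k :: int
  proof -
    have "int a mod int m = int b mod int m"
      using that(1) by (metis mod_eq_dvd_iff dvd_triv_left)
    then show ?thesis using that(2,3) by simp
  qed
  \<comment> \<open>Stated as a congruence, the relation between consecutive positions includes the
    step from the last position back to position 0.\<close>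
  have stepm: "y = f x" if "x \<in> P" "y \<in> orbit f x" "card (orbit f x) = m"
      "int (cycle_position f y) - int (Suc (cycle_position f x)) = int m * k" for x y and k :: int
  proof -
    have "int (cycle_position f y) mod int m = int (Suc (cycle_position f x)) mod int m"
      using that(4) by (metis mod_eq_dvd_iff dvd_triv_left)
    then have "cycle_position f y mod m = cycle_position f (f x)"
      using cycle_position_step[OF P(1,2) that(1)] that(3) by (simp flip: zmod_int of_nat_Suc)
    moreover have "y \<in> P" using bij_betw_self_in_orbit(2)[OF P(1,2) that(1)] that(2) by auto
    moreover have "cycle_position f y < m"
      using cycle_position_less[OF P(1,2) \<open>y \<in> P\<close>] that(3) bij_betw_orbit_eq[OF P(1,2) that(1,2)] by simp
    moreover have "f x \<in> orbit f y"
      using bij_betw_orbit_eq[OF P(1,2) that(1,2)] orbit.base[of f x] by simp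
    ultimately show ?thesis
      using cycle_position_inj[OF P(1,2) \<open>y \<in> P\<close>, of "f x"] by simp
  qed
  have "\<rho> = \<rho>'" using eq norm_sector_point \<rho> by (metis abs_of_nonneg)
  moreover have "\<delta> = \<delta>' \<and>
     (p = q \<and> e = e' \<or> \<delta> = - 1/2 \<and> p = q \<or> \<delta> = 1/2 \<and> (e \<and> \<not> e' \<and> q = f p \<or> \<not> e \<and> e' \<and> p = f q))"
    if "\<rho> \<noteq> 0"
  proof -
    have "cis (2 * pi * (2 * real c + (if e then 1 + \<delta> else - \<delta>)) / (2 * real m)) =
        cis (2 * pi * (2 * real c' + (if e' then 1 + \<delta>' else - \<delta>')) / (2 * real m))"
      using eq that \<open>\<rho> = \<rho>'\<close> orb by (simp add: sector_point_def m_def c_def c'_def)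
    then obtain k :: int where k: "2 * real c + (if e then 1 + \<delta> else - \<delta>) =
        2 * real c' + (if e' then 1 + \<delta>' else - \<delta>') + 2 * real m * k"
      using cis_turn_eq_iff[of "2 * real m"] m0 by auto
    \<comment> \<open>\<open>j\<close> collects the integral part of the angle equation. It is even
      and bounded by the offsets, which leaves \<open>0\<close> and, if \<open>e\<close> and
      \<open>e'\<close> differ, one of \<open>2\<close> and \<open>- 2\<close>.\<close>
    define j where "j = 2 * (int c' - int c + int m * k)"
    have j: "even j" "real_of_int j = 2 * real c' - 2 * real c + 2 * real m * k"
      unfolding j_def by (auto simp: algebra_simps)
    consider "e = e'" | "e \<and> \<not> e'" | "\<not> e \<and> e'" by blast
    then show ?thesis
    proof cases
      case 1
      then have "\<bar>real_of_int j\<bar> \<le> 1" "real_of_int j = (if e then \<delta> - \<delta>' else \<delta>' - \<delta>)"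
        using k j \<delta> by (auto split: if_splits)
      then have "j = 0" "\<delta> = \<delta>'" using even_int_between[OF j(1)] by (auto split: if_splits)
      then have "int c - int c' = int m * k" by (simp add: j_def)
      then have "c = c'" using mod_eq c by blast
      then have "p = q" using cycle_position_inj[OF P qp(1)] by (simp add: c_def c'_def)
      then show ?thesis using 1 \<open>\<delta> = \<delta>'\<close> by simp
    next
      case 2
      then have r: "real_of_int j = 1 + \<delta> + \<delta>'" using k j by simp
      then have "j = 0 \<or> j = 2"
      proof -
        have "0 \<le> j" "j \<le> 2" using r \<delta> by linarith+
        then show ?thesis using j(1) by (cases "j = 1") auto
      qed
      then show ?thesis
      proof
        assume "j = 0"
        then have d: "\<delta> = -1/2" "\<delta>' = -1/2" using r \<delta> by (simp, linarith)+
        from \<open>j = 0\<close> have "int c - int c' = int m * k" by (simp add: j_def)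
        then have "c = c'" using mod_eq c by blast
        then have "p = q" using cycle_position_inj[OF P qp(1)] by (simp add: c_def c'_def)
        then show ?thesis using d by simp
      next
        assume "j = 2"
        then have d: "\<delta> = 1/2" "\<delta>' = 1/2" using r \<delta> by (simp, linarith)+
        from \<open>j = 2\<close> have "int c' - int (Suc c) = int m * (- k)" by (simp add: j_def)
        then have "q = f p" by (intro stepm[OF P(3) qp(1), of "- k"]) (simp_all add: c_def c'_def m_def)
        then show ?thesis using d 2 by simp
      qed
    next
      case 3
      then have r: "real_of_int j = - 1 - \<delta> - \<delta>'" using k j by simp
      then have "j = 0 \<or> j = - 2"
      proof -
        have "j \<le> 0" "- 2 \<le> j" using r \<delta> by linarith+
        then show ?thesis using j(1) by (cases "j = - 1") auto
      qed
      then show ?thesis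
      proof
        assume "j = 0"
        then have d: "\<delta> = -1/2" "\<delta>' = -1/2" using r \<delta> by (simp, linarith)+
        from \<open>j = 0\<close> have "int c - int c' = int m * k" by (simp add: j_def)
        then have "c = c'" using mod_eq c by blast
        then have "p = q" using cycle_position_inj[OF P qp(1)] by (simp add: c_def c'_def)
        then show ?thesis using d by simp
      next
        assume "j = - 2"
        then have d: "\<delta> = 1/2" "\<delta>' = 1/2" using r \<delta> by (simp, linarith)+
        from \<open>j = - 2\<close> have "int c - int (Suc c') = int m * k" by (simp add: j_def)
        then have "p = f q" by (intro stepm[OF q qp(2), of k]) (simp_all add: c_def c'_def m_def orb)
        then show ?thesis using d 3 by simp
      qed
    qed
  qed
  ultimately show ?thesis by blast
qed

lemma sector_point_surj:
  assumes P: "finite P" "bij_betw f P P" "p \<in> P"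
  obtains q e \<delta> where "q \<in> orbit f p" "\<bar>\<delta>\<bar> \<le> 1/2" "w = sector_point f q e (norm w) \<delta>"
proof -
  obtain r where r: "\<And>k. (f ^^ k) r \<in> orbit f p \<and> cycle_position f ((f ^^ k) r) = k mod card (orbit f p)"
    using cycle_position_enumerates[OF P] bij_betw_self_in_orbit(1)[OF P] by metis
  define m where "m = card (orbit f p)"
  have m0: "m > 0" unfolding m_def by (rule card_orbit_pos[OF P])
  \<comment> \<open>\<open>\<tau>\<close> is the argument of \<open>w\<close> in units of segments,
    and \<open>J\<close> is the nearest segment end, reduced modulo a full turn. An even
    \<open>J\<close> begins and an odd \<open>J\<close> ends the node segment with number
    \<open>J div 2\<close>. The rounding error becomes \<open>\<delta>\<close>, with the sign that
    makes it positive inside the edge segment.\<close>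
  define \<tau> where "\<tau> = Arg w * (2 * real m) / (2 * pi)"
  define J where "J = round \<tau> mod (2 * int m)"
  define k where "k = nat (J div 2)"
  define \<delta> where "\<delta> = (if odd J then \<tau> - real_of_int (round \<tau>) else real_of_int (round \<tau>) - \<tau>)"
  have J: "0 \<le> J" "J < 2 * int m" using m0 by (auto simp: J_def)
  have km: "k < m" using J by (simp add: k_def)
  have Jk: "real_of_int J = 2 * real k + (if odd J then 1 else 0)"
  proof -
    have "J = 2 * int k + (if odd J then 1 else 0)"
      using J by (simp add: k_def)
    from arg_cong[OF this, of real_of_int] show ?thesis by (cases "odd J") simp_all
  qed
  define n where "n = round \<tau> div (2 * int m)"
  have n: "round \<tau> = J + 2 * int m * n"
    unfolding J_def n_def by (rule mod_mult_div_eq[symmetric])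
  have q: "(f ^^ k) r \<in> orbit f p" "cycle_position f ((f ^^ k) r) = k"
    using r[of k] km by (auto simp: m_def)
  have "w = of_real (norm w) * cis (2 * pi * \<tau> / (2 * real m))"
    using m0 rcis_cmod_Arg[of w] by (simp add: \<tau>_def rcis_def)
  also have "\<dots> = sector_point f ((f ^^ k) r) (odd J) (norm w) \<delta>"
  proof -
    have "real_of_int (round \<tau>) = real_of_int J + 2 * real m * n"
      using arg_cong[OF n, of real_of_int] by simp
    then have "\<tau> = (2 * real k + (if odd J then 1 + \<delta> else - \<delta>)) + 2 * real m * n"
      unfolding Jk by (cases "odd J") (simp_all add: \<delta>_def)
    then have "cis (2 * pi * \<tau> / (2 * real m)) =
        cis (2 * pi * (2 * real k + (if odd J then 1 + \<delta> else - \<delta>)) / (2 * real m))"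
      using m0 by (intro cis_turn_eq_iff[THEN iffD2] exI[of _ n]) simp_all
    then show ?thesis
      using q bij_betw_orbit_eq[OF P q(1)] by (simp add: sector_point_def m_def)
  qed
  finally show thesis
    using that[of "(f ^^ k) r" \<delta> "odd J"] q(1) of_int_round_abs_le[of \<tau>]
    by (simp add: \<delta>_def abs_minus_commute)
qed

lemma node_point_sector_point:
  "node_point f p s = sector_point f p False 1 (- s)"
  "node_point f p s = sector_point f p True 1 (s - 1)"
  by (simp_all add: node_point_def sector_point_def)

lemma edge_point_sector_point:
  "edge_point f p s = sector_point f p True 1 s"
  by (simp add: edge_point_def sector_point_def add.assoc)

lemma edge_point_sector_point_next:
  assumes P: "finite P" "bij_betw f P P" "p \<in> P"
  shows "edge_point f p s = sector_point f (f p) False 1 (1 - s)"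
proof -
  define m where "m = card (orbit f p)"
  have m0: "m > 0" unfolding m_def by (rule card_orbit_pos[OF P])
  have card: "card (orbit f (f p)) = m"
    using self_in_orbit_step[OF bij_betw_self_in_orbit(1)[OF P]] by (simp add: m_def)
  \<comment> \<open>\<open>k\<close> is 1 if \<open>p\<close> has the last position of its cycle and
    0 otherwise.\<close>
  obtain k where k: "Suc (cycle_position f p) = cycle_position f (f p) + m * k"
    using cycle_position_step[OF P] mod_mult_div_eq by (metis m_def)
  have "2 * real (cycle_position f p) + 1 + s =
      2 * real (cycle_position f (f p)) - (1 - s) + 2 * real m * (int k)"
    using arg_cong[OF k, of real] by simp
  then have "cis (2 * pi * (2 * real (cycle_position f p) + 1 + s) / (2 * real m)) =
      cis (2 * pi * (2 * real (cycle_position f (f p)) - (1 - s)) / (2 * real m))"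
    using m0 by (subst cis_turn_eq_iff) (auto intro!: exI[of _ "int k"])
  then show ?thesis
    unfolding edge_point_def sector_point_def card m_def[symmetric] by (simp add: algebra_simps)
qed

lemma sector_point_next:
  assumes P: "finite P" "bij_betw f P P" "p \<in> P"
  shows "sector_point f p True \<rho> (1/2) = sector_point f (f p) False \<rho> (1/2)"
proof -
  have "sector_point f q e \<rho> d = of_real \<rho> * sector_point f q e 1 d" for q e d
    by (simp add: sector_point_def)
  then show ?thesis
    using edge_point_sector_point_next[OF P, of "1/2"] edge_point_sector_point[of f p "1/2"] by simp
qed

lemma sector_point_swap: "sector_point f p True \<rho> (- 1/2) = sector_point f p False \<rho> (- 1/2)"
  by (simp add: sector_point_def)

text \<open>Half a sector parametrized by \<open>[0, 1]\<^sup>2\<close>: the corner \<open>(0, 0)\<close> goes to the center of the disk, the sides \<open>a = 0\<close> and \<open>b = 0\<close> to radii.\<close>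

definition sector_map :: "('p \<Rightarrow> 'p) \<Rightarrow> 'p \<Rightarrow> bool \<Rightarrow> real \<Rightarrow> real \<Rightarrow> complex" where
  "sector_map f p e a b = sector_point f p e (max a b) ((a - b) / (2 * max a b))"

lemma norm_sector_map: "norm (sector_map f p e a b) = \<bar>max a b\<bar>"
  by (simp add: sector_map_def norm_sector_point)

lemma offset_bound:
  fixes a b :: real
  assumes "0 \<le> a" "0 \<le> b"
  shows "\<bar>(a - b) / (2 * max a b)\<bar> \<le> 1/2"
proof (cases "max a b = 0")
  case False
  with assms have "max a b > 0" "\<bar>a - b\<bar> \<le> max a b" by (auto simp: max_def)
  then show ?thesis by (simp add: abs_le_iff field_simps)
qed simp

text \<open>At the center the angle has no limit and its formula divides by zero, but the radius
  tends to 0 there. Elsewhere all ingredients of the formula are continuous.\<close>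

lemma sector_map_continuous:
  assumes "continuous_on S u" "continuous_on S v" and pos: "\<And>x. x \<in> S \<Longrightarrow> 0 \<le> u x \<and> 0 \<le> v x"
  shows "continuous_on S (\<lambda>x. sector_map f p e (u x) (v x))"
proof (unfold continuous_on_def, intro ballI)
  fix x assume x: "x \<in> S"
  have uv: "(u \<longlongrightarrow> u x) (at x within S)" "(v \<longlongrightarrow> v x) (at x within S)"
    using assms(1,2) x by (auto simp: continuous_on)
  show "((\<lambda>x. sector_map f p e (u x) (v x)) \<longlongrightarrow> sector_map f p e (u x) (v x)) (at x within S)"
  proof (cases "max (u x) (v x) = 0")
    case False
    define D where "D y = (u y - v y) / (2 * max (u y) (v y))" for y
    define A N where "A = 2 * real (cycle_position f p)" and "N = inverse (2 * real (card (orbit f p)))"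
    define \<Theta> where "\<Theta> y = 2 * pi * (A + (if e then 1 + D y else - D y)) * N" for y
    have M: "((\<lambda>y. max (u y) (v y)) \<longlongrightarrow> max (u x) (v x)) (at x within S)"
      by (rule tendsto_max[OF uv])
    have D: "(D \<longlongrightarrow> D x) (at x within S)"
      unfolding D_def using False
      by (intro tendsto_divide tendsto_diff tendsto_mult tendsto_const uv M) simp
    have "((\<lambda>y. if e then 1 + D y else - D y) \<longlongrightarrow> (if e then 1 + D x else - D x)) (at x within S)"
      using tendsto_add[OF tendsto_const D, of 1] tendsto_minus[OF D] by (cases e) simp_all
    then have "(\<Theta> \<longlongrightarrow> \<Theta> x) (at x within S)"
      unfolding \<Theta>_def by (intro tendsto_mult tendsto_add tendsto_const)
    then have "((\<lambda>y. cis (\<Theta> y)) \<longlongrightarrow> cis (\<Theta> x)) (at x within S)"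
      unfolding cis_conv_exp by (intro tendsto_exp tendsto_mult tendsto_of_real tendsto_const)
    then have "((\<lambda>y. of_real (max (u y) (v y)) * cis (\<Theta> y)) \<longlongrightarrow> of_real (max (u x) (v x)) * cis (\<Theta> x)) (at x within S)"
      by (intro tendsto_mult tendsto_of_real M)
    then show ?thesis
      by (simp only: sector_map_def sector_point_def divide_inverse \<Theta>_def D_def A_def N_def)
  next
    case True
    then have "sector_map f p e (u x) (v x) = 0"
      using norm_sector_map[of f p e "u x" "v x"] by simp
    moreover have "((\<lambda>y. \<bar>max (u y) (v y)\<bar>) \<longlongrightarrow> \<bar>max (u x) (v x)\<bar>) (at x within S)"
      by (rule tendsto_rabs[OF tendsto_max[OF uv]])
    then have "((\<lambda>y. norm (sector_map f p e (u y) (v y))) \<longlongrightarrow> 0) (at x within S)"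
      unfolding norm_sector_map True abs_zero .
    then have "((\<lambda>y. sector_map f p e (u y) (v y)) \<longlongrightarrow> 0) (at x within S)"
      by (rule tendsto_norm_zero_cancel)
    ultimately show ?thesis
      by simp
  qed
qed

lemma offset_coords:
  fixes a b a' b' :: real
  assumes "0 \<le> a" "0 \<le> b" "0 \<le> a'" "0 \<le> b'" "max a b = max a' b'" "max a b \<noteq> 0"
    "(a - b) / (2 * max a b) = (a' - b') / (2 * max a' b')"
  shows "a = a' \<and> b = b'"
proof -
  have "a - b = a' - b'" using assms(5-7) by auto
  then show ?thesis using assms(5) by (auto simp: max_def split: if_splits)
qed

text \<open>Away from the center the offsets \<open>- 1/2\<close> and \<open>1/2\<close> are the
  sides \<open>a = 0\<close> and \<open>b = 0\<close> of the square; at the center both coordinates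
  vanish.\<close>

lemma sector_map_eqD:
  assumes P: "finite P" "bij_betw f P P" "p \<in> P" and orb: "orbit f p = orbit f q" and q: "q \<in> P"
    and eq: "sector_map f p e a b = sector_map f q e' a' b'"
    and nn: "0 \<le> a" "0 \<le> b" "0 \<le> a'" "0 \<le> b'"
  shows "a = a' \<and> b = b' \<and> (a = 0 \<and> b = 0 \<or> p = q \<and> e = e' \<or> a = 0 \<and> p = q \<or>
     b = 0 \<and> (e \<and> \<not> e' \<and> q = f p \<or> \<not> e \<and> e' \<and> p = f q))"
proof -
  have mx: "0 \<le> max a b" "0 \<le> max a' b'" using nn by auto
  have *: "max a b = max a' b' \<and> (max a b = 0 \<or> (a - b) / (2 * max a b) = (a' - b') / (2 * max a' b') \<and>
     (p = q \<and> e = e' \<or> (a - b) / (2 * max a b) = - 1/2 \<and> p = q \<or>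
      (a - b) / (2 * max a b) = 1/2 \<and> (e \<and> \<not> e' \<and> q = f p \<or> \<not> e \<and> e' \<and> p = f q)))"
    using sector_point_eqD[OF P orb q eq[unfolded sector_map_def] mx offset_bound[OF nn(1,2)] offset_bound[OF nn(3,4)]] .
  show ?thesis
  proof (cases "max a b = 0")
    case True
    then show ?thesis using * nn by (auto simp: max_def split: if_splits)
  next
    case False
    then have "a = a' \<and> b = b'" using offset_coords[OF nn] * by blast
    moreover have "a = 0" if "(a - b) / (2 * max a b) = - 1/2"
      using that False nn by (auto simp: field_simps max_def split: if_splits)
    moreover have "b = 0" if "(a - b) / (2 * max a b) = 1/2"
      using that False nn by (auto simp: field_simps max_def split: if_splits)
    ultimately show ?thesis using * False by blast
  qed
qed

lemma sector_map_surj: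
  assumes P: "finite P" "bij_betw f P P" "p \<in> P" and w: "norm w \<le> 1"
  obtains q e a b where "q \<in> orbit f p" "a \<in> {0..1}" "b \<in> {0..1}" "w = sector_map f q e a b"
proof -
  obtain q e \<delta> where q: "q \<in> orbit f p" "\<bar>\<delta>\<bar> \<le> 1/2" "w = sector_point f q e (norm w) \<delta>"
    using sector_point_surj[OF P] .
  \<comment> \<open>Chosen so that the larger of \<open>a\<close> and \<open>b\<close> is
    \<open>norm w\<close> and \<open>a - b\<close> is \<open>2 * norm w * \<delta>\<close>, which
    recovers radius and offset.\<close>
  define a b where "a = (if \<delta> \<ge> 0 then norm w else norm w * (1 + 2 * \<delta>))"
    and "b = (if \<delta> \<ge> 0 then norm w * (1 - 2 * \<delta>) else norm w)"
  have "norm w * (1 + 2 * \<delta>) \<le> norm w" if "\<delta> \<le> 0" using that by (intro mult_left_le) auto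
  moreover have "norm w * (1 - 2 * \<delta>) \<le> norm w" if "\<delta> \<ge> 0" using that by (intro mult_left_le) auto
  ultimately have m: "max a b = norm w"
    by (cases "\<delta> \<ge> 0") (simp_all add: a_def b_def max.absorb1 max.absorb2)
  have ab: "a \<in> {0..1}" "b \<in> {0..1}"
    using q(2) w m by (auto simp: a_def b_def max_def split: if_splits)
  have "w = sector_map f q e a b"
  proof (cases "w = 0")
    case False
    have "a - b = 2 * norm w * \<delta>" by (simp add: a_def b_def algebra_simps)
    then show ?thesis using q(3) m False by (simp add: sector_map_def)
  qed (use m in \<open>simp add: sector_map_def sector_point_def\<close>)
  then show thesis using that q(1) ab by blast
qed

section \<open>Passages of a link diagram\<close>

locale link_diagram =
  fixes n :: nat and \<Gamma> :: link_param
  assumes link: "oriented_link n \<Gamma>" and regular: "regular_projection n \<Gamma>"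
begin

lemma finite_crossings: "finite (crossings n \<Gamma>)"
  using regular by (simp add: regular_projection_def)

lemma finite_passages: "finite (passages n \<Gamma>)"
  by (simp add: passages_def finite_crossings)

lemma crossingsD:
  assumes "(p, q) \<in> crossings n \<Gamma>"
  shows "p \<in> {..<n} \<times> {0..<1}" "q \<in> {..<n} \<times> {0..<1}" "plane_point \<Gamma> p = plane_point \<Gamma> q"
    "snd (space_point \<Gamma> p) > snd (space_point \<Gamma> q)" "p \<noteq> q"
  using assms by (auto simp: crossings_def)

lemma passage_cases:
  assumes "p \<in> passages n \<Gamma>"
  obtains q where "(p, q) \<in> crossings n \<Gamma>" | q where "(q, p) \<in> crossings n \<Gamma>"
  using assms by (auto simp: passages_def)

lemma passages_param: "p \<in> passages n \<Gamma> \<Longrightarrow> p \<in> {..<n} \<times> {0..<1}"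
  by (erule passage_cases) (use crossingsD(1,2) in blast)+

lemma double_point:
  assumes "p \<in> {..<n} \<times> {0..<1}" "q \<in> {..<n} \<times> {0..<1}" "r \<in> {..<n} \<times> {0..<1}"
    and "plane_point \<Gamma> p = plane_point \<Gamma> q" "plane_point \<Gamma> p = plane_point \<Gamma> r" "p \<noteq> q" "p \<noteq> r"
  shows "q = r"
proof (rule ccontr)
  assume "q \<noteq> r"
  let ?A = "{s \<in> {..<n} \<times> {0..<1}. plane_point \<Gamma> s = plane_point \<Gamma> p}"
  have A: "finite ?A" "card ?A \<le> 2" using regular unfolding regular_projection_def by blast+
  have "{p, q, r} \<subseteq> ?A" using assms by auto
  then have "card {p, q, r} \<le> 2" using card_mono[OF A(1)] A(2) by (meson order_trans)
  then show False using \<open>q \<noteq> r\<close> assms(6,7) by simp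
qed

text \<open>The link is embedded, so two strands over the same point of the plane have different
  heights, and the heights decide which strand is the over strand.\<close>

lemma double_point_passage:
  assumes "p \<in> {..<n} \<times> {0..<1}" "q \<in> {..<n} \<times> {0..<1}" "plane_point \<Gamma> p = plane_point \<Gamma> q" "p \<noteq> q"
  shows "(p, q) \<in> crossings n \<Gamma> \<or> (q, p) \<in> crossings n \<Gamma>"
proof -
  have "space_point \<Gamma> p \<noteq> space_point \<Gamma> q"
  proof
    assume "space_point \<Gamma> p = space_point \<Gamma> q"
    moreover have "inj_on (\<lambda>(i, t). \<Gamma> i t) ({..<n} \<times> {0..<1})"
      using link by (simp add: oriented_link_def)
    ultimately show False
      using assms inj_onD[of "\<lambda>(i, t). \<Gamma> i t" "{..<n} \<times> {0..<1}" p q]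
      by (simp add: space_point_def case_prod_beta)
  qed
  then have "snd (space_point \<Gamma> p) \<noteq> snd (space_point \<Gamma> q)"
    using assms(3) by (auto simp: plane_point_def prod_eq_iff)
  then show ?thesis
    using assms by (auto simp: crossings_def)
qed

lemma crossing_partner:
  assumes "(p, q) \<in> crossings n \<Gamma>" "(p, r) \<in> crossings n \<Gamma> \<or> (r, p) \<in> crossings n \<Gamma>"
  shows "r = q"
  using assms double_point[of p q r] crossingsD by metis

lemma crossing_partner':
  assumes "(q, p) \<in> crossings n \<Gamma>" "(p, r) \<in> crossings n \<Gamma> \<or> (r, p) \<in> crossings n \<Gamma>"
  shows "r = q"
  using assms double_point[of p q r] crossingsD by metis

lemma other_passage_crossing:
  assumes "(p, q) \<in> crossings n \<Gamma>"
  shows "other_passage n \<Gamma> p = q" "other_passage n \<Gamma> q = p"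
  unfolding other_passage_def
  by (rule the_equality; use assms crossing_partner crossing_partner' in blast)+

lemma over_not_under:
  assumes "(p, q) \<in> crossings n \<Gamma>"
  shows "p \<in> fst ` crossings n \<Gamma>" "q \<notin> fst ` crossings n \<Gamma>" "p \<notin> snd ` crossings n \<Gamma>"
proof -
  show "p \<in> fst ` crossings n \<Gamma>" using assms by force
  show "q \<notin> fst ` crossings n \<Gamma>"
  proof
    assume "q \<in> fst ` crossings n \<Gamma>"
    then obtain r where "(q, r) \<in> crossings n \<Gamma>" by auto
    moreover from this have "r = p" using crossing_partner'[OF assms] by blast
    ultimately show False using crossingsD(4)[OF assms] crossingsD(4)[of q p] by simp
  qed
  show "p \<notin> snd ` crossings n \<Gamma>"
  proof
    assume "p \<in> snd ` crossings n \<Gamma>"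
    then obtain r where "(r, p) \<in> crossings n \<Gamma>" by auto
    moreover from this have "r = q" using crossing_partner[OF assms] by blast
    ultimately show False using crossingsD(4)[OF assms] crossingsD(4)[of q p] by simp
  qed
qed

lemma crossing_of_crossing:
  assumes "(p, q) \<in> crossings n \<Gamma>"
  shows "crossing_of n \<Gamma> p = (p, q)" "crossing_of n \<Gamma> q = (p, q)"
  using other_passage_crossing[OF assms] over_not_under[OF assms] by (simp_all add: crossing_of_def)

lemma crossing_passages:
  assumes "(p, q) \<in> crossings n \<Gamma>"
  shows "p \<in> passages n \<Gamma>" "q \<in> passages n \<Gamma>"
  using assms by (force simp: passages_def)+

lemma other_passage:
  assumes "p \<in> passages n \<Gamma>"
  shows "other_passage n \<Gamma> p \<in> passages n \<Gamma>" "other_passage n \<Gamma> (other_passage n \<Gamma> p) = p"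
    "other_passage n \<Gamma> p \<noteq> p" "crossing_of n \<Gamma> (other_passage n \<Gamma> p) = crossing_of n \<Gamma> p"
    "other_passage n \<Gamma> p \<in> fst ` crossings n \<Gamma> \<longleftrightarrow> p \<notin> fst ` crossings n \<Gamma>"
    "crossing_of n \<Gamma> p \<in> crossings n \<Gamma>"
proof -
  have "other_passage n \<Gamma> p \<in> passages n \<Gamma> \<and> other_passage n \<Gamma> (other_passage n \<Gamma> p) = p \<and>
    other_passage n \<Gamma> p \<noteq> p \<and> crossing_of n \<Gamma> (other_passage n \<Gamma> p) = crossing_of n \<Gamma> p \<and>
    (other_passage n \<Gamma> p \<in> fst ` crossings n \<Gamma> \<longleftrightarrow> p \<notin> fst ` crossings n \<Gamma>) \<and>
    crossing_of n \<Gamma> p \<in> crossings n \<Gamma>"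
    using assms
  proof (cases rule: passage_cases)
    case (1 q)
    then show ?thesis
      using other_passage_crossing[OF 1] crossing_of_crossing[OF 1] crossingsD(5)[OF 1]
        over_not_under(1,2)[OF 1] crossing_passages[OF 1] by simp
  next
    case (2 q)
    then show ?thesis
      using other_passage_crossing[OF 2] crossing_of_crossing[OF 2] crossingsD(5)[OF 2]
        over_not_under(1,2)[OF 2] crossing_passages[OF 2] by simp
  qed
  then show "other_passage n \<Gamma> p \<in> passages n \<Gamma>" "other_passage n \<Gamma> (other_passage n \<Gamma> p) = p"
    "other_passage n \<Gamma> p \<noteq> p" "crossing_of n \<Gamma> (other_passage n \<Gamma> p) = crossing_of n \<Gamma> p"
    "other_passage n \<Gamma> p \<in> fst ` crossings n \<Gamma> \<longleftrightarrow> p \<notin> fst ` crossings n \<Gamma>"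
    "crossing_of n \<Gamma> p \<in> crossings n \<Gamma>"
    by blast+
qed

lemma crossing_of_eqD:
  assumes "p \<in> passages n \<Gamma>" "q \<in> passages n \<Gamma>" "crossing_of n \<Gamma> p = crossing_of n \<Gamma> q"
  shows "q = p \<or> q = other_passage n \<Gamma> p"
  using assms(1)
proof (cases rule: passage_cases)
  case (1 r)
  show ?thesis
    by (rule passage_cases[OF assms(2)])
      (use 1 assms(3) in \<open>auto simp: other_passage_crossing crossing_of_crossing\<close>)
next
  case (2 r)
  show ?thesis
    by (rule passage_cases[OF assms(2)])
      (use 2 assms(3) in \<open>auto simp: other_passage_crossing crossing_of_crossing\<close>)
qed

lemma bij_betw_other_passage: "bij_betw (other_passage n \<Gamma>) (passages n \<Gamma>) (passages n \<Gamma>)"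
  by (rule bij_betwI[of _ _ _ "other_passage n \<Gamma>"]) (auto simp: other_passage)

section \<open>Order of the passages along a component\<close>

text \<open>The parameter is kept before its reduction by \<open>frac\<close>, so that the edge
  leaving \<open>p\<close> is an interval of the real line even if it runs across an
  integer.\<close>

definition next_time :: "passage \<Rightarrow> real" where
  "next_time p = Inf {s. s > snd p \<and> (fst p, frac s) \<in> passages n \<Gamma>}"

lemma next_on_link_next_time: "next_on_link n \<Gamma> p = (fst p, frac (next_time p))"
  by (simp add: next_on_link_def next_time_def)

lemma next_time:
  assumes p: "p \<in> passages n \<Gamma>"
  shows "snd p < next_time p" "next_time p \<le> snd p + 1" "(fst p, frac (next_time p)) \<in> passages n \<Gamma>"
    "\<And>s. snd p < s \<Longrightarrow> s < next_time p \<Longrightarrow> (fst p, frac s) \<notin> passages n \<Gamma>"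
proof -
  let ?S = "{s. s > snd p \<and> (fst p, frac s) \<in> passages n \<Gamma>}"
  \<comment> \<open>Within one full turn there are only finitely many candidates, so the infimum is
    a minimum.\<close>
  define F where "F = {s \<in> ?S. s \<le> snd p + 1}"
  have p01: "0 \<le> snd p" "snd p < 1" using passages_param[OF p] by auto
  have "F \<subseteq> (\<lambda>(q, k). snd q + real_of_int k) ` (passages n \<Gamma> \<times> {0..1})"
  proof
    fix s assume "s \<in> F"
    then have s: "snd p < s" "s \<le> snd p + 1" "(fst p, frac s) \<in> passages n \<Gamma>" by (auto simp: F_def)
    moreover have "\<lfloor>s\<rfloor> \<in> {0..1}" using s p01 by (auto simp: le_floor_iff floor_le_iff)
    moreover have "s = frac s + real_of_int \<lfloor>s\<rfloor>" by (simp add: frac_def)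
    ultimately show "s \<in> (\<lambda>(q, k). snd q + real_of_int k) ` (passages n \<Gamma> \<times> {0..1})"
      by (intro image_eqI[of _ _ "((fst p, frac s), \<lfloor>s\<rfloor>)"]) auto
  qed
  then have fin: "finite F" by (rule finite_subset) (simp add: finite_passages)
  have "frac (snd p + 1) = snd p" using p01 by (simp add: frac_eq frac_1_eq)
  \<comment> \<open>A full turn returns to \<open>p\<close>, hence \<open>F\<close> is nonempty even
    if the component has no other passage.\<close>
  then have one: "snd p + 1 \<in> F" using p by (simp add: F_def)
  then have mem: "Min F \<in> F" using fin by (intro Min_in) auto
  have low: "Min F \<le> s" if "s \<in> ?S" for s
  proof (cases "s \<le> snd p + 1")
    case True then show ?thesis using that fin by (intro Min_le) (auto simp: F_def)
  next
    case False then show ?thesis using Min_le[OF fin one] by simp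
  qed
  have "next_time p = Min F"
    unfolding next_time_def
    by (rule cInf_eq_minimum) (use mem low in \<open>auto simp: F_def\<close>)
  then show "snd p < next_time p" "next_time p \<le> snd p + 1" "(fst p, frac (next_time p)) \<in> passages n \<Gamma>"
    "\<And>s. snd p < s \<Longrightarrow> s < next_time p \<Longrightarrow> (fst p, frac s) \<notin> passages n \<Gamma>"
    using mem low by (force simp: F_def)+
qed

lemma bij_betw_next_on_link: "bij_betw (next_on_link n \<Gamma>) (passages n \<Gamma>) (passages n \<Gamma>)"
proof -
  have maps: "next_on_link n \<Gamma> ` passages n \<Gamma> \<subseteq> passages n \<Gamma>"
    using next_time(3) by (auto simp: next_on_link_next_time)
  \<comment> \<open>If \<open>q\<close> comes after \<open>p\<close>, the successor of
    \<open>p\<close> is not later than \<open>q\<close>, and the successor of \<open>q\<close> is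
    not later than \<open>p\<close> one turn on. The two times are therefore different and less than
    1 apart, so they have different fractional parts.\<close>
  have contra: False if p: "p \<in> passages n \<Gamma>" and q: "q \<in> passages n \<Gamma>" and lt: "snd p < snd q"
    and eq: "next_on_link n \<Gamma> p = next_on_link n \<Gamma> q" for p q
  proof -
    have f: "fst q = fst p" "frac (next_time p) = frac (next_time q)"
      using eq by (simp_all add: next_on_link_next_time)
    have q01: "0 \<le> snd q" "snd q < 1" using passages_param[OF q] by auto
    have p01: "0 \<le> snd p" "snd p < 1" using passages_param[OF p] by auto
    have 1: "next_time p \<le> snd q"
    proof (rule ccontr)
      assume "\<not> next_time p \<le> snd q"
      then have "(fst p, frac (snd q)) \<notin> passages n \<Gamma>" using lt by (intro next_time(4)[OF p]) auto
      moreover have "(fst p, frac (snd q)) = q" using q01 f(1) by (simp add: frac_eq prod_eq_iff)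
      ultimately show False using q by simp
    qed
    have 2: "next_time q \<le> snd p + 1"
    proof (rule ccontr)
      assume "\<not> next_time q \<le> snd p + 1"
      then have "(fst q, frac (snd p + 1)) \<notin> passages n \<Gamma>" using q01 p01 by (intro next_time(4)[OF q]) auto
      then show False using p p01 f(1) by (simp add: frac_eq frac_1_eq)
    qed
    have "next_time p < next_time q" "next_time q - next_time p < 1"
      using 1 2 next_time(1)[OF p] next_time(1)[OF q] by linarith+
    moreover have "next_time q - next_time p = real_of_int (\<lfloor>next_time q\<rfloor> - \<lfloor>next_time p\<rfloor>)"
      using f(2) by (simp add: frac_def)
    ultimately have "0 < \<lfloor>next_time q\<rfloor> - \<lfloor>next_time p\<rfloor>" "\<lfloor>next_time q\<rfloor> - \<lfloor>next_time p\<rfloor> < 1"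
      by linarith+
    then show False by simp
  qed
  have "inj_on (next_on_link n \<Gamma>) (passages n \<Gamma>)"
  proof (intro inj_onI prod_eqI)
    fix p q assume *: "p \<in> passages n \<Gamma>" "q \<in> passages n \<Gamma>" "next_on_link n \<Gamma> p = next_on_link n \<Gamma> q"
    then show "fst p = fst q" by (simp add: next_on_link_next_time)
    show "snd p = snd q"
      using contra[OF *(1,2) _ *(3)] contra[OF *(2,1) _ *(3)[symmetric]] by (meson linorder_cases)
  qed
  then show ?thesis
    using maps finite_passages by (simp add: bij_betw_def endo_inj_surj)
qed

lemma next_on_seifert_conv: "next_on_seifert n \<Gamma> = next_on_link n \<Gamma> \<circ> other_passage n \<Gamma>"
  by (auto simp: next_on_seifert_def)

lemma bij_betw_next_on_seifert: "bij_betw (next_on_seifert n \<Gamma>) (passages n \<Gamma>) (passages n \<Gamma>)"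
  unfolding next_on_seifert_conv
  by (rule bij_betw_trans[OF bij_betw_other_passage bij_betw_next_on_link])

lemma next_on_link_in: "p \<in> passages n \<Gamma> \<Longrightarrow> next_on_link n \<Gamma> p \<in> passages n \<Gamma>"
  using bij_betw_next_on_link bij_betwE by blast

lemma next_on_seifert_other:
  "p \<in> passages n \<Gamma> \<Longrightarrow> next_on_seifert n \<Gamma> (other_passage n \<Gamma> p) = next_on_link n \<Gamma> p"
  by (simp add: next_on_seifert_def other_passage)

lemma next_on_link_surj:
  assumes "q \<in> passages n \<Gamma>"
  obtains p where "p \<in> passages n \<Gamma>" "next_on_link n \<Gamma> p = q"
  using assms bij_betw_next_on_link unfolding bij_betw_def by (metis imageE)

end

section \<open>Subdivision into flags\<close>

text \<open>
  A semi-edge \<open>(p, e)\<close> is the end of a diagram edge at the passage \<open>p\<close>; it is outgoing if \<open>e\<close> holds.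
  Every semi-edge carries a triangle whose vertices are the center of a Seifert disk, the center of a
  capping disk and the center of a band.  A point of it has homogeneous barycentric coordinates
  \<open>(x, y, z)\<close>, normalized by \<open>max x (max y z) = 1\<close>; the three quadrilaterals \<open>x = 1\<close>, \<open>y = 1\<close> and
  \<open>z = 1\<close> lie in the Seifert disk, in the capping disk and in the band, respectively.
\<close>

type_synonym flag_point = "((passage \<times> bool) \<times> nat) \<times> real \<times> real \<times> real"

fun cube_face :: "nat \<Rightarrow> (real \<times> real \<times> real) set" where
  "cube_face 0 = {1} \<times> {0..1} \<times> {0..1}"
| "cube_face (Suc 0) = {0..1} \<times> {1} \<times> {0..1}"
| "cube_face (Suc (Suc _)) = {0..1} \<times> {0..1} \<times> {1}"

lemma cube_face_2 [simp]: "cube_face 2 = {0..1} \<times> {0..1} \<times> {1}"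
  by (simp add: numeral_2_eq_2)

lemma compact_cube_face: "compact (cube_face i)"
  by (cases i rule: cube_face.cases) (auto intro!: compact_Times)

lemma cube_faceD:
  assumes "(x, y, z) \<in> cube_face i"
  shows "x \<in> {0..1}" "y \<in> {0..1}" "z \<in> {0..1}" "x = 1 \<or> y = 1 \<or> z = 1"
  using assms by (cases i rule: cube_face.cases; auto)+

lemma cube_face_proportional:
  assumes "(x, y, z) \<in> cube_face i" "(x', y', z') \<in> cube_face j"
    and "x * s' = x' * s" "y * s' = y' * s" "z * s' = z' * s" "s > 0" "s' > 0"
  shows "x = x' \<and> y = y' \<and> z = z'"
proof -
  note D = cube_faceD[OF assms(1)] cube_faceD[OF assms(2)]
  have le: "u * s' \<le> s'" "u * s \<le> s" if "u \<in> {0..1}" for u :: real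
    using that assms(6,7) by (auto intro: mult_left_le_one_le)
  have "s' \<le> s"
    using D(4) assms(3-5) le(2)[OF D(5)] le(2)[OF D(6)] le(2)[OF D(7)] by auto
  moreover have "s \<le> s'"
    using D(8) assms(3-5) le(1)[OF D(1)] le(1)[OF D(2)] le(1)[OF D(3)] by auto
  ultimately have "s = s'" by simp
  then show ?thesis using assms(3-7) by simp
qed

context link_diagram
begin

definition semi_edges :: "(passage \<times> bool) set" where
  "semi_edges = passages n \<Gamma> \<times> UNIV"

definition flag_space :: "flag_point topology" where
  "flag_space = sum_topology (\<lambda>(h, i). top_of_set (cube_face i)) (semi_edges \<times> {0, 1, 2})"

text \<open>The last three rules are the sides of the triangle of a flag. On \<open>x = 0\<close>,
  from the capping center to the band center, the two ends at \<open>p\<close> meet. On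
  \<open>y = 0\<close>, from the Seifert center to the band center, the incoming and the outgoing
  end meet that a Seifert circle connects at the crossing. On \<open>z = 0\<close>, from the Seifert
  center to the capping center, the two ends of an edge of the diagram meet. The rule
  \<open>face\<close> joins the quadrilaterals of a single flag.\<close>

inductive flag_step :: "flag_point \<Rightarrow> flag_point \<Rightarrow> bool" where
  face: "p \<in> passages n \<Gamma> \<Longrightarrow> i \<in> {0, 1, 2} \<Longrightarrow> j \<in> {0, 1, 2} \<Longrightarrow> w \<in> cube_face i \<Longrightarrow> w \<in> cube_face j \<Longrightarrow>
    flag_step (((p, e), i), w) (((p, e), j), w)"
| turn: "p \<in> passages n \<Gamma> \<Longrightarrow> i \<in> {0, 1, 2} \<Longrightarrow> (0, y, z) \<in> cube_face i \<Longrightarrow>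
    flag_step (((p, e), i), (0, y, z)) (((p, \<not> e), i), (0, y, z))"
| other: "p \<in> passages n \<Gamma> \<Longrightarrow> i \<in> {0, 1, 2} \<Longrightarrow> (x, 0, z) \<in> cube_face i \<Longrightarrow>
    flag_step (((p, e), i), (x, 0, z)) (((other_passage n \<Gamma> p, \<not> e), i), (x, 0, z))"
| along: "p \<in> passages n \<Gamma> \<Longrightarrow> i \<in> {0, 1, 2} \<Longrightarrow> (x, y, 0) \<in> cube_face i \<Longrightarrow>
    flag_step (((p, True), i), (x, y, 0)) (((next_on_link n \<Gamma> p, False), i), (x, y, 0))"

definition flag_gluing :: "(flag_point \<times> flag_point) set" where
  "flag_gluing = {(a, b). flag_step a b}"

lemma flag_gluingI: "flag_step a b \<Longrightarrow> (a, b) \<in> generated_equiv flag_gluing"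
  by (rule generated_equiv_base) (simp add: flag_gluing_def)

abbreviation flag_equiv :: "flag_point \<Rightarrow> flag_point \<Rightarrow> bool" where
  "flag_equiv a b \<equiv> (a, b) \<in> generated_equiv flag_gluing"

lemmas flag_equiv_face = flag_step.face[THEN flag_gluingI]
lemmas flag_equiv_turn = flag_step.turn[THEN flag_gluingI]
lemmas flag_equiv_other = flag_step.other[THEN flag_gluingI]
lemmas flag_equiv_next = flag_step.along[THEN flag_gluingI]

lemma topspace_flag_space_iff:
  "(((p, e), i), w) \<in> topspace flag_space \<longleftrightarrow> p \<in> passages n \<Gamma> \<and> i \<in> {0, 1, 2} \<and> w \<in> cube_face i"
  by (simp add: flag_space_def semi_edges_def)

lemma flag_space_cases:
  assumes "a \<in> topspace flag_space"
  obtains p e i x y z where "a = (((p, e), i), (x, y, z))" "p \<in> passages n \<Gamma>" "i \<in> {0, 1, 2}" "(x, y, z) \<in> cube_face i"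
  using assms topspace_flag_space_iff by (metis surj_pair)

lemma topspace_flag_spaceI:
  "p \<in> passages n \<Gamma> \<Longrightarrow> i \<in> {0, 1, 2} \<Longrightarrow> w \<in> cube_face i \<Longrightarrow> (((p, e), i), w) \<in> topspace flag_space"
  by (simp add: topspace_flag_space_iff)

lemma compact_flag_space: "compact_space flag_space"
  unfolding flag_space_def
proof (rule compact_space_sum_topology)
  show "finite (semi_edges \<times> {0, 1, 2::nat})"
    unfolding semi_edges_def by (intro finite_cartesian_product finite_passages) simp_all
  show "compact_space (case hi of (h, i) \<Rightarrow> top_of_set (cube_face i))" for hi :: "(passage \<times> bool) \<times> nat"
    using compact_cube_face[of "snd hi"]
    unfolding case_prod_beta by (simp only: compact_space_subtopology compactin_euclidean_iff)
qed

section \<open>The glued triangles as a quotient of the flags\<close>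

text \<open>
  By the sign conventions of \<open>\<psi>\<close> the triangle of a semi-edge is the positive one if \<open>positive_side\<close> holds,
  and the capping vertex of the semi-edge has index 1 for an under passage and 2 for an over passage.
\<close>

definition positive_side :: "passage \<Rightarrow> bool \<Rightarrow> bool" where
  "positive_side p e \<longleftrightarrow> (e = (crossing_sign \<Gamma> (crossing_of n \<Gamma> p) = 1)) \<noteq> (p \<in> fst ` crossings n \<Gamma>)"

definition capping_vertex :: "passage \<Rightarrow> nat" where
  "capping_vertex p = (if p \<in> fst ` crossings n \<Gamma> then 2 else 1)"

lemma capping_vertex_12: "capping_vertex p = 1 \<or> capping_vertex p = 2"
  by (simp add: capping_vertex_def)

text \<open>The two ends between which a Seifert circle turns at a crossing share a triangle, with
  the roles of the vertices 1 and 2 exchanged.\<close>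

lemma other_passage_triangle:
  assumes "p \<in> passages n \<Gamma>"
  shows "positive_side (other_passage n \<Gamma> p) (\<not> e) = positive_side p e"
    "capping_vertex (other_passage n \<Gamma> p) = 3 - capping_vertex p"
  using other_passage[OF assms] by (auto simp: positive_side_def capping_vertex_def)

lemma positive_side_Not: "positive_side p (\<not> e) = (\<not> positive_side p e)"
  by (auto simp: positive_side_def)

lemma positive_side_eq_iff: "positive_side p e = positive_side p e' \<longleftrightarrow> e = e'"
  by (auto simp: positive_side_def)

lemma positive_side_surj:
  obtains e where "positive_side p e = b"
  by (cases "positive_side p True = b") (use positive_side_Not[of p True] in auto)

section \<open>Pairing of the sides of the triangles\<close>

text \<open>A side has the number of the opposite vertex. The side from the Seifert center, vertex
  0, to the capping vertex of \<open>p\<close> is therefore numbered by the remaining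
  vertex.\<close>

fun semi_edge_side :: "passage \<times> bool \<Rightarrow> ((passage \<times> passage) \<times> bool) \<times> nat" where
  "semi_edge_side (p, e) = ((crossing_of n \<Gamma> p, positive_side p e), 3 - capping_vertex p)"

fun next_semi_edge :: "passage \<times> bool \<Rightarrow> passage \<times> bool" where
  "next_semi_edge (p, e) =
     (if e then (next_on_link n \<Gamma> p, False) else (inv_into (passages n \<Gamma>) (next_on_link n \<Gamma>) p, True))"

text \<open>Side 0 joins the two capping vertices and is the diagonal of the quadrilateral of a
  crossing, so it belongs to both triangles of the crossing. The other sides correspond to
  semi-edges and inherit the pairing of the two ends of an edge.\<close>

fun side_pairing ::
    "((passage \<times> passage) \<times> bool) \<times> nat \<Rightarrow> ((passage \<times> passage) \<times> bool) \<times> nat" where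
  "side_pairing ((c, b), i) =
     (if i = 0 then ((c, \<not> b), 0)
      else semi_edge_side (next_semi_edge (inv_into semi_edges semi_edge_side ((c, b), i))))"

text \<open>At a given crossing the number of the side tells over from under, and the triangle tells
  the two ends at a passage apart.\<close>

lemma semi_edge_side_inj: "inj_on semi_edge_side semi_edges"
proof (intro inj_onI)
  fix h h' assume h: "h \<in> semi_edges" "h' \<in> semi_edges" and eq: "semi_edge_side h = semi_edge_side h'"
  obtain p e p' e' where hh: "h = (p, e)" "h' = (p', e')" by (cases h, cases h')
  have p: "p \<in> passages n \<Gamma>" "p' \<in> passages n \<Gamma>" using h hh by (auto simp: semi_edges_def)
  have "3 - capping_vertex p = 3 - capping_vertex p'" using eq hh by simp
  then have v: "capping_vertex p = capping_vertex p'"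
    using capping_vertex_12[of p] capping_vertex_12[of p'] by linarith
  have "p' = p \<or> p' = other_passage n \<Gamma> p" using eq hh crossing_of_eqD[OF p] by simp
  moreover have "capping_vertex (other_passage n \<Gamma> p) \<noteq> capping_vertex p"
    using other_passage_triangle(2)[OF p(1)] capping_vertex_12[of p] by linarith
  ultimately have "p' = p" using v by metis
  moreover from this have "e' = e" using eq hh positive_side_eq_iff[of p e e'] by simp
  ultimately show "h = h'" using hh by simp
qed

lemma passage_at_crossing:
  assumes "c \<in> crossings n \<Gamma>" "v = 1 \<or> v = 2"
  obtains p where "p \<in> passages n \<Gamma>" "crossing_of n \<Gamma> p = c" "capping_vertex p = v"
proof -
  obtain a b where c: "c = (a, b)" by (cases c)
  note f = assms(1)[unfolded c]
  show thesis
    using that[of a] that[of b] assms(2) crossing_of_crossing[OF f] over_not_under[OF f] crossing_passages[OF f]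
    by (auto simp: capping_vertex_def c)
qed

lemma semi_edge_side_image: "semi_edge_side ` semi_edges = (crossings n \<Gamma> \<times> UNIV) \<times> {1, 2}"
proof (intro subset_antisym subsetI)
  fix s assume "s \<in> semi_edge_side ` semi_edges"
  then obtain p e where p: "p \<in> passages n \<Gamma>" "s = semi_edge_side (p, e)" by (auto simp: semi_edges_def)
  then show "s \<in> (crossings n \<Gamma> \<times> UNIV) \<times> {1, 2}"
    using other_passage(6)[OF p(1)] capping_vertex_12[of p] by auto
next
  fix s :: "((passage \<times> passage) \<times> bool) \<times> nat" assume "s \<in> (crossings n \<Gamma> \<times> UNIV) \<times> {1, 2}"
  then obtain c b i where s: "s = ((c, b), i)" "c \<in> crossings n \<Gamma>" "i = 1 \<or> i = 2" by auto
  then obtain p where p: "p \<in> passages n \<Gamma>" "crossing_of n \<Gamma> p = c" "capping_vertex p = 3 - i"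
    using passage_at_crossing[of c "3 - i"] by (metis diff_Suc_1 diff_add_inverse2 numeral_3_eq_3 numeral_2_eq_2 One_nat_def add_2_eq_Suc' diff_Suc_Suc diff_zero)
  obtain e where "positive_side p e = b" by (rule positive_side_surj)
  then have "semi_edge_side (p, e) = s" using s p by auto
  moreover have "(p, e) \<in> semi_edges" using p by (simp add: semi_edges_def)
  ultimately show "s \<in> semi_edge_side ` semi_edges" by blast
qed

lemma next_semi_edge_in: "h \<in> semi_edges \<Longrightarrow> next_semi_edge h \<in> semi_edges"
  using bij_betw_next_on_link next_on_link_in inv_into_into[of _ "next_on_link n \<Gamma>" "passages n \<Gamma>"]
  by (cases h) (auto simp: semi_edges_def bij_betw_def)

lemma next_semi_edge_next_semi_edge: "h \<in> semi_edges \<Longrightarrow> next_semi_edge (next_semi_edge h) = h"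
  using bij_betw_next_on_link
  by (cases h) (auto simp: semi_edges_def bij_betw_inv_into_left bij_betw_inv_into_right)

lemma next_semi_edge_neq: "next_semi_edge h \<noteq> h"
  by (cases h) auto

lemma side_pairing_semi_edge_side:
  assumes "h \<in> semi_edges"
  shows "side_pairing (semi_edge_side h) = semi_edge_side (next_semi_edge h)"
proof -
  obtain p e where h: "h = (p, e)" by (cases h)
  have "3 - capping_vertex p \<noteq> 0" using capping_vertex_12[of p] by auto
  then show ?thesis
    using inv_into_f_f[OF semi_edge_side_inj assms] by (simp add: h)
qed

lemma side_cases:
  assumes "s \<in> (crossings n \<Gamma> \<times> UNIV) \<times> {0, 1, 2}"
  obtains c b where "c \<in> crossings n \<Gamma>" "s = ((c, b), 0)" | h where "h \<in> semi_edges" "s = semi_edge_side h"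
proof (cases "snd s = 0")
  case True
  moreover obtain c b i where "s = ((c, b), i)" by (metis surj_pair)
  ultimately show thesis using assms that(1) by auto
next
  case False
  then have "s \<in> semi_edge_side ` semi_edges" using assms semi_edge_side_image by auto
  then show thesis using that(2) by blast
qed

lemma side_pairing_involution:
  assumes "s \<in> (crossings n \<Gamma> \<times> UNIV) \<times> {0, 1, 2}"
  shows "side_pairing s \<in> (crossings n \<Gamma> \<times> UNIV) \<times> {0, 1, 2}" "side_pairing s \<noteq> s"
    "side_pairing (side_pairing s) = s"
proof -
  have "side_pairing s \<in> (crossings n \<Gamma> \<times> UNIV) \<times> {0, 1, 2} \<and> side_pairing s \<noteq> s \<and>
      side_pairing (side_pairing s) = s"
    using assms
  proof (cases rule: side_cases)
    case (1 c b)
    then show ?thesis by simp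
  next
    case (2 h)
    have "semi_edge_side (next_semi_edge h) \<in> (crossings n \<Gamma> \<times> UNIV) \<times> {1, 2}"
      using semi_edge_side_image next_semi_edge_in[OF 2(1)] by blast
    moreover have "semi_edge_side (next_semi_edge h) \<noteq> semi_edge_side h"
      using inj_onD[OF semi_edge_side_inj _ next_semi_edge_in[OF 2(1)] 2(1)] next_semi_edge_neq[of h] by blast
    ultimately show ?thesis
      using 2 side_pairing_semi_edge_side[OF 2(1)] side_pairing_semi_edge_side[OF next_semi_edge_in[OF 2(1)]]
        next_semi_edge_next_semi_edge[OF 2(1)] by auto
  qed
  then show "side_pairing s \<in> (crossings n \<Gamma> \<times> UNIV) \<times> {0, 1, 2}" "side_pairing s \<noteq> s"
    "side_pairing (side_pairing s) = s" by blast+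
qed

section \<open>Flags in the barycentric coordinates of a triangle\<close>

definition simplex_point :: "nat \<Rightarrow> real \<Rightarrow> real \<Rightarrow> real \<Rightarrow> nat \<Rightarrow> real" where
  "simplex_point v a b c = (\<lambda>j. if j = 0 then a else if j = v then b else if j = 3 - v then c else 0)"

text \<open>Vertex 0 is the Seifert center. The band center is the midpoint of the side between the
  two capping vertices, hence its weight \<open>z\<close> is divided equally between them.\<close>

fun flag_triangle :: "flag_point \<Rightarrow> ((passage \<times> passage) \<times> bool) \<times> (nat \<Rightarrow> real)" where
  "flag_triangle (((p, e), i), (x, y, z)) =
     ((crossing_of n \<Gamma> p, positive_side p e),
      simplex_point (capping_vertex p) (x / (x + y + z)) ((y + z / 2) / (x + y + z)) (z / 2 / (x + y + z)))"

lemma simplex_point_in_simplex: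
  assumes "v = 1 \<or> v = 2" "0 \<le> a" "0 \<le> b" "0 \<le> c" "a + b + c = 1"
  shows "simplex_point v a b c \<in> standard_simplex 2"
proof -
  have "(\<Sum>i\<le>2. simplex_point v a b c i) = 1"
    using assms by (auto simp: simplex_point_def numeral_2_eq_2)
  moreover have "simplex_point v a b c i \<in> {0..1}" for i
    using assms by (auto simp: simplex_point_def)
  moreover have "simplex_point v a b c i = 0" if "i > 2" for i
    using that assms by (auto simp: simplex_point_def)
  ultimately show ?thesis by (auto simp: standard_simplex_def)
qed

lemma simplex_point_collapse:
  assumes "v = 1 \<or> v = 2" "u \<in> standard_simplex 2"
  shows "simplex_point v (u 0) (u v) (u (3 - v)) = u" "u 0 + u v + u (3 - v) = 1"
    "0 \<le> u 0" "0 \<le> u v" "0 \<le> u (3 - v)"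
proof -
  have z: "u j = 0" if "j > 2" for j using assms(2) that by (simp add: standard_simplex_def)
  have "{..2::nat} = {0, 1, 2}" by auto
  then have "u 0 + (u 1 + u 2) = 1" using assms(2) by (simp add: standard_simplex_def)
  then show "u 0 + u v + u (3 - v) = 1" using assms(1) by auto
  show "simplex_point v (u 0) (u v) (u (3 - v)) = u"
  proof
    fix j show "simplex_point v (u 0) (u v) (u (3 - v)) j = u j"
      using assms(1) z[of j] by (auto simp: simplex_point_def)
  qed
  show "0 \<le> u 0" "0 \<le> u v" "0 \<le> u (3 - v)" using assms(2) by (auto simp: standard_simplex_def)
qed

lemma simplex_point_eq_iff:
  assumes "v = 1 \<or> v = 2"
  shows "simplex_point v a b c = simplex_point v a' b' c' \<longleftrightarrow> a = a' \<and> b = b' \<and> c = c'"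
proof
  assume *: "simplex_point v a b c = simplex_point v a' b' c'"
  show "a = a' \<and> b = b' \<and> c = c'"
    using fun_cong[OF *, of 0] fun_cong[OF *, of v] fun_cong[OF *, of "3 - v"] assms
    by (auto simp: simplex_point_def)
qed simp

lemma simplex_point_swap: "v = 1 \<or> v = 2 \<Longrightarrow> simplex_point (3 - v) a b c = simplex_point v a c b"
  by (auto simp: simplex_point_def)

lemma flag_sum_pos: "(x, y, z) \<in> cube_face i \<Longrightarrow> x + y + z > 0"
  using cube_faceD[of x y z i] by auto

text \<open>Only the two flags of one triangle can have common images, and they overlap in the
  median \<open>y = 0\<close> through vertex 0.\<close>

lemma flag_triangle_eqD:
  assumes p: "p \<in> passages n \<Gamma>" "p' \<in> passages n \<Gamma>" and i: "i \<in> {0, 1, 2}" "i' \<in> {0, 1, 2}"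
    and w: "(x, y, z) \<in> cube_face i" "(x', y', z') \<in> cube_face i'"
    and eq: "flag_triangle (((p, e), i), (x, y, z)) = flag_triangle (((p', e'), i'), (x', y', z'))"
  shows "flag_equiv (((p, e), i), (x, y, z)) (((p', e'), i'), (x', y', z'))"
proof -
  define s s' where "s = x + y + z" and "s' = x' + y' + z'"
  have s: "s > 0" "s' > 0" using flag_sum_pos w by (auto simp: s_def s'_def)
  note v = capping_vertex_12[of p]
  note D = cube_faceD[OF w(1)] cube_faceD[OF w(2)]
  from crossing_of_eqD[OF p] eq consider "p' = p" | "p' = other_passage n \<Gamma> p" by auto
  then show ?thesis
  proof cases
    case 1
    then have e: "e' = e" using eq positive_side_eq_iff[of p e e'] by simp
    have c: "x / s = x' / s'" "(y + z / 2) / s = (y' + z' / 2) / s'" "z / 2 / s = z' / 2 / s'"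
      using eq 1 simplex_point_eq_iff[OF v] by (auto simp: s_def s'_def)
    then have "x * s' = x' * s" "(y + z / 2) * s' = (y' + z' / 2) * s" "z * s' = z' * s"
      using s by (auto simp: field_simps)
    moreover from this have "y * s' = y' * s" by (simp add: algebra_simps)
    ultimately have "x = x' \<and> y = y' \<and> z = z'"
      using cube_face_proportional[OF w _ _ _ s] by blast
    then show ?thesis using flag_equiv_face[OF p(1) i] w 1 e by auto
  next
    case 2
    then have e: "e' = (\<not> e)"
      using eq positive_side_eq_iff[of p' e' "\<not> e"] other_passage_triangle(1)[OF p(1), of e] by simp
    have c: "x / s = x' / s'" "(y + z / 2) / s = z' / 2 / s'" "z / 2 / s = (y' + z' / 2) / s'"
      using eq 2 simplex_point_eq_iff[OF v]
      by (auto simp: s_def s'_def other_passage_triangle(2)[OF p(1)] simplex_point_swap[OF v])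
    then have "x * s' = x' * s" "(y + z / 2) * s' = z' / 2 * s" "z / 2 * s' = (y' + z' / 2) * s"
      using s by (auto simp: field_simps)
    \<comment> \<open>Substituting the third equation into the second one leaves a vanishing sum of
      two nonnegative terms.\<close>
    then have f: "x * s' = x' * s" "y * s' + y' * s = 0" "z * s' = 2 * (y' * s) + z' * s"
      by (auto simp: algebra_simps)
    moreover have "0 \<le> y * s'" "0 \<le> y' * s" using D s by auto
    ultimately have "y * s' = 0" "y' * s = 0" by linarith+
    then have y: "y = 0" "y' = 0" using s by auto
    moreover from this have "z * s' = z' * s" using f(3) by simp
    ultimately have "x = x' \<and> y = y' \<and> z = z'"
      using cube_face_proportional[OF w f(1) _ _ s] by simp
    then have xz: "x' = x" "z' = z" by auto
    have "flag_equiv (((p, e), i), (x, 0, z)) (((p, e), i'), (x, 0, z))"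
      using w y xz by (intro flag_equiv_face[OF p(1) i]) auto
    moreover have "flag_equiv (((p, e), i'), (x, 0, z)) (((p', e'), i'), (x, 0, z))"
      unfolding 2 e using w y xz by (intro flag_equiv_other[OF p(1) i(2)]) auto
    ultimately show ?thesis unfolding y xz by (rule generated_equiv_trans)
  qed
qed

text \<open>Inverse of \<open>flag_triangle\<close> on the half of the triangle nearer to vertex
  \<open>v\<close>. The excess of the weight at \<open>v\<close> over the weight at
  \<open>3 - v\<close> belongs to the capping center, and what remains of the two weights belongs to
  the band center.\<close>

definition flag_coords :: "nat \<Rightarrow> (nat \<Rightarrow> real) \<Rightarrow> real \<times> real \<times> real" where
  "flag_coords v u = (let m = max (u 0) (max (u v - u (3 - v)) (2 * u (3 - v))) in
     (u 0 / m, (u v - u (3 - v)) / m, 2 * u (3 - v) / m))"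

lemma flag_triangle_flag_coords:
  assumes p: "p \<in> passages n \<Gamma>" and u: "u \<in> standard_simplex 2" "u (3 - capping_vertex p) \<le> u (capping_vertex p)"
  obtains i where "i \<in> {0, 1, 2}" "flag_coords (capping_vertex p) u \<in> cube_face i"
    "\<And>e. flag_triangle (((p, e), i), flag_coords (capping_vertex p) u) = ((crossing_of n \<Gamma> p, positive_side p e), u)"
proof -
  define v where "v = capping_vertex p"
  have v: "v = 1 \<or> v = 2" unfolding v_def by (rule capping_vertex_12)
  note S = simplex_point_collapse[OF v u(1)]
  define a b c where "a = u 0" and "b = u v - u (3 - v)" and "c = 2 * u (3 - v)"
  define m where "m = max a (max b c)"
  have abc: "0 \<le> a" "0 \<le> b" "0 \<le> c" "a + b + c = 1"
    using S u(2) by (auto simp: a_def b_def c_def v_def)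
  then have m: "m > 0" "a \<le> m" "b \<le> m" "c \<le> m" by (auto simp: m_def)
  have co: "flag_coords v u = (a / m, b / m, c / m)"
    by (simp add: flag_coords_def Let_def a_def b_def c_def m_def)
  \<comment> \<open>The coordinate that attains the maximum decides in which quadrilateral the point
    lies.\<close>
  have "m = a \<or> m = b \<or> m = c" by (auto simp: m_def max_def)
  then obtain i :: nat where i: "i \<in> {0, 1, 2}" "(a / m, b / m, c / m) \<in> cube_face i"
  proof (elim disjE)
    assume *: "m = a" show thesis by (rule that[of 0]) (use * abc m in auto)
  next
    assume *: "m = b" show thesis by (rule that[of 1]) (use * abc m in auto)
  next
    assume *: "m = c" show thesis by (rule that[of 2]) (use * abc m in auto)
  qed
  have sum: "a / m + b / m + c / m = 1 / m" using abc(4) by (simp flip: add_divide_distrib)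
  have "a / m / (1 / m) = u 0" "(b / m + c / m / 2) / (1 / m) = u v" "c / m / 2 / (1 / m) = u (3 - v)"
    using m by (auto simp: a_def b_def c_def field_simps)
  then have "flag_triangle (((p, e), i), flag_coords v u) = ((crossing_of n \<Gamma> p, positive_side p e), u)" for e
    using S(1) by (simp add: co sum flip: v_def)
  then show thesis using that i co by (simp add: v_def)
qed

lemma flag_triangle_in:
  assumes "a \<in> topspace flag_space"
  shows "flag_triangle a \<in> (crossings n \<Gamma> \<times> UNIV) \<times> standard_simplex 2"
proof -
  obtain p e i x y z where a: "a = (((p, e), i), (x, y, z))" "p \<in> passages n \<Gamma>" "(x, y, z) \<in> cube_face i"
    using flag_space_cases[OF assms] .
  define s where "s = x + y + z"
  have s: "s > 0" using flag_sum_pos[OF a(3)] by (simp add: s_def)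
  have "x / s + (y + z / 2) / s + z / 2 / s = (x + (y + z / 2) + z / 2) / s"
    by (simp only: add_divide_distrib)
  also have "\<dots> = 1" using s by (simp add: s_def)
  finally have "simplex_point (capping_vertex p) (x / s) ((y + z / 2) / s) (z / 2 / s) \<in> standard_simplex 2"
    using cube_faceD[OF a(3)] s by (intro simplex_point_in_simplex capping_vertex_12) auto
  then show ?thesis
    using a(1) other_passage(6)[OF a(2)] by (simp add: s_def)
qed

lemma flag_triangle_surj:
  assumes "c \<in> crossings n \<Gamma>" "u \<in> standard_simplex 2"
  shows "((c, b), u) \<in> flag_triangle ` topspace flag_space"
proof -
  \<comment> \<open>The larger one of the two capping weights selects the flag.\<close>
  obtain v :: nat where v: "v = 1 \<or> v = 2" "u (3 - v) \<le> u v"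
  proof (cases "u 1 \<le> u 2")
    case True show thesis by (rule that[of 2]) (use True in auto)
  next
    case False show thesis by (rule that[of 1]) (use False in auto)
  qed
  obtain p where p: "p \<in> passages n \<Gamma>" "crossing_of n \<Gamma> p = c" "capping_vertex p = v"
    using passage_at_crossing[OF assms(1) v(1)] .
  obtain i where i: "i \<in> {0, 1, 2}" "flag_coords v u \<in> cube_face i"
    "\<And>e. flag_triangle (((p, e), i), flag_coords v u) = ((c, positive_side p e), u)"
    using flag_triangle_flag_coords[OF p(1) assms(2)] v(2) p by auto
  obtain e where e: "positive_side p e = b" by (rule positive_side_surj)
  show ?thesis
    by (rule image_eqI[OF _ topspace_flag_spaceI[OF p(1) i(1,2), of e]]) (simp only: i(3) e)
qed

lemma continuous_map_flag_triangle:
  "continuous_map flag_space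
     (sum_topology (\<lambda>_. subtopology (powertop_real UNIV) (standard_simplex 2)) (crossings n \<Gamma> \<times> UNIV)) flag_triangle"
  unfolding flag_space_def
proof (intro continuous_map_from_sum_topology)
  fix hi assume hi: "hi \<in> semi_edges \<times> {0, 1, 2::nat}"
  obtain p e i where h: "hi = ((p, e), i)" "p \<in> passages n \<Gamma>" "i \<in> {0, 1, 2}"
    using hi by (auto simp: semi_edges_def)
  define F where "F w = snd (flag_triangle (((p, e), i), w))" for w
  have tri: "flag_triangle (((p, e), i), w) = ((crossing_of n \<Gamma> p, positive_side p e), F w)" for w
    by (cases w) (simp add: F_def)
  have "continuous_on (cube_face i) (\<lambda>w. F w j)" for j
  proof -
    have pos: "fst w + fst (snd w) + snd (snd w) \<noteq> 0" if "w \<in> cube_face i" for w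
      using flag_sum_pos[of "fst w" "fst (snd w)" "snd (snd w)" i] that by simp
    have F: "F w j = simplex_point (capping_vertex p) (fst w / (fst w + fst (snd w) + snd (snd w)))
       ((fst (snd w) + snd (snd w) / 2) / (fst w + fst (snd w) + snd (snd w)))
       (snd (snd w) / 2 / (fst w + fst (snd w) + snd (snd w))) j" for w
      by (cases w) (simp add: F_def)
    have "continuous_on (cube_face i) (\<lambda>w. fst w / (fst w + fst (snd w) + snd (snd w)))"
      "continuous_on (cube_face i) (\<lambda>w. (fst (snd w) + snd (snd w) / 2) / (fst w + fst (snd w) + snd (snd w)))"
      "continuous_on (cube_face i) (\<lambda>w. snd (snd w) / 2 / (fst w + fst (snd w) + snd (snd w)))"
      using pos by (intro continuous_intros; simp)+
    moreover have "continuous_on A (\<lambda>w. if b then f w else g w)"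
      if "continuous_on A f" "continuous_on A g" for A b and f g :: "real \<times> real \<times> real \<Rightarrow> real"
      using that by (cases b) auto
    ultimately show ?thesis
      unfolding F simplex_point_def by (simp only: continuous_on_const)
  qed
  then have "continuous_map (top_of_set (cube_face i)) (powertop_real UNIV) F"
    by (simp add: continuous_map_componentwise_UNIV)
  moreover have "F w \<in> standard_simplex 2" if "w \<in> cube_face i" for w
    using flag_triangle_in[OF topspace_flag_spaceI[OF h(2,3) that, of e]] by (simp add: tri)
  ultimately have "continuous_map (top_of_set (cube_face i)) (subtopology (powertop_real UNIV) (standard_simplex 2)) F"
    by (auto simp: continuous_map_in_subtopology)
  then have "continuous_map (top_of_set (cube_face i))
     (sum_topology (\<lambda>_. subtopology (powertop_real UNIV) (standard_simplex 2)) (crossings n \<Gamma> \<times> UNIV))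
     ((\<lambda>u. ((crossing_of n \<Gamma> p, positive_side p e), u)) \<circ> F)"
    by (rule continuous_map_compose[OF _ continuous_map_component_injection]) (use other_passage(6)[OF h(2)] in auto)
  then show "continuous_map (case hi of (h, i) \<Rightarrow> top_of_set (cube_face i))
     (sum_topology (\<lambda>_. subtopology (powertop_real UNIV) (standard_simplex 2)) (crossings n \<Gamma> \<times> UNIV))
     (\<lambda>x. flag_triangle (hi, x))"
    by (simp add: h(1) tri comp_def)
qed

lemma quotient_map_flag_triangle:
  "quotient_map flag_space
     (sum_topology (\<lambda>_. subtopology (powertop_real UNIV) (standard_simplex 2)) (crossings n \<Gamma> \<times> UNIV)) flag_triangle"
proof (rule quotient_map_compact_Hausdorff[OF compact_flag_space _ continuous_map_flag_triangle])
  show "Hausdorff_space (sum_topology (\<lambda>_. subtopology (powertop_real UNIV) (standard_simplex 2))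
      (crossings n \<Gamma> \<times> (UNIV :: bool set)))"
    by (intro Hausdorff_space_sum_topology Hausdorff_space_subtopology) (simp add: Hausdorff_space_product_topology)
  show "flag_triangle ` topspace flag_space =
      topspace (sum_topology (\<lambda>_. subtopology (powertop_real UNIV) (standard_simplex 2)) (crossings n \<Gamma> \<times> UNIV))"
    using flag_triangle_in flag_triangle_surj by fastforce
qed

section \<open>Gluing of sides compared with gluing of flags\<close>

text \<open>Vertex 0 comes first on side \<open>3 - v\<close> for either value of \<open>v\<close>.
  The order-preserving gluing of paired sides therefore never exchanges the Seifert end with the
  capping end.\<close>

lemma simplical_face_simplex_point:
  assumes "v = 1 \<or> v = 2" "\<And>j. j > 1 \<Longrightarrow> u j = 0"
  shows "simplical_face (3 - v) u = simplex_point v (u 0) (u 1) 0"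
    "simplical_face 0 u = simplex_point v 0 (u (v - 1)) (u (2 - v))"
proof -
  have "simplical_face (3 - v) u j = simplex_point v (u 0) (u 1) 0 j \<and>
      simplical_face 0 u j = simplex_point v 0 (u (v - 1)) (u (2 - v)) j" for j
  proof -
    consider "j = 0" | "j = 1" | "j = 2" | "j > 2" by linarith
    then show ?thesis
      using assms(1)
      by (cases; elim disjE) (simp_all add: simplical_face_def simplex_point_def assms(2))
  qed
  then show "simplical_face (3 - v) u = simplex_point v (u 0) (u 1) 0"
    "simplical_face 0 u = simplex_point v 0 (u (v - 1)) (u (2 - v))" by blast+
qed

definition triangle_gluing ::
    "((((passage \<times> passage) \<times> bool) \<times> (nat \<Rightarrow> real)) \<times> (((passage \<times> passage) \<times> bool) \<times> (nat \<Rightarrow> real))) set" where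
  "triangle_gluing = {((t, simplical_face i x), (t', simplical_face j x)) | t i t' j x.
     t \<in> crossings n \<Gamma> \<times> UNIV \<and> i \<in> {0, 1, 2} \<and> side_pairing (t, i) = (t', j) \<and> x \<in> standard_simplex 1}"

lemma triangle_gluingI:
  assumes "t \<in> crossings n \<Gamma> \<times> UNIV" "i \<in> {0, 1, 2}" "side_pairing (t, i) = (t', j)" "x \<in> standard_simplex 1"
  shows "((t, simplical_face i x), (t', simplical_face j x)) \<in> triangle_gluing"
  using assms unfolding triangle_gluing_def by blast

lemma triangle_gluing_lift:
  assumes "(a, a') \<in> triangle_gluing"
  shows "\<exists>y\<in>topspace flag_space. \<exists>y'\<in>topspace flag_space.
    flag_triangle y = a \<and> flag_triangle y' = a' \<and> flag_equiv y y'"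
proof -
  obtain t i t' j x where a: "a = (t, simplical_face i x)" "a' = (t', simplical_face j x)"
    and t: "t \<in> crossings n \<Gamma> \<times> UNIV" "i \<in> {0, 1, 2}" "side_pairing (t, i) = (t', j)"
    and x: "x \<in> standard_simplex 1"
    using assms by (auto simp: triangle_gluing_def)
  have x0: "x j = 0" if "j > 1" for j using x that by (simp add: standard_simplex_def)
  have face: "simplical_face k x \<in> standard_simplex 2" if "k \<le> 2" for k
    using simplical_face_in_standard_simplex[of 2 k x] that x by (simp add: numeral_2_eq_2)
  have "(t, i) \<in> (crossings n \<Gamma> \<times> UNIV) \<times> {0, 1, 2}" using t by auto
  then show ?thesis
  proof (cases rule: side_cases)
    case (1 c b)
    define u where "u = simplical_face 0 x"
    have a': "a = ((c, b), u)" "a' = ((c, \<not> b), u)" using 1 a t(3) by (auto simp: u_def)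
    have u: "u \<in> standard_simplex 2" unfolding u_def by (rule face) simp
    \<comment> \<open>On side 0 the Seifert weight vanishes, which is the situation of the rule
      \<open>turn\<close>.\<close>
    have u0: "u 0 = 0" by (simp add: u_def simplical_face_def)
    obtain v :: nat where v: "v = 1 \<or> v = 2" "u (3 - v) \<le> u v"
    proof (cases "u 1 \<le> u 2")
      case True show thesis by (rule that[of 2]) (use True in auto)
    next
      case False show thesis by (rule that[of 1]) (use False in auto)
    qed
    obtain p where p: "p \<in> passages n \<Gamma>" "crossing_of n \<Gamma> p = c" "capping_vertex p = v"
      using passage_at_crossing[OF 1(1) v(1)] .
    obtain k where k: "k \<in> {0, 1, 2}" "flag_coords v u \<in> cube_face k"
      "\<And>e. flag_triangle (((p, e), k), flag_coords v u) = ((c, positive_side p e), u)"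
      using flag_triangle_flag_coords[OF p(1) u] v(2) p by auto
    obtain e where e: "positive_side p e = b" by (rule positive_side_surj)
    obtain y z where co: "flag_coords v u = (0, y, z)" by (simp add: flag_coords_def Let_def u0)
    have "flag_equiv (((p, e), k), flag_coords v u) (((p, \<not> e), k), flag_coords v u)"
      unfolding co using k co by (intro flag_equiv_turn[OF p(1)]) auto
    then show ?thesis
      using topspace_flag_spaceI[OF p(1) k(1,2)] k(3)[of e] k(3)[of "\<not> e"] e positive_side_Not[of p e] a'
      by (intro bexI[of _ "(((p, e), k), flag_coords v u)"] bexI[of _ "(((p, \<not> e), k), flag_coords v u)"]) auto
  next
    case (2 h)
    \<comment> \<open>The coordinates are written with \<open>v = 1\<close> whatever the capping
      vertex is, so that the lifts of both points of a pair get the same triple.\<close>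
    have lift: "\<exists>k\<in>{0, 1, 2}. \<exists>xx yy. (xx, yy, 0) \<in> cube_face k \<and> (xx, yy, 0) = flag_coords 1 (simplex_point 1 (x 0) (x 1) 0) \<and>
        flag_triangle (((q, f), k), (xx, yy, 0)) = (fst (semi_edge_side (q, f)), simplical_face (snd (semi_edge_side (q, f))) x)"
      if q: "q \<in> passages n \<Gamma>" for q f
    proof -
      note v = capping_vertex_12[of q]
      define u where "u = simplex_point (capping_vertex q) (x 0) (x 1) 0"
      have u': "u = simplical_face (3 - capping_vertex q) x"
        using simplical_face_simplex_point(1)[OF v x0] by (simp add: u_def)
      have u: "u \<in> standard_simplex 2" unfolding u' by (rule face) (use v in auto)
      have "u (3 - capping_vertex q) = 0" "u 0 = x 0" "u (capping_vertex q) = x 1"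
        using v by (auto simp: u_def simplex_point_def)
      moreover have "0 \<le> x 1" using x by (simp add: standard_simplex_def)
      moreover have "flag_coords (capping_vertex q) u = flag_coords 1 (simplex_point 1 (x 0) (x 1) 0)"
        using calculation by (simp add: flag_coords_def simplex_point_def)
      moreover obtain k where "k \<in> {0, 1, 2}" "flag_coords (capping_vertex q) u \<in> cube_face k"
        "\<And>e. flag_triangle (((q, e), k), flag_coords (capping_vertex q) u) = ((crossing_of n \<Gamma> q, positive_side q e), u)"
        using flag_triangle_flag_coords[OF q u] calculation by auto
      moreover obtain xx yy where "flag_coords 1 (simplex_point 1 (x 0) (x 1) 0) = (xx, yy, 0)"
        by (simp add: flag_coords_def simplex_point_def Let_def)
      ultimately show ?thesis by (auto simp flip: u')
    qed
    \<comment> \<open>The two lifts may lie in different quadrilaterals \<open>k\<close> and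
      \<open>k'\<close>; a \<open>face\<close> step makes up for that.\<close>
    have pair: "flag_equiv y y' \<and> y \<in> topspace flag_space \<and> y' \<in> topspace flag_space"
      if "y = (((q, True), k), (xx, yy, 0))" "y' = (((next_on_link n \<Gamma> q, False), k'), (xx, yy, 0))"
        "q \<in> passages n \<Gamma>" "k \<in> {0, 1, 2}" "k' \<in> {0, 1, 2}" "(xx, yy, 0) \<in> cube_face k" "(xx, yy, 0) \<in> cube_face k'"
      for y y' q k k' xx yy
      using flag_equiv_next[OF that(3,4,6)] flag_equiv_face[OF next_on_link_in[OF that(3)] that(4,5,6,7), of False]
        topspace_flag_spaceI[OF that(3,4,6)] topspace_flag_spaceI[OF next_on_link_in[OF that(3)] that(5,7)]
      unfolding that(1,2) by (blast intro: generated_equiv_trans)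
    have h': "(t', j) = semi_edge_side (next_semi_edge h)"
      using t(3) 2(2) side_pairing_semi_edge_side[OF 2(1)] by simp
    have ends: "a = (fst (semi_edge_side h), simplical_face (snd (semi_edge_side h)) x)"
      "a' = (fst (semi_edge_side (next_semi_edge h)), simplical_face (snd (semi_edge_side (next_semi_edge h))) x)"
      using a 2(2)[symmetric] h'[symmetric] by simp_all
    have hn: "next_semi_edge h \<in> semi_edges" by (rule next_semi_edge_in[OF 2(1)])
    obtain p e where hp: "h = (p, e)" "p \<in> passages n \<Gamma>" using 2(1) by (auto simp: semi_edges_def)
    obtain p' e' where hp': "next_semi_edge h = (p', e')" "p' \<in> passages n \<Gamma>" using hn by (auto simp: semi_edges_def)
    obtain k xx yy where k: "k \<in> {0, 1, 2}" "(xx, yy, 0) \<in> cube_face k"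
        "(xx, yy, 0) = flag_coords 1 (simplex_point 1 (x 0) (x 1) 0)" "flag_triangle (((p, e), k), (xx, yy, 0)) = a"
      using lift[OF hp(2), of e] unfolding ends(1) hp(1) by blast
    obtain k' xx' yy' where k'': "k' \<in> {0, 1, 2}" "(xx', yy', 0) \<in> cube_face k'"
        "(xx', yy', 0) = flag_coords 1 (simplex_point 1 (x 0) (x 1) 0)" "flag_triangle (((p', e'), k'), (xx', yy', 0)) = a'"
      using lift[OF hp'(2), of e'] unfolding ends(2) hp'(1) by blast
    have "xx' = xx" "yy' = yy" using k(3) k''(3) by (metis prod.inject)+
    with k'' have k': "k' \<in> {0, 1, 2}" "(xx, yy, 0) \<in> cube_face k'" "flag_triangle (((p', e'), k'), (xx, yy, 0)) = a'"
      by simp_all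
    show ?thesis
    proof (cases e)
      case True
      then have "p' = next_on_link n \<Gamma> p" "e' = False" using hp hp' by auto
      then show ?thesis
        using pair[OF refl refl hp(2) k(1) k'(1) k(2) k'(2)] k(4) k'(3) True
        by (intro bexI[of _ "(((p, e), k), (xx, yy, 0))"] bexI[of _ "(((p', e'), k'), (xx, yy, 0))"]) simp_all
    next
      case False
      then have "p = next_on_link n \<Gamma> p'" "e' = True"
        using hp hp' next_semi_edge_next_semi_edge[OF 2(1)] by auto
      then show ?thesis
        using pair[OF refl refl hp'(2) k'(1) k(1) k'(2) k(2)] k(4) k'(3) False
        by (intro bexI[of _ "(((p, e), k), (xx, yy, 0))"] bexI[of _ "(((p', e'), k'), (xx, yy, 0))"])
          (simp_all add: generated_equiv_sym)
    qed
  qed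
qed

lemma triangle_gluing_push:
  assumes "(y, y') \<in> flag_gluing"
  shows "(flag_triangle y, flag_triangle y') \<in> generated_equiv triangle_gluing"
proof -
  have "flag_step y y'" using assms by (simp add: flag_gluing_def)
  then show ?thesis
  proof (cases rule: flag_step.cases)
    case (face p i j w e)
    then show ?thesis by (cases w) simp
  next
    case (turn p i b c e)
    note v = capping_vertex_12[of p]
    note D = cube_faceD[OF turn(5)]
    have s: "b + c > 0" using flag_sum_pos[OF turn(5)] by simp
    define b' c' where "b' = (b + c / 2) / (b + c)" and "c' = c / 2 / (b + c)"
    have "b' + c' = (b + c / 2 + c / 2) / (b + c)"
      by (simp only: b'_def c'_def add_divide_distrib)
    then have bc: "b' + c' = 1" "0 \<le> b'" "0 \<le> c'"
      using s D by (auto simp: b'_def c'_def)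
    \<comment> \<open>Side 0 omits vertex 0, so vertex \<open>v\<close> of the triangle is vertex
      \<open>v - 1\<close> of the side.\<close>
    define x where "x = (\<lambda>j. if j = capping_vertex p - 1 then b' else if j = 2 - capping_vertex p then c' else 0)"
    have x: "x \<in> standard_simplex 1" using bc v by (auto simp: x_def standard_simplex_def)
    have face: "simplical_face 0 x = simplex_point (capping_vertex p) 0 b' c'"
      using v by (subst simplical_face_simplex_point(2)[OF v]) (auto simp: x_def)
    have "(flag_triangle y, flag_triangle y') =
        (((crossing_of n \<Gamma> p, positive_side p e), simplical_face 0 x), ((crossing_of n \<Gamma> p, \<not> positive_side p e), simplical_face 0 x))"
      using turn(1,2) by (simp add: face b'_def c'_def positive_side_Not)
    also have "\<dots> \<in> triangle_gluing"
      using x other_passage(6)[OF turn(3)] by (intro triangle_gluingI) simp_all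
    finally show ?thesis by (rule generated_equiv_base)
  next
    case (other p i a c e)
    have "flag_triangle y = flag_triangle y'"
      using other other_passage[OF other(3)] other_passage_triangle[OF other(3)] simplex_point_swap[OF capping_vertex_12]
      by simp
    then show ?thesis by simp
  next
    case (along p i a b)
    note D = cube_faceD[OF along(5)]
    have s: "a + b > 0" using flag_sum_pos[OF along(5)] by simp
    define x where "x = (\<lambda>j::nat. if j = 0 then a / (a + b) else if j = 1 then b / (a + b) else 0)"
    have "a / (a + b) + b / (a + b) = 1" using s by (simp flip: add_divide_distrib)
    then have x: "x \<in> standard_simplex 1" using s D by (auto simp: x_def standard_simplex_def)
    have face: "simplical_face (3 - capping_vertex q) x = simplex_point (capping_vertex q) (a / (a + b)) (b / (a + b)) 0" for q
      by (subst simplical_face_simplex_point(1)[OF capping_vertex_12]) (auto simp: x_def)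
    have h: "(p, True) \<in> semi_edges" using along(3) by (simp add: semi_edges_def)
    have "(flag_triangle y, flag_triangle y') =
      (((crossing_of n \<Gamma> p, positive_side p True), simplical_face (3 - capping_vertex p) x),
       ((crossing_of n \<Gamma> (next_on_link n \<Gamma> p), positive_side (next_on_link n \<Gamma> p) False),
         simplical_face (3 - capping_vertex (next_on_link n \<Gamma> p)) x))"
      unfolding face using along(1,2) by simp
    also have "\<dots> \<in> triangle_gluing"
      using x other_passage(6)[OF along(3)] side_pairing_semi_edge_side[OF h] capping_vertex_12[of p]
      by (intro triangle_gluingI) auto
    finally show ?thesis by (rule generated_equiv_base)
  qed
qed

lemma glued_triangles_conv:
  "glued_triangles (crossings n \<Gamma> \<times> UNIV) side_pairing =
    quotient_space (sum_topology (\<lambda>_. subtopology (powertop_real UNIV) (standard_simplex 2)) (crossings n \<Gamma> \<times> UNIV))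
      triangle_gluing"
  by (simp add: glued_triangles_def triangle_gluing_def)

lemma flags_homeomorphic_glued_triangles:
  "quotient_space flag_space flag_gluing homeomorphic_space
    glued_triangles (crossings n \<Gamma> \<times> UNIV) side_pairing"
  unfolding glued_triangles_conv
proof (rule homeomorphic_space_quotient_space[OF quotient_map_flag_triangle])
  fix y y' assume "y \<in> topspace flag_space" "y' \<in> topspace flag_space" "flag_triangle y = flag_triangle y'"
  then show "flag_equiv y y'"
    by (elim flag_space_cases) (metis flag_triangle_eqD)
qed (fact triangle_gluing_lift, fact triangle_gluing_push)

end

section \<open>The closed surface as a quotient of the flags\<close>

text \<open>Treats Seifert and capping disks together; \<open>N\<close> places the half sectors of a
  disk among the flags. Coincidences on the two kinds of midlines are covered by \<open>swap\<close>
  and \<open>step\<close>, whereas at the center all half sectors of the disk meet.\<close>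

lemma disk_flags_related:
  assumes f: "finite P" "bij_betw f P P"
    and swap: "\<And>q e b. q \<in> P \<Longrightarrow> b \<in> {0..1} \<Longrightarrow> (N q e 0 b, N q (\<not> e) 0 b) \<in> generated_equiv R"
    and step: "\<And>q a. q \<in> P \<Longrightarrow> a \<in> {0..1} \<Longrightarrow> (N q True a 0, N (f q) False a 0) \<in> generated_equiv R"
    and q: "q \<in> P" "q' \<in> P" "orbit f q = orbit f q'"
    and ab: "a \<in> {0..1::real}" "b \<in> {0..1::real}" "a' \<in> {0..1}" "b' \<in> {0..1}"
    and eq: "sector_map f q e a b = sector_map f q' e' a' b'"
  shows "(N q e a b, N q' e' a' b') \<in> generated_equiv R"
proof -
  have swap': "(N q e 0 b, N q e' 0 b) \<in> generated_equiv R" if "q \<in> P" "b \<in> {0..1}" for q e e' b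
    using swap[OF that, of e] by (cases "e' = e") auto
  \<comment> \<open>At the center any half sector is reached from any other one by walking around
    the cycle.\<close>
  have center: "r \<in> P \<and> (N q True 0 0, N r True 0 0) \<in> generated_equiv R" if "r \<in> orbit f q" for r
    using that
  proof induction
    case base
    have "f q \<in> P" using f(2) q(1) bij_betwE by blast
    then show ?case
      using generated_equiv_trans[OF step[OF q(1), of 0] swap'[of "f q" 0]] by simp
  next
    case (step r)
    then have "f r \<in> P" using f(2) bij_betwE by blast
    then show ?case
      using step generated_equiv_trans[OF assms(4)[of r 0] swap'[of "f r" 0 False True]]
      by (auto intro: generated_equiv_trans)
  qed
  have D: "a = a' \<and> b = b' \<and> (a = 0 \<and> b = 0 \<or> q = q' \<and> e = e' \<or> a = 0 \<and> q = q' \<or>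
     b = 0 \<and> (e \<and> \<not> e' \<and> q' = f q \<or> \<not> e \<and> e' \<and> q = f q'))"
    using ab by (intro sector_map_eqD[OF f q(1) q(3) q(2) eq]) auto
  then consider "a = 0" "b = 0" | "q = q'" "e = e'" | "a = 0" "q = q'" | "b = 0" "e" "\<not> e'" "q' = f q"
    | "b = 0" "\<not> e" "e'" "q = f q'" by blast
  then show ?thesis
  proof cases
    case 1
    have "q' \<in> orbit f q" using bij_betw_self_in_orbit(1)[OF f q(2)] q(3) by simp
    then have "(N q True 0 0, N q' True 0 0) \<in> generated_equiv R" using center by blast
    then have "(N q e 0 0, N q' e' 0 0) \<in> generated_equiv R"
      using swap'[OF q(1), of 0 e True] swap'[OF q(2), of 0 True e'] by (auto intro: generated_equiv_trans)
    then show ?thesis using D 1 by simp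
  next
    case 2 then show ?thesis using D by simp
  next
    case 3 then show ?thesis using D swap'[OF q(1) ab(2)] by auto
  next
    case 4 then show ?thesis using D step[OF q(1) ab(1)] by auto
  next
    case 5 then show ?thesis using D generated_equiv_sym[OF step[OF q(2) ab(1)]] by auto
  qed
qed

text \<open>The two half sectors of a node share its boundary segment, divided at
  \<open>s = 1/2\<close>.\<close>

lemma node_point_sector_map:
  assumes "s \<in> {0..1}"
  shows "node_point f p s = (if s \<le> 1/2 then sector_map f p False (1 - 2 * s) 1 else sector_map f p True (2 * s - 1) 1)"
proof -
  have m: "max (1 - 2 * s) 1 = 1" "max (2 * s - 1) 1 = 1" using assms by auto
  have d: "(1 - 2 * s - 1) / (2 * 1) = - s" "(2 * s - 1 - 1) / (2 * 1) = s - 1" by (simp_all add: field_simps)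
  show ?thesis
  proof (cases "s \<le> 1/2")
    case True
    then show ?thesis by (simp only: if_True sector_map_def m d node_point_sector_point(1))
  next
    case False
    then show ?thesis by (simp only: if_False sector_map_def m d node_point_sector_point(2))
  qed
qed

lemma edge_point_sector_map:
  assumes "finite P" "bij_betw f P P" "p \<in> P" "s \<in> {0..1}"
  shows "edge_point f p s = (if s \<le> 1/2 then sector_map f p True 1 (1 - 2 * s) else sector_map f (f p) False 1 (2 * s - 1))"
proof -
  have m: "max 1 (1 - 2 * s) = 1" "max 1 (2 * s - 1) = 1" using assms(4) by auto
  have d: "(1 - (1 - 2 * s)) / (2 * 1) = s" "(1 - (2 * s - 1)) / (2 * 1) = 1 - s" by (simp_all add: field_simps)
  show ?thesis
  proof (cases "s \<le> 1/2")
    case True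
    then show ?thesis by (simp only: if_True sector_map_def m d edge_point_sector_point)
  next
    case False
    then show ?thesis
      by (simp only: if_False sector_map_def m d edge_point_sector_point_next[OF assms(1-3)])
  qed
qed

lemma sector_map_swap: "sector_map f p e 0 b = sector_map f p (\<not> e) 0 b"
proof (cases "b > 0")
  case True
  then have "(0 - b) / (2 * max 0 b) = - 1/2" by (simp add: max_def)
  then show ?thesis
    using sector_point_swap[of f p] by (cases e) (simp_all add: sector_map_def)
qed (simp add: sector_map_def sector_point_def)

lemma sector_map_next:
  assumes "finite P" "bij_betw f P P" "p \<in> P"
  shows "sector_map f p True a 0 = sector_map f (f p) False a 0"
proof (cases "a > 0")
  case True
  then have "(a - 0) / (2 * max a 0) = 1/2" by (simp add: max_def)
  then show ?thesis
    using sector_point_next[OF assms] by (simp add: sector_map_def)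
qed (simp add: sector_map_def sector_point_def)

context link_diagram
begin

text \<open>A Seifert circle is indexed by the passages on which it arrives at crossings. The
  incoming end of \<open>p\<close> thus lies at the node of \<open>p\<close>, and the outgoing end
  at the node of the other passage, from which the circle turned into the strand of
  \<open>p\<close>.\<close>

definition seifert_node :: "passage \<Rightarrow> bool \<Rightarrow> passage" where
  "seifert_node p e = (if e then other_passage n \<Gamma> p else p)"

lemma seifert_node:
  assumes "p \<in> passages n \<Gamma>"
  shows "seifert_node p e \<in> passages n \<Gamma>" "seifert_node (seifert_node p e) e = p"
    "other_passage n \<Gamma> (seifert_node p e) = seifert_node p (\<not> e)"
  using other_passage[OF assms] assms by (simp_all add: seifert_node_def)

text \<open>The midlines of a band cut it into four quarters, one for each passage and end. In the
  coordinates of \<open>p\<close>, the side along the strand of \<open>p\<close> is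
  \<open>y = 1\<close>, the center is \<open>x = y = 0\<close>, and \<open>x = 1\<close> is the
  bottom side for an incoming end and the top side for an outgoing one.\<close>

fun flag_surface :: "flag_point \<Rightarrow> piece \<times> complex" where
  "flag_surface (((p, e), i), (x, y, z)) =
     (if i = 0 then (Seifert_Disk (orbit (next_on_seifert n \<Gamma>) (seifert_node p e)),
                     sector_map (next_on_seifert n \<Gamma>) (seifert_node p e) e y z)
      else if i = 1 then (Capping_Disk (orbit (next_on_link n \<Gamma>) p), sector_map (next_on_link n \<Gamma>) p e x z)
      else (Band (crossing_of n \<Gamma> p), band_point n \<Gamma> p ((1 - y) / 2) (if e then (1 + x) / 2 else (1 - x) / 2)))"

abbreviation pieces_space :: "(piece \<times> complex) topology" where
  "pieces_space \<equiv> sum_topology piece_space (surface_pieces n \<Gamma> \<union> capping_pieces n \<Gamma>)"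

abbreviation piece_gluing :: "((piece \<times> complex) \<times> (piece \<times> complex)) set" where
  "piece_gluing \<equiv> band_gluing n \<Gamma> \<union> capping_gluing n \<Gamma>"

lemma pieces:
  assumes "p \<in> passages n \<Gamma>"
  shows "Seifert_Disk (orbit (next_on_seifert n \<Gamma>) p) \<in> surface_pieces n \<Gamma> \<union> capping_pieces n \<Gamma>"
    "Capping_Disk (orbit (next_on_link n \<Gamma>) p) \<in> surface_pieces n \<Gamma> \<union> capping_pieces n \<Gamma>"
    "Band (crossing_of n \<Gamma> p) \<in> surface_pieces n \<Gamma> \<union> capping_pieces n \<Gamma>"
  using assms other_passage(6)[OF assms] unfolding surface_pieces_def capping_pieces_def by blast+

lemma piece_cases:
  assumes "m \<in> surface_pieces n \<Gamma> \<union> capping_pieces n \<Gamma>"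
  obtains p where "p \<in> passages n \<Gamma>" "m = Seifert_Disk (orbit (next_on_seifert n \<Gamma>) p)"
    | p where "p \<in> passages n \<Gamma>" "m = Capping_Disk (orbit (next_on_link n \<Gamma>) p)"
    | p where "p \<in> passages n \<Gamma>" "p \<in> fst ` crossings n \<Gamma>" "m = Band (crossing_of n \<Gamma> p)"
proof -
  have "\<exists>p\<in>passages n \<Gamma>. p \<in> fst ` crossings n \<Gamma> \<and> c = crossing_of n \<Gamma> p" if "c \<in> crossings n \<Gamma>" for c
  proof -
    obtain a b where c: "c = (a, b)" by (cases c)
    then show ?thesis
      using that crossing_passages(1)[of a b] crossing_of_crossing(1)[of a b] over_not_under(1)[of a b] by metis
  qed
  then show thesis using assms that unfolding surface_pieces_def capping_pieces_def by blast
qed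

lemma mem_unit_square: "Complex x y \<in> cbox 0 (1 + \<i>) \<longleftrightarrow> x \<in> {0..1} \<and> y \<in> {0..1}"
  by (auto simp: in_cbox_complex_iff)

lemma band_point_in_square: "x \<in> {0..1} \<Longrightarrow> y \<in> {0..1} \<Longrightarrow> band_point n \<Gamma> p x y \<in> cbox 0 (1 + \<i>)"
  by (simp add: band_point_def mem_unit_square)

lemma band_point_other:
  "p \<in> passages n \<Gamma> \<Longrightarrow> band_point n \<Gamma> (other_passage n \<Gamma> p) x y = band_point n \<Gamma> p (1 - x) (1 - y)"
  using other_passage(5)[of p] by (simp add: band_point_def)

lemma band_point_eq_iff: "band_point n \<Gamma> p x y = band_point n \<Gamma> p x' y' \<longleftrightarrow> x = x' \<and> y = y'"
  by (auto simp: band_point_def)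

lemma sector_map_in_disk: "a \<in> {0..1} \<Longrightarrow> b \<in> {0..1} \<Longrightarrow> sector_map f p e a b \<in> cball 0 1"
  by (auto simp: norm_sector_map max_def)

lemma flag_surface_in:
  assumes "p \<in> passages n \<Gamma>" "(x, y, z) \<in> cube_face i"
  shows "flag_surface (((p, e), i), (x, y, z)) \<in> topspace pieces_space"
proof -
  note D = cube_faceD[OF assms(2)]
  have "(1 - y) / 2 \<in> {0..1}" "(if e then (1 + x) / 2 else (1 - x) / 2) \<in> {0..1}" using D by auto
  note B = band_point_in_square[OF this, of p]
  show ?thesis
    using pieces[OF assms(1)] pieces(1)[OF seifert_node(1)[OF assms(1)]] B
      sector_map_in_disk[OF D(2,3), of "next_on_seifert n \<Gamma>" "seifert_node p e" e]
      sector_map_in_disk[OF D(1,3), of "next_on_link n \<Gamma>" p e]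
    by (simp del: Un_iff)
qed

lemma continuous_map_flag_surface: "continuous_map flag_space pieces_space flag_surface"
  unfolding flag_space_def
proof (intro continuous_map_from_sum_topology)
  fix hi assume hi: "hi \<in> semi_edges \<times> {0, 1, 2::nat}"
  obtain p e i where h: "hi = ((p, e), i)" by (metis surj_pair)
  have p: "p \<in> passages n \<Gamma>" and i: "i \<in> {0, 1, 2}" using hi by (auto simp: h semi_edges_def)
  have nn: "0 \<le> fst w" "0 \<le> fst (snd w)" "0 \<le> snd (snd w)" if "w \<in> cube_face i" for w
    using cube_faceD[of "fst w" "fst (snd w)" "snd (snd w)" i] that by auto
  \<comment> \<open>The piece is the same for all points of a quadrilateral, so it is read off at an
    arbitrary triple.\<close>
  define m where "m = fst (flag_surface (((p, e), i), (1, 1, 1)))"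
  define F where "F w = snd (flag_surface (((p, e), i), w))" for w
  have FF: "flag_surface (hi, w) = (m, F w)" for w
    by (cases w) (simp add: F_def m_def h)
  have m: "m \<in> surface_pieces n \<Gamma> \<union> capping_pieces n \<Gamma>"
    using pieces[OF p] pieces(1)[OF seifert_node(1)[OF p]] by (simp add: m_def)
  have in_piece: "F w \<in> topspace (piece_space m)" if "w \<in> cube_face i" for w
  proof -
    obtain x y z where w: "w = (x, y, z)" by (metis surj_pair)
    show ?thesis
      using flag_surface_in[OF p, of x y z i e] that FF[of w] by (simp add: w h)
  qed
  have cont: "continuous_on (cube_face i) F"
  proof -
    have F: "F = (\<lambda>w. if i = 0 then sector_map (next_on_seifert n \<Gamma>) (seifert_node p e) e (fst (snd w)) (snd (snd w))
       else if i = 1 then sector_map (next_on_link n \<Gamma>) p e (fst w) (snd (snd w))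
       else band_point n \<Gamma> p ((1 - fst (snd w)) / 2) (if e then (1 + fst w) / 2 else (1 - fst w) / 2))"
    proof
      fix w :: "real \<times> real \<times> real"
      obtain x y z where "w = (x, y, z)" by (metis surj_pair)
      then show "F w = (if i = 0 then sector_map (next_on_seifert n \<Gamma>) (seifert_node p e) e (fst (snd w)) (snd (snd w))
       else if i = 1 then sector_map (next_on_link n \<Gamma>) p e (fst w) (snd (snd w))
       else band_point n \<Gamma> p ((1 - fst (snd w)) / 2) (if e then (1 + fst w) / 2 else (1 - fst w) / 2))"
        by (simp add: F_def)
    qed
    have S: "continuous_on (cube_face i)
        (\<lambda>w. sector_map (next_on_seifert n \<Gamma>) (seifert_node p e) e (fst (snd w)) (snd (snd w)))"
      by (rule sector_map_continuous) (intro continuous_intros, intro continuous_intros, simp add: nn)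
    have C: "continuous_on (cube_face i) (\<lambda>w. sector_map (next_on_link n \<Gamma>) p e (fst w) (snd (snd w)))"
      by (rule sector_map_continuous) (intro continuous_intros, intro continuous_intros, simp add: nn)
    have "continuous_on (cube_face i) (\<lambda>w. (if e then (1 + fst w) / 2 else (1 - fst w) / 2))"
      by (cases e) (simp_all add: continuous_intros)
    then have B: "continuous_on (cube_face i)
        (\<lambda>w. band_point n \<Gamma> p ((1 - fst (snd w)) / 2) (if e then (1 + fst w) / 2 else (1 - fst w) / 2))"
      unfolding band_point_def Complex_eq
      by (cases "p \<in> fst ` crossings n \<Gamma>"; simp only: if_True if_False; intro continuous_intros; assumption?) simp_all
    show ?thesis
      unfolding F using S C B by (cases "i = 0"; cases "i = 1") simp_all
  qed
  have "\<exists>S. piece_space m = top_of_set S" by (cases m) auto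
  then have "continuous_map (top_of_set (cube_face i)) (piece_space m) F"
    using cont in_piece by (auto simp: continuous_map_in_subtopology)
  then have "continuous_map (top_of_set (cube_face i)) pieces_space (Pair m \<circ> F)"
    by (rule continuous_map_compose[OF _ continuous_map_component_injection[OF m]])
  then show "continuous_map (case hi of (h, i) \<Rightarrow> top_of_set (cube_face i)) pieces_space (\<lambda>x. flag_surface (hi, x))"
    unfolding FF by (simp add: h comp_def)
qed

lemma flag_surface_surj:
  assumes "m \<in> surface_pieces n \<Gamma> \<union> capping_pieces n \<Gamma>" "w \<in> topspace (piece_space m)"
  shows "(m, w) \<in> flag_surface ` topspace flag_space"
  using assms(1)
proof (cases rule: piece_cases)
  case (1 p)
  then have "norm w \<le> 1" using assms(2) by simp
  then obtain q e a b where q: "q \<in> orbit (next_on_seifert n \<Gamma>) p" "a \<in> {0..1}" "b \<in> {0..1}"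
      "w = sector_map (next_on_seifert n \<Gamma>) q e a b"
    by (rule sector_map_surj[OF finite_passages bij_betw_next_on_seifert 1(1)])
  have qP: "q \<in> passages n \<Gamma>"
    using q(1) bij_betw_self_in_orbit(2)[OF finite_passages bij_betw_next_on_seifert 1(1)] by blast
  have "orbit (next_on_seifert n \<Gamma>) q = orbit (next_on_seifert n \<Gamma>) p"
    by (rule bij_betw_orbit_eq[OF finite_passages bij_betw_next_on_seifert 1(1) q(1)])
  then have "(m, w) = flag_surface (((seifert_node q e, e), 0), (1, a, b))"
    using 1 q seifert_node(2)[OF qP] by simp
  then show ?thesis
    by (rule image_eqI) (use q seifert_node(1)[OF qP] in \<open>auto intro!: topspace_flag_spaceI\<close>)
next
  case (2 p)
  then have "norm w \<le> 1" using assms(2) by simp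
  then obtain q e a b where q: "q \<in> orbit (next_on_link n \<Gamma>) p" "a \<in> {0..1}" "b \<in> {0..1}"
      "w = sector_map (next_on_link n \<Gamma>) q e a b"
    by (rule sector_map_surj[OF finite_passages bij_betw_next_on_link 2(1)])
  have qP: "q \<in> passages n \<Gamma>"
    using q(1) bij_betw_self_in_orbit(2)[OF finite_passages bij_betw_next_on_link 2(1)] by blast
  have "orbit (next_on_link n \<Gamma>) q = orbit (next_on_link n \<Gamma>) p"
    by (rule bij_betw_orbit_eq[OF finite_passages bij_betw_next_on_link 2(1) q(1)])
  then have "(m, w) = flag_surface (((q, e), 1), (a, 1, b))"
    using 2 q by simp
  then show ?thesis
    by (rule image_eqI) (use q qP in \<open>auto intro!: topspace_flag_spaceI\<close>)
next
  case (3 p)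
  obtain x y where w: "w = Complex x y" by (cases w)
  have xy: "x \<in> {0..1}" "y \<in> {0..1}" using assms(2) 3 mem_unit_square[of x y] by (auto simp: w)
  \<comment> \<open>This is the half of the band next to the strand of \<open>q\<close>. The half
    turn built into \<open>band_point\<close> lets the same computation serve both strands.\<close>
  have half: "\<exists>e a b. a \<in> {0..1} \<and> b \<in> {0..1} \<and> (m, w) = flag_surface (((q, e), 2), (a, b, 1))"
    if "w = band_point n \<Gamma> q x y" "x \<in> {0..1/2}" "y \<in> {0..1}" "crossing_of n \<Gamma> q = crossing_of n \<Gamma> p" for q x y
  proof (cases "y \<le> 1/2")
    case True
    show ?thesis
      by (rule exI[of _ False], rule exI[of _ "1 - 2 * y"], rule exI[of _ "1 - 2 * x"]) (use that 3 True in simp)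
  next
    case False
    show ?thesis
      by (rule exI[of _ True], rule exI[of _ "2 * y - 1"], rule exI[of _ "1 - 2 * x"]) (use that 3 False in simp)
  qed
  have "\<exists>q\<in>passages n \<Gamma>. \<exists>e a b. a \<in> {0..1} \<and> b \<in> {0..1} \<and> (m, w) = flag_surface (((q, e), 2), (a, b, 1))"
  proof (cases "x \<le> 1/2")
    case True
    have "w = band_point n \<Gamma> p x y" using 3 by (simp add: w band_point_def)
    moreover have "x \<in> {0..1/2}" using True xy by simp
    ultimately show ?thesis using half[OF _ _ xy(2) refl] 3(1) by blast
  next
    case False
    have "w = band_point n \<Gamma> (other_passage n \<Gamma> p) (1 - x) (1 - y)"
      unfolding band_point_other[OF 3(1)] using 3 by (simp add: w band_point_def)
    moreover have "1 - x \<in> {0..1/2}" "1 - y \<in> {0..1}" using False xy by simp_all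
    ultimately show ?thesis using half other_passage(1,4)[OF 3(1)] by blast
  qed
  then obtain q e a b where q: "q \<in> passages n \<Gamma>" "a \<in> {0..1}" "b \<in> {0..1}"
    "(m, w) = flag_surface (((q, e), 2), (a, b, 1))" by blast
  show ?thesis
    by (rule image_eqI[where f = flag_surface and x = "(((q, e), 2), (a, b, 1))", OF q(4)]) (use q in \<open>auto intro!: topspace_flag_spaceI\<close>)
qed

lemma quotient_map_flag_surface: "quotient_map flag_space pieces_space flag_surface"
proof (rule quotient_map_compact_Hausdorff[OF compact_flag_space _ continuous_map_flag_surface])
  show "Hausdorff_space pieces_space"
  proof (rule Hausdorff_space_sum_topology)
    show "Hausdorff_space (piece_space m)" for m
      by (cases m) (simp_all add: Hausdorff_space_subtopology)
  qed
  show "flag_surface ` topspace flag_space = topspace pieces_space"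
  proof (intro subset_antisym subsetI)
    fix a assume "a \<in> flag_surface ` topspace flag_space"
    then obtain b where "a = flag_surface b" "b \<in> topspace flag_space" by blast
    then show "a \<in> topspace pieces_space"
      by (elim flag_space_cases) (use flag_surface_in in blast)
  next
    fix a assume "a \<in> topspace pieces_space"
    then show "a \<in> flag_surface ` topspace flag_space"
      using flag_surface_surj[of "fst a" "snd a"] by (cases a) simp
  qed
qed

section \<open>Gluing of pieces compared with gluing of flags\<close>

lemma flag_surface_eqD:
  assumes p: "p \<in> passages n \<Gamma>" "p' \<in> passages n \<Gamma>" and i: "i \<in> {0, 1, 2}" "i' \<in> {0, 1, 2}"
    and w: "(x, y, z) \<in> cube_face i" "(x', y', z') \<in> cube_face i'"
    and eq: "flag_surface (((p, e), i), (x, y, z)) = flag_surface (((p', e'), i'), (x', y', z'))"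
  shows "flag_equiv (((p, e), i), (x, y, z)) (((p', e'), i'), (x', y', z'))"
proof -
  note D = cube_faceD[OF w(1)] cube_faceD[OF w(2)]
  have ii: "i' = i" using i eq by auto
  consider "i = 0" | "i = 1" | "i = 2" using i by auto
  then show ?thesis
  proof cases
    case 1
    \<comment> \<open>\<open>seifert_node\<close> is an involution in its first argument; applied to
      a node it gives back the passage whose end \<open>e\<close> lies there.\<close>
    define N where "N q e a b = (((seifert_node q e, e), 0::nat), (1::real, a::real, b::real))" for q e a b
    have "(N (seifert_node p e) e y z, N (seifert_node p' e') e' y' z') \<in> generated_equiv flag_gluing"
    proof (rule disk_flags_related[OF finite_passages bij_betw_next_on_seifert])
      fix q e b assume q: "q \<in> passages n \<Gamma>" and b: "b \<in> {0..1::real}"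
      show "flag_equiv (N q e 0 b) (N q (\<not> e) 0 b)"
        using flag_equiv_other[of "seifert_node q e" 0 1 b e] seifert_node[OF q] b by (simp add: N_def)
    next
      fix q a assume q: "q \<in> passages n \<Gamma>" and a: "a \<in> {0..1::real}"
      have "next_on_link n \<Gamma> (seifert_node q True) = seifert_node (next_on_seifert n \<Gamma> q) False"
        by (simp add: seifert_node_def next_on_seifert_def)
      then show "flag_equiv (N q True a 0) (N (next_on_seifert n \<Gamma> q) False a 0)"
        using flag_equiv_next[of "seifert_node q True" 0 1 a] seifert_node[OF q] a by (simp add: N_def)
    qed (use seifert_node(1) p D eq ii 1 in auto)
    then show ?thesis using 1 ii w seifert_node(2) p by (simp add: N_def)
  next
    case 2
    define N where "N q e a b = (((q, e), 1::nat), (a::real, 1::real, b::real))" for q :: passage and e :: bool and a b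
    have "(N p e x z, N p' e' x' z') \<in> generated_equiv flag_gluing"
    proof (rule disk_flags_related[OF finite_passages bij_betw_next_on_link])
      fix q e b assume q: "q \<in> passages n \<Gamma>" and b: "b \<in> {0..1::real}"
      show "flag_equiv (N q e 0 b) (N q (\<not> e) 0 b)"
        using flag_equiv_turn[of q 1 1 b e] q b by (simp add: N_def)
    next
      fix q a assume q: "q \<in> passages n \<Gamma>" and a: "a \<in> {0..1::real}"
      show "flag_equiv (N q True a 0) (N (next_on_link n \<Gamma> q) False a 0)"
        using flag_equiv_next[of q 1 a 1] q a by (simp add: N_def)
    qed (use p D eq ii 2 in auto)
    then show ?thesis using 2 ii w by (simp add: N_def)
  next
    case 3
    have z: "z = 1" "z' = 1" using w 3 ii by auto
    have w': "(x, y, 1) \<in> cube_face i" "(x', y', 1) \<in> cube_face i" using w z ii by auto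
    define u u' where "u = (if e then (1 + x) / 2 else (1 - x) / 2)" and "u' = (if e' then (1 + x') / 2 else (1 - x') / 2)"
    have c: "crossing_of n \<Gamma> p = crossing_of n \<Gamma> p'" and b: "band_point n \<Gamma> p ((1 - y) / 2) u = band_point n \<Gamma> p' ((1 - y') / 2) u'"
      using eq 3 ii by (simp_all add: u_def u'_def)
    have main: "flag_equiv (((p, e), i), (x, y, 1)) (((p', e'), i), (x', y', 1))"
    proof (cases "p' = p")
      case True
      then have y: "y' = y" and u: "u = u'" using b by (auto simp: band_point_eq_iff)
      show ?thesis
      proof (cases "e' = e")
        case True
        then have "x' = x" using u by (simp add: u_def u'_def split: if_splits)
        then show ?thesis using \<open>p' = p\<close> y True by simp
      next
        case False
        then have "x = 0" "x' = 0" using u D by (auto simp: u_def u'_def split: if_splits)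
        moreover have "e' = (\<not> e)" using False by simp
        ultimately show ?thesis
          using \<open>p' = p\<close> y flag_equiv_turn[OF p(1) i(1), of y 1 e] w' by simp
      qed
    next
      case False
      then have p': "p' = other_passage n \<Gamma> p" using crossing_of_eqD[OF p c] by simp
      then have "(1 - y) / 2 = 1 - (1 - y') / 2" and u: "u = 1 - u'"
        using b by (simp_all add: band_point_other[OF p(1)] band_point_eq_iff)
      \<comment> \<open>Quarters of different strands meet in the midline \<open>y = 0\<close>
        only.\<close>
      then have "y + y' = 0" by (simp add: field_simps)
      then have y: "y = 0" "y' = 0" using D by auto
      show ?thesis
      proof (cases "e' = (\<not> e)")
        case True
        then have "x' = x" using u by (simp add: u_def u'_def field_simps split: if_splits)
        then show ?thesis using p' y True flag_equiv_other[OF p(1) i(1), of x 1 e] w' by simp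
      next
        case False
        \<comment> \<open>Opposite quarters share just the center of the band, and it takes two
          steps to get from one to the other.\<close>
        then have e: "e' = e" by simp
        then have "x + x' = 0" using u by (simp add: u_def u'_def field_simps split: if_splits)
        then have x: "x = 0" "x' = 0" using D by auto
        have "flag_equiv (((p, e), i), (0, 0, 1)) (((p, \<not> e), i), (0, 0, 1))"
          using flag_equiv_turn[OF p(1) i(1), of 0 1 e] w' x y by simp
        moreover have "flag_equiv (((p, \<not> e), i), (0, 0, 1)) (((p', e), i), (0, 0, 1))"
          using flag_equiv_other[OF p(1) i(1), of 0 1 "\<not> e"] w' x y p' by simp
        ultimately show ?thesis unfolding x y e by (rule generated_equiv_trans)
      qed
    qed
    then show ?thesis using z ii by simp
  qed
qed

lemma orbit_next:
  assumes "p \<in> passages n \<Gamma>"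
  shows "orbit (next_on_link n \<Gamma>) (next_on_link n \<Gamma> p) = orbit (next_on_link n \<Gamma>) p"
    "orbit (next_on_seifert n \<Gamma>) (next_on_link n \<Gamma> p) = orbit (next_on_seifert n \<Gamma>) (other_passage n \<Gamma> p)"
  using self_in_orbit_step[OF bij_betw_self_in_orbit(1)[OF finite_passages bij_betw_next_on_link assms]]
    self_in_orbit_step[OF bij_betw_self_in_orbit(1)[OF finite_passages bij_betw_next_on_seifert other_passage(1)[OF assms]]]
    next_on_seifert_other[OF assms] by simp_all

text \<open>A side of a band that is attached to a Seifert disk touches two quarters: its first half
  belongs to the incoming end of \<open>p\<close>, its second half to the outgoing end of the other
  passage, into which the circle turns.\<close>

lemma band_gluing_flags:
  assumes "p \<in> passages n \<Gamma>" "s \<in> {0..1}"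
  obtains q e a where "q \<in> passages n \<Gamma>" "a \<in> {0..1}"
    "flag_surface (((q, e), 0), (1, a, 1)) =
       (Seifert_Disk (orbit (next_on_seifert n \<Gamma>) p), node_point (next_on_seifert n \<Gamma>) p s)"
    "flag_surface (((q, e), 2), (1, a, 1)) = (Band (crossing_of n \<Gamma> p), band_point n \<Gamma> p s 0)"
proof (cases "s \<le> 1/2")
  case True
  show thesis
    by (rule that[of p "1 - 2 * s" False]) (use assms True in \<open>simp_all add: node_point_sector_map seifert_node_def\<close>)
next
  case False
  show thesis
    by (rule that[of "other_passage n \<Gamma> p" "2 * s - 1" True])
      (use assms False other_passage[OF assms(1)] in
        \<open>simp_all add: node_point_sector_map seifert_node_def band_point_other field_simps\<close>)
qed

lemma capping_gluing_node_flags: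
  assumes "p \<in> passages n \<Gamma>" "s \<in> {0..1}"
  obtains e a where "a \<in> {0..1}"
    "flag_surface (((p, e), 1), (a, 1, 1)) =
       (Capping_Disk (orbit (next_on_link n \<Gamma>) p), node_point (next_on_link n \<Gamma>) p s)"
    "flag_surface (((p, e), 2), (a, 1, 1)) = (Band (crossing_of n \<Gamma> p), band_point n \<Gamma> p 0 s)"
proof (cases "s \<le> 1/2")
  case True
  show thesis
    by (rule that[of "1 - 2 * s" False]) (use assms True in \<open>simp_all add: node_point_sector_map\<close>)
next
  case False
  show thesis
    by (rule that[of "2 * s - 1" True]) (use assms False in \<open>simp_all add: node_point_sector_map\<close>)
qed

text \<open>An edge leaves \<open>p\<close> as an outgoing end and reaches the next passage as an
  incoming end; \<open>s = 1/2\<close> separates the two.\<close>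

lemma capping_gluing_edge_flags:
  assumes "p \<in> passages n \<Gamma>" "s \<in> {0..1}"
  obtains q e b where "q \<in> passages n \<Gamma>" "b \<in> {0..1}"
    "flag_surface (((q, e), 1), (1, 1, b)) =
       (Capping_Disk (orbit (next_on_link n \<Gamma>) p), edge_point (next_on_link n \<Gamma>) p s)"
    "flag_surface (((q, e), 0), (1, 1, b)) =
       (Seifert_Disk (orbit (next_on_seifert n \<Gamma>) (other_passage n \<Gamma> p)),
        edge_point (next_on_seifert n \<Gamma>) (other_passage n \<Gamma> p) s)"
proof -
  note E = edge_point_sector_map[OF finite_passages bij_betw_next_on_link assms]
    edge_point_sector_map[OF finite_passages bij_betw_next_on_seifert other_passage(1)[OF assms(1)] assms(2)]
  show thesis
  proof (cases "s \<le> 1/2")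
    case True
    show thesis
      by (rule that[of p "1 - 2 * s" True]) (use assms True in \<open>simp_all add: E seifert_node_def\<close>)
  next
    case False
    show thesis
      by (rule that[of "next_on_link n \<Gamma> p" "2 * s - 1" False])
        (use assms False next_on_link_in[OF assms(1)] next_on_seifert_other[OF assms(1)] orbit_next[OF assms(1)] in
          \<open>simp_all add: E seifert_node_def\<close>)
  qed
qed

text \<open>All identifications of the closed surface take place inside one flag, between two of its
  quadrilaterals.\<close>

lemma piece_gluing_lift:
  assumes "(a, a') \<in> piece_gluing"
  shows "\<exists>y\<in>topspace flag_space. \<exists>y'\<in>topspace flag_space.
    flag_surface y = a \<and> flag_surface y' = a' \<and> flag_equiv y y'"
proof -
  have *: ?thesis if "flag_surface (((q, e), i), w) = a" "flag_surface (((q, e), j), w) = a'" "q \<in> passages n \<Gamma>"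
      "i \<in> {0, 1, 2}" "j \<in> {0, 1, 2}" "w \<in> cube_face i" "w \<in> cube_face j" for q e i j w
    using that(1,2) flag_equiv_face[OF that(3-7), of e] topspace_flag_spaceI[OF that(3,4,6), of e]
      topspace_flag_spaceI[OF that(3,5,7), of e] by blast
  from assms consider
    (1) p s where "p \<in> passages n \<Gamma>" "s \<in> {0..1}"
      "a = (Seifert_Disk (orbit (next_on_seifert n \<Gamma>) p), node_point (next_on_seifert n \<Gamma>) p s)"
      "a' = (Band (crossing_of n \<Gamma> p), band_point n \<Gamma> p s 0)"
    | (2) p s where "p \<in> passages n \<Gamma>" "s \<in> {0..1}"
      "a = (Capping_Disk (orbit (next_on_link n \<Gamma>) p), node_point (next_on_link n \<Gamma>) p s)"
      "a' = (Band (crossing_of n \<Gamma> p), band_point n \<Gamma> p 0 s)"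
    | (3) p s where "p \<in> passages n \<Gamma>" "s \<in> {0..1}"
      "a = (Capping_Disk (orbit (next_on_link n \<Gamma>) p), edge_point (next_on_link n \<Gamma>) p s)"
      "a' = (Seifert_Disk (orbit (next_on_seifert n \<Gamma>) (other_passage n \<Gamma> p)),
        edge_point (next_on_seifert n \<Gamma>) (other_passage n \<Gamma> p) s)"
    unfolding band_gluing_def capping_gluing_def by blast
  then show ?thesis
  proof cases
    case 1
    obtain q e c where "q \<in> passages n \<Gamma>" "c \<in> {0..1}" "flag_surface (((q, e), 0), (1, c, 1)) = a"
      "flag_surface (((q, e), 2), (1, c, 1)) = a'"
      using band_gluing_flags[OF 1(1,2)] 1(3,4) by metis
    then show ?thesis by (intro *[of q e 0 "(1, c, 1)" 2]) auto
  next
    case 2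
    obtain e c where "c \<in> {0..1}" "flag_surface (((p, e), 1), (c, 1, 1)) = a"
      "flag_surface (((p, e), 2), (c, 1, 1)) = a'"
      using capping_gluing_node_flags[OF 2(1,2)] 2(3,4) by metis
    then show ?thesis using 2(1) by (intro *[of p e 1 "(c, 1, 1)" 2]) auto
  next
    case 3
    obtain q e c where "q \<in> passages n \<Gamma>" "c \<in> {0..1}" "flag_surface (((q, e), 1), (1, 1, c)) = a"
      "flag_surface (((q, e), 0), (1, 1, c)) = a'"
      using capping_gluing_edge_flags[OF 3(1,2)] 3(3,4) by metis
    then show ?thesis by (intro *[of q e 1 "(1, 1, c)" 0]) auto
  qed
qed

lemma flag_surface_seifert_band:
  assumes p: "p \<in> passages n \<Gamma>" and y: "y \<in> {0..1}"
  shows "(flag_surface (((p, e), 0), (1, y, 1)), flag_surface (((p, e), 2), (1, y, 1))) \<in> piece_gluing"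
proof -
  define s where "s = (if e then (1 + y) / 2 else (1 - y) / 2)"
  have s: "s \<in> {0..1}" using y by (auto simp: s_def)
  have m: "max y 1 = 1" using y by auto
  have "sector_map (next_on_seifert n \<Gamma>) (seifert_node p e) e y 1 = node_point (next_on_seifert n \<Gamma>) (seifert_node p e) s"
  proof (cases e)
    case True
    then have d: "(y - 1) / (2 * 1) = s - 1" by (simp add: s_def field_simps)
    show ?thesis by (simp only: True sector_map_def m d node_point_sector_point(2))
  next
    case False
    then have d: "(y - 1) / (2 * 1) = - s" by (simp add: s_def field_simps)
    show ?thesis by (simp only: False sector_map_def m d node_point_sector_point(1))
  qed
  moreover have "band_point n \<Gamma> p ((1 - y) / 2) (if e then (1 + 1) / 2 else (1 - 1) / 2) = band_point n \<Gamma> (seifert_node p e) s 0"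
    using p by (cases e) (simp_all add: s_def seifert_node_def band_point_other field_simps)
  moreover have "crossing_of n \<Gamma> (seifert_node p e) = crossing_of n \<Gamma> p"
    using other_passage(4)[OF p] by (simp add: seifert_node_def)
  ultimately have "(flag_surface (((p, e), 0), (1, y, 1)), flag_surface (((p, e), 2), (1, y, 1))) =
     ((Seifert_Disk (orbit (next_on_seifert n \<Gamma>) (seifert_node p e)), node_point (next_on_seifert n \<Gamma>) (seifert_node p e) s),
       (Band (crossing_of n \<Gamma> (seifert_node p e)), band_point n \<Gamma> (seifert_node p e) s 0))"
    by simp
  also have "\<dots> \<in> band_gluing n \<Gamma>"
    unfolding band_gluing_def using s seifert_node(1)[OF p, of e] by blast
  finally show ?thesis by blast
qed

lemma flag_surface_capping_band:
  assumes p: "p \<in> passages n \<Gamma>" and x: "x \<in> {0..1}"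
  shows "(flag_surface (((p, e), 1), (x, 1, 1)), flag_surface (((p, e), 2), (x, 1, 1))) \<in> piece_gluing"
proof -
  define s where "s = (if e then (1 + x) / 2 else (1 - x) / 2)"
  have s: "s \<in> {0..1}" using x by (auto simp: s_def)
  have m: "max x 1 = 1" using x by auto
  have "sector_map (next_on_link n \<Gamma>) p e x 1 = node_point (next_on_link n \<Gamma>) p s"
  proof (cases e)
    case True
    then have d: "(x - 1) / (2 * 1) = s - 1" by (simp add: s_def field_simps)
    show ?thesis by (simp only: True sector_map_def m d node_point_sector_point(2))
  next
    case False
    then have d: "(x - 1) / (2 * 1) = - s" by (simp add: s_def field_simps)
    show ?thesis by (simp only: False sector_map_def m d node_point_sector_point(1))
  qed
  then have "(flag_surface (((p, e), 1), (x, 1, 1)), flag_surface (((p, e), 2), (x, 1, 1))) =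
     ((Capping_Disk (orbit (next_on_link n \<Gamma>) p), node_point (next_on_link n \<Gamma>) p s),
       (Band (crossing_of n \<Gamma> p), band_point n \<Gamma> p 0 s))"
    by (simp add: s_def)
  also have "\<dots> \<in> capping_gluing n \<Gamma>"
    unfolding capping_gluing_def using s p by blast
  finally show ?thesis by blast
qed

lemma flag_surface_seifert_capping:
  assumes p: "p \<in> passages n \<Gamma>" and z: "z \<in> {0..1}"
  shows "(flag_surface (((p, e), 1), (1, 1, z)), flag_surface (((p, e), 0), (1, 1, z))) \<in> piece_gluing"
proof -
  have m: "max 1 z = 1" using z by auto
  have "\<exists>q s. q \<in> passages n \<Gamma> \<and> s \<in> {0..1} \<and>
    flag_surface (((p, e), 1), (1, 1, z)) = (Capping_Disk (orbit (next_on_link n \<Gamma>) q), edge_point (next_on_link n \<Gamma>) q s) \<and>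
    flag_surface (((p, e), 0), (1, 1, z)) = (Seifert_Disk (orbit (next_on_seifert n \<Gamma>) (other_passage n \<Gamma> q)),
        edge_point (next_on_seifert n \<Gamma>) (other_passage n \<Gamma> q) s)"
  proof (cases e)
    case True
    then show ?thesis
      using p z by (intro exI[of _ p] exI[of _ "(1 - z) / 2"])
        (simp add: sector_map_def m edge_point_sector_point seifert_node_def)
  next
    case False
    \<comment> \<open>An incoming end is the second half of the edge that leaves the preceding
      passage.\<close>
    obtain q where q: "q \<in> passages n \<Gamma>" "next_on_link n \<Gamma> q = p" using next_on_link_surj[OF p] .
    define s where "s = (1 + z) / 2"
    have s: "s \<in> {0..1}" "(1 - z) / (2 * 1) = 1 - s" using z by (auto simp: s_def field_simps)
    have sm: "sector_map f p False 1 z = sector_point f p False 1 (1 - s)" for f :: "passage \<Rightarrow> passage"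
      by (simp only: sector_map_def m s)
    have "edge_point (next_on_link n \<Gamma>) q s = sector_point (next_on_link n \<Gamma>) p False 1 (1 - s)"
      using edge_point_sector_point_next[OF finite_passages bij_betw_next_on_link q(1)] q(2) by simp
    moreover have "edge_point (next_on_seifert n \<Gamma>) (other_passage n \<Gamma> q) s = sector_point (next_on_seifert n \<Gamma>) p False 1 (1 - s)"
      using edge_point_sector_point_next[OF finite_passages bij_betw_next_on_seifert other_passage(1)[OF q(1)]]
        next_on_seifert_other[OF q(1)] q(2) by simp
    ultimately show ?thesis
      using False q(1) s(1) orbit_next[OF q(1)] q(2)
      by (intro exI[of _ q] exI[of _ s]) (simp add: sm seifert_node_def)
  qed
  then show ?thesis unfolding capping_gluing_def by blast
qed

text \<open>A \<open>face\<close> step becomes an identification of pieces, while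
  \<open>turn\<close>, \<open>other\<close> and \<open>along\<close> leave the image fixed. For the
  triangles it was \<open>turn\<close> and \<open>along\<close> that became identifications, while
  \<open>face\<close> and \<open>other\<close> left the image fixed.\<close>

lemma piece_gluing_push:
  assumes "(y, y') \<in> flag_gluing"
  shows "(flag_surface y, flag_surface y') \<in> generated_equiv piece_gluing"
proof -
  have "flag_step y y'" using assms by (simp add: flag_gluing_def)
  then show ?thesis
  proof (cases rule: flag_step.cases)
    case (face p i j w e)
    obtain a b c where w: "w = (a, b, c)" by (metis surj_pair)
    have sym: "(u, v) \<in> generated_equiv piece_gluing" if "(u, v) \<in> piece_gluing \<or> (v, u) \<in> piece_gluing \<or> u = v" for u v
      using that by (blast intro: generated_equiv_base generated_equiv_sym)
    note D = cube_faceD[OF face(6)[unfolded w]]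
    consider "i = j" | "{i, j} = {0, 2}" | "{i, j} = {1, 2}" | "{i, j} = {0, 1}" using face(4,5) by auto
    then show ?thesis
    proof cases
      case 1 then show ?thesis using face by simp
    next
      case 2
      then have "a = 1" "c = 1" using face(6,7) by (auto simp: w doubleton_eq_iff)
      then show ?thesis
        using 2 flag_surface_seifert_band[OF face(3) D(2), of e] unfolding face(1,2) w
        by (intro sym) (auto simp: doubleton_eq_iff simp del: flag_surface.simps)
    next
      case 3
      then have "b = 1" "c = 1" using face(6,7) by (auto simp: w doubleton_eq_iff)
      then show ?thesis
        using 3 flag_surface_capping_band[OF face(3) D(1), of e] unfolding face(1,2) w
        by (intro sym) (auto simp: doubleton_eq_iff simp del: flag_surface.simps)
    next
      case 4
      then have "a = 1" "b = 1" using face(6,7) by (auto simp: w doubleton_eq_iff)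
      then show ?thesis
        using 4 flag_surface_seifert_capping[OF face(3) D(3), of e] unfolding face(1,2) w
        by (intro sym) (auto simp: doubleton_eq_iff simp del: flag_surface.simps)
    qed
  next
    case (turn p i b c e)
    \<comment> \<open>A vanishing coordinate excludes the quadrilateral on which it is 1; the next
      two cases use the same fact.\<close>
    then have "i = 1 \<or> i = 2" by auto
    then have "flag_surface y = flag_surface y'"
      using sector_map_swap[of "next_on_link n \<Gamma>" p e c] unfolding turn(1,2) by auto
    then show ?thesis by simp
  next
    case (other p i a c e)
    then have "i = 0 \<or> i = 2" by auto
    moreover have "seifert_node (other_passage n \<Gamma> p) (\<not> e) = seifert_node p e"
      using other_passage(2)[OF other(3)] by (simp add: seifert_node_def)
    moreover have "band_point n \<Gamma> (other_passage n \<Gamma> p) (1 / 2) (if \<not> e then (1 + a) / 2 else (1 - a) / 2) =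
        band_point n \<Gamma> p (1 / 2) (if e then (1 + a) / 2 else (1 - a) / 2)"
      unfolding band_point_other[OF other(3)] by (simp add: field_simps)
    ultimately have "flag_surface y = flag_surface y'"
      using sector_map_swap[of "next_on_seifert n \<Gamma>" "seifert_node p e" e c] other_passage(4)[OF other(3)]
      unfolding other(1,2) by auto
    then show ?thesis by simp
  next
    case (along p i a b)
    then have "i = 0 \<or> i = 1" by auto
    moreover have "seifert_node (next_on_link n \<Gamma> p) False = next_on_seifert n \<Gamma> (seifert_node p True)"
      using next_on_seifert_other[OF along(3)] by (simp add: seifert_node_def)
    ultimately have "flag_surface y = flag_surface y'"
      using sector_map_next[OF finite_passages bij_betw_next_on_link along(3), of a]
        sector_map_next[OF finite_passages bij_betw_next_on_seifert seifert_node(1)[OF along(3), of True], of b]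
        orbit_next[OF along(3)]
      unfolding along(1,2) by (auto simp: seifert_node_def next_on_seifert_other[OF along(3)])
    then show ?thesis by simp
  qed
qed

lemma flags_homeomorphic_closed_seifert_surface:
  "quotient_space flag_space flag_gluing homeomorphic_space closed_seifert_surface n \<Gamma>"
  unfolding closed_seifert_surface_def
proof (rule homeomorphic_space_quotient_space[OF quotient_map_flag_surface])
  fix y y' assume "y \<in> topspace flag_space" "y' \<in> topspace flag_space" "flag_surface y = flag_surface y'"
  then show "flag_equiv y y'"
    by (elim flag_space_cases) (metis flag_surface_eqD)
qed (fact piece_gluing_lift, fact piece_gluing_push)

lemma glued_triangles_homeomorphic_closed_seifert_surface:
  "glued_triangles (crossings n \<Gamma> \<times> UNIV) side_pairing homeomorphic_space closed_seifert_surface n \<Gamma>"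
  using flags_homeomorphic_glued_triangles flags_homeomorphic_closed_seifert_surface
  by (meson homeomorphic_space_sym homeomorphic_space_trans)

end

section \<open>Regions near a point of the diagram\<close>

abbreviation cross :: "complex \<Rightarrow> complex \<Rightarrow> real" where
  "cross v w \<equiv> Im (cnj v * w)"

lemma cross_swap: "cross v w = - cross w v"
  by (simp add: algebra_simps)

lemma cross_eq_0_swap: "cross v w = 0 \<longleftrightarrow> cross w v = 0"
  by (metis cross_swap neg_equal_0_iff_equal)

lemma cross_scale_right: "cross v (of_real r * w) = r * cross v w"
  by (simp add: algebra_simps)

lemma abs_cross_le: "\<bar>cross v w\<bar> \<le> norm v * norm w"
  using abs_Im_le_cmod[of "cnj v * w"] by (simp add: norm_mult)

lemma cross_i_times: "cross v (\<i> * v) = (norm v)\<^sup>2"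
  by (simp add: cmod_power2 flip: power2_eq_square)

lemma inner_i_times: "w \<bullet> (\<i> * v) = cross v w"
  by (simp add: inner_complex_def)

section \<open>Strict differentiability and transversality\<close>

text \<open>Both ends of the chord may vary. The mean value inequality is applied to
  \<open>f\<close> minus its linear part, whose derivative \<open>v t - v t0\<close> is small near
  \<open>t0\<close>.\<close>

lemma C1_strict_derivative:
  fixes f :: "real \<Rightarrow> complex"
  assumes f: "\<And>t. (f has_vector_derivative v t) (at t)" and v: "isCont v t0" and "\<kappa> > 0"
  obtains \<epsilon> where "\<epsilon> > 0"
    "\<And>s s'. s \<in> ball t0 \<epsilon> \<Longrightarrow> s' \<in> ball t0 \<epsilon> \<Longrightarrow> norm (f s' - f s - of_real (s' - s) * v t0) \<le> \<kappa> * \<bar>s' - s\<bar>"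
proof -
  obtain \<epsilon> where \<epsilon>: "\<epsilon> > 0" "\<And>s. dist s t0 < \<epsilon> \<Longrightarrow> dist (v s) (v t0) < \<kappa>"
    using v \<open>\<kappa> > 0\<close> unfolding continuous_at_eps_delta by blast
  show thesis
  proof
    fix s s' assume s: "s \<in> ball t0 \<epsilon>" "s' \<in> ball t0 \<epsilon>"
    define h where "h t = f t - t *\<^sub>R v t0" for t
    have "norm (h s' - h s) \<le> \<kappa> * norm (s' - s)"
    proof (rule differentiable_bound[OF convex_ball, of t0 \<epsilon> h "\<lambda>t x. x *\<^sub>R (v t - v t0)"])
      fix t assume t: "t \<in> ball t0 \<epsilon>"
      have "((\<lambda>t. t *\<^sub>R v t0) has_vector_derivative v t0) (at t)"
        unfolding has_vector_derivative_def by (auto intro!: derivative_eq_intros)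
      then have "(h has_vector_derivative v t - v t0) (at t)"
        unfolding h_def by (rule has_vector_derivative_diff[OF f])
      then show "(h has_derivative (\<lambda>x. x *\<^sub>R (v t - v t0))) (at t within ball t0 \<epsilon>)"
        by (simp add: has_vector_derivative_def has_derivative_at_withinI)
      have "norm (v t - v t0) \<le> \<kappa>"
        using \<epsilon>(2)[of t] t by (simp add: dist_commute dist_norm norm_minus_commute less_imp_le)
      then show "onorm (\<lambda>x. x *\<^sub>R (v t - v t0)) \<le> \<kappa>"
        by (intro onorm_le) (simp add: mult.commute[of \<kappa>] mult_left_mono)
    qed (use s in auto)
    then show "norm (f s' - f s - of_real (s' - s) * v t0) \<le> \<kappa> * \<bar>s' - s\<bar>"
      by (simp add: h_def scaleR_conv_of_real algebra_simps)
  qed (rule \<epsilon>(1))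
qed

text \<open>A chord of the curve near \<open>t0\<close> is almost parallel to \<open>v t0\<close>,
  so it cannot be a multiple of a transversal direction. Compactness of \<open>K\<close> makes this
  uniform in the direction.\<close>

lemma C1_transversal:
  fixes f :: "real \<Rightarrow> complex"
  assumes f: "\<And>t. (f has_vector_derivative v t) (at t)" and v: "isCont v t0"
    and K: "compact K" "\<And>w. w \<in> K \<Longrightarrow> cross (v t0) w \<noteq> 0"
  obtains \<epsilon> where "\<epsilon> > 0"
    "\<And>s s' w e. s \<in> ball t0 \<epsilon> \<Longrightarrow> s' \<in> ball t0 \<epsilon> \<Longrightarrow> w \<in> K \<Longrightarrow> e \<noteq> 0 \<Longrightarrow> f s + of_real e * w \<noteq> f s'"
proof (cases "K = {}")
  case True
  then show thesis using that[of 1] by simp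
next
  case False
  have "continuous_on K (\<lambda>w. \<bar>cross (v t0) w\<bar>)" by (intro continuous_intros)
  then obtain w0 where w0: "w0 \<in> K" "\<And>w. w \<in> K \<Longrightarrow> \<bar>cross (v t0) w0\<bar> \<le> \<bar>cross (v t0) w\<bar>"
    using continuous_attains_inf[OF K(1) False] by blast
  define c where "c = \<bar>cross (v t0) w0\<bar>"
  have c: "c > 0" using K(2)[OF w0(1)] by (simp add: c_def del: complex_cnj_mult)
  obtain M where M: "M > 0" "\<And>w. w \<in> K \<Longrightarrow> norm w \<le> M"
    using compact_imp_bounded[OF K(1)] bounded_pos by metis
  \<comment> \<open>With this error bound, the determinant of \<open>w\<close> with the deviation of
    a chord is at most half of what transversality demands.\<close>
  have k: "c / (2 * M) > 0" using c M by simp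
  obtain \<epsilon> where \<epsilon>: "\<epsilon> > 0" "\<And>s s'. s \<in> ball t0 \<epsilon> \<Longrightarrow> s' \<in> ball t0 \<epsilon> \<Longrightarrow>
      norm (f s' - f s - of_real (s' - s) * v t0) \<le> c / (2 * M) * \<bar>s' - s\<bar>"
    using C1_strict_derivative[OF f v k] by blast
  show thesis
  proof (rule that[OF \<epsilon>(1)], rule notI)
    fix s s' w e assume s: "s \<in> ball t0 \<epsilon>" "s' \<in> ball t0 \<epsilon>" and w: "w \<in> K" and e: "e \<noteq> (0::real)"
      and eq: "f s + of_real e * w = f s'"
    have d: "f s' - f s = of_real e * w" using eq by (simp add: algebra_simps)
    have "w \<noteq> 0" using K(2)[OF w] by auto
    then have ne: "s' \<noteq> s" using d e by auto
    have "\<bar>cross w (of_real e * w - of_real (s' - s) * v t0)\<bar> \<le> norm w * (c / (2 * M) * \<bar>s' - s\<bar>)"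
      using \<epsilon>(2)[OF s] unfolding d by (intro order_trans[OF abs_cross_le] mult_left_mono) auto
    also have "\<dots> \<le> M * (c / (2 * M) * \<bar>s' - s\<bar>)"
      using M(2)[OF w] c M by (intro mult_right_mono) auto
    also have "\<dots> = c / 2 * \<bar>s' - s\<bar>" using M by simp
    finally have 1: "\<bar>cross w (of_real e * w - of_real (s' - s) * v t0)\<bar> \<le> c / 2 * \<bar>s' - s\<bar>" .
    have "cross w (of_real e * w - of_real (s' - s) * v t0) = (s' - s) * cross (v t0) w"
      by (simp add: algebra_simps)
    then have "\<bar>s' - s\<bar> * \<bar>cross (v t0) w\<bar> \<le> c / 2 * \<bar>s' - s\<bar>" using 1 by (simp add: abs_mult)
    then have "\<bar>cross (v t0) w\<bar> \<le> c / 2"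
      using ne by (simp add: mult.commute)
    moreover have "c \<le> \<bar>cross (v t0) w\<bar>" using w0(2)[OF w] by (simp add: c_def)
    ultimately show False using c by simp
  qed
qed

lemma cross_ne0_on_cball:
  assumes "cross v w \<noteq> 0"
  obtains r where "r > 0" "\<And>w'. w' \<in> cball w r \<Longrightarrow> sgn (cross v w') = sgn (cross v w)"
proof -
  have v: "norm v > 0" using assms by auto
  \<comment> \<open>By \<open>abs_cross_le\<close>, a change of \<open>w\<close> by at most
    \<open>r\<close> changes the determinant by at most half of its value, so the sign
    survives.\<close>
  define r where "r = \<bar>cross v w\<bar> / (2 * norm v)"
  have r: "r > 0" unfolding r_def using assms v by (intro divide_pos_pos) (simp_all del: complex_cnj_mult)
  show thesis
  proof (rule that[OF r])
    fix w' assume "w' \<in> cball w r"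
    then have "norm (w' - w) \<le> r" by (simp add: dist_norm norm_minus_commute)
    then have "\<bar>cross v (w' - w)\<bar> \<le> norm v * r"
      by (intro order_trans[OF abs_cross_le] mult_left_mono) auto
    also have "\<dots> = \<bar>cross v w\<bar> / 2" using v by (simp add: r_def)
    finally have "\<bar>cross v w' - cross v w\<bar> \<le> \<bar>cross v w\<bar> / 2" by (simp add: algebra_simps)
    moreover define X Y where "X = cross v w'" and "Y = cross v w"
    ultimately have "\<bar>X - Y\<bar> \<le> \<bar>Y\<bar> / 2" "Y \<noteq> 0" using assms by simp_all
    then have "sgn X = sgn Y" by (auto simp: sgn_if abs_if split: if_splits)
    then show "sgn (cross v w') = sgn (cross v w)" by (simp add: X_def Y_def)
  qed
qed

context link_diagram
begin

section \<open>The diagram and its regions near a regular point\<close>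

abbreviation \<gamma> :: "nat \<Rightarrow> real \<Rightarrow> complex" where
  "\<gamma> i t \<equiv> fst (\<Gamma> i t)"

definition velocity :: "nat \<Rightarrow> real \<Rightarrow> complex" where
  "velocity i t = vector_derivative (\<gamma> i) (at t)"

lemma plane_point_Pair: "plane_point \<Gamma> (i, t) = \<gamma> i t"
  by (simp add: plane_point_def space_point_def)

lemma normal_Pair: "normal \<Gamma> (i, t) = \<i> * velocity i t"
  by (simp add: normal_def tangent_def velocity_def)

lemma tangent_Pair: "tangent \<Gamma> (i, t) = velocity i t"
  by (simp add: tangent_def velocity_def)

lemma link_derivative:
  assumes "i < n"
  shows "\<exists>D. (\<forall>t. (\<Gamma> i has_vector_derivative D t) (at t)) \<and> continuous_on UNIV D"
  using assms link unfolding oriented_link_def C1_differentiable_on_def by blast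

lemma velocity:
  assumes "i < n"
  shows "(\<gamma> i has_vector_derivative velocity i t) (at t)" "isCont (velocity i) t" "velocity i t \<noteq> 0"
proof -
  obtain D where D: "\<And>t. (\<Gamma> i has_vector_derivative D t) (at t)" "continuous_on UNIV D"
    using link_derivative[OF assms] by blast
  have d: "(\<gamma> i has_vector_derivative fst (D t)) (at t)" for t
    using bounded_linear.has_vector_derivative[OF bounded_linear_fst D(1)] .
  then have v: "velocity i = (\<lambda>t. fst (D t))"
    unfolding velocity_def by (auto intro: vector_derivative_at)
  show "(\<gamma> i has_vector_derivative velocity i t) (at t)" using d by (simp add: v)
  have "continuous_on UNIV (\<lambda>t. fst (D t))" by (intro continuous_intros D(2))
  then show "isCont (velocity i) t" by (simp add: v continuous_on_eq_continuous_at)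
  show "velocity i t \<noteq> 0"
    using regular assms by (simp add: regular_projection_def velocity_def)
qed

lemma continuous_link: "i < n \<Longrightarrow> continuous_on S (\<Gamma> i)"
  using link_derivative by (metis has_vector_derivative_continuous continuous_at_imp_continuous_on)

lemma continuous_curve: "i < n \<Longrightarrow> continuous_on S (\<gamma> i)"
  by (intro continuous_intros continuous_link)

lemma link_periodic_nat: "i < n \<Longrightarrow> \<Gamma> i (t + real k) = \<Gamma> i t"
proof (induction k)
  case (Suc k)
  have "\<Gamma> i ((t + real k) + 1) = \<Gamma> i (t + real k)" using link Suc.prems unfolding oriented_link_def by blast
  then show ?case using Suc by (simp add: algebra_simps)
qed simp

lemma link_periodic:
  assumes "i < n"
  shows "\<Gamma> i (t + of_int k) = \<Gamma> i t"
proof (cases "k \<ge> 0")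
  case True
  then show ?thesis using link_periodic_nat[OF assms, of t "nat k"] by simp
next
  case False
  then show ?thesis using link_periodic_nat[OF assms, of "t + of_int k" "nat (- k)"] by simp
qed

lemma link_frac: "i < n \<Longrightarrow> \<Gamma> i (frac t) = \<Gamma> i t"
  using link_periodic[of i "frac t" "\<lfloor>t\<rfloor>"] by (simp add: frac_def)

lemma velocity_frac:
  assumes "i < n"
  shows "velocity i (frac t) = velocity i t"
proof -
  have "(\<gamma> i has_vector_derivative velocity i t) (at (frac t + of_int \<lfloor>t\<rfloor>))"
    using velocity(1)[OF assms, of t] by (simp add: frac_def)
  moreover have "((\<lambda>s. s + of_int \<lfloor>t\<rfloor>) has_vector_derivative 1) (at (frac t))"
    by (auto intro!: derivative_eq_intros)
  ultimately have "((\<lambda>s. \<gamma> i (s + of_int \<lfloor>t\<rfloor>)) has_vector_derivative velocity i t) (at (frac t))"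
    using vector_diff_chain_at[of "\<lambda>s. s + of_int \<lfloor>t\<rfloor>" 1 "frac t" "\<gamma> i" "velocity i t"] by (simp add: comp_def)
  then show ?thesis
    using link_periodic[OF assms] by (simp add: velocity_def vector_derivative_at)
qed

lemma diagram_set_conv: "diagram_set n \<Gamma> = (\<Union>i<n. \<gamma> i ` {0..1})"
proof -
  have "\<gamma> i t \<in> \<gamma> i ` {0..1}" if "i < n" for i t
    using link_frac[OF that, of t] frac_ge_0[of t] frac_lt_1[of t]
    by (intro image_eqI[of _ _ "frac t"]) auto
  then show ?thesis by (auto simp: diagram_set_def link_set_def image_iff)
qed

text \<open>The parts of the curves whose parameters stay away from the preimages of
  \<open>z\<close> form a compact set that misses \<open>z\<close>, so they keep a positive distance
  from it.\<close>

lemma near_diagram_point: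
  assumes "\<epsilon> > 0"
  obtains \<rho> where "\<rho> > 0" "\<And>w. w \<in> diagram_set n \<Gamma> \<Longrightarrow> dist z w < \<rho> \<Longrightarrow>
    \<exists>i t s. i < n \<and> \<gamma> i t = z \<and> \<bar>s - t\<bar> < \<epsilon> \<and> w = \<gamma> i s"
proof -
  \<comment> \<open>Balls around all real preimages are removed, including preimages just outside
    the unit interval.\<close>
  define C where "C i = {0..1} - (\<Union>t\<in>{t. \<gamma> i t = z}. ball t \<epsilon>)" for i
  define F where "F = (\<Union>i<n. \<gamma> i ` C i)"
  have "compact (C i)" for i unfolding C_def by (intro compact_diff) auto
  then have "compact F"
    unfolding F_def by (intro compact_UN finite_lessThan compact_continuous_image continuous_curve) auto
  moreover have "z \<notin> F" using assms by (auto simp: F_def C_def)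
  ultimately obtain \<rho> where \<rho>: "\<rho> > 0" "\<And>w. w \<in> F \<Longrightarrow> \<rho> \<le> dist z w"
    using separate_point_closed[of F z] compact_imp_closed by blast
  show thesis
  proof (rule that[OF \<rho>(1)])
    fix w assume w: "w \<in> diagram_set n \<Gamma>" "dist z w < \<rho>"
    then obtain i s where s: "i < n" "s \<in> {0..1}" "w = \<gamma> i s" by (auto simp: diagram_set_conv)
    have "w \<notin> F" using \<rho>(2) w(2) by force
    then have "s \<notin> C i" using s by (auto simp: F_def)
    then obtain t where "\<gamma> i t = z" "s \<in> ball t \<epsilon>" using s(2) unfolding C_def by blast
    then show "\<exists>i t s. i < n \<and> \<gamma> i t = z \<and> \<bar>s - t\<bar> < \<epsilon> \<and> w = \<gamma> i s"
      using s by (intro exI[of _ i] exI[of _ t] exI[of _ s]) (simp add: dist_real_def abs_minus_commute)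
  qed
qed

lemma same_frac_shift:
  assumes "i < n" "frac t = frac t0" "\<bar>s - t\<bar> < \<epsilon>"
  obtains s' where "s' \<in> ball t0 \<epsilon>" "\<gamma> i s = \<gamma> i s'"
proof -
  define k where "k = \<lfloor>t0\<rfloor> - \<lfloor>t\<rfloor>"
  have k: "t0 = t + of_int k" using assms(2) by (simp add: k_def frac_def)
  show thesis
    by (rule that[of "s + of_int k"]) (use assms(3) k link_periodic[OF assms(1), of s k] in \<open>auto simp: dist_real_def\<close>)
qed

lemma frac_param: "i < n \<Longrightarrow> (i, frac t) \<in> {..<n} \<times> {0..<1}"
  by (simp add: frac_lt_1)

lemma near_regular_point:
  assumes i: "i < n" and reg: "(i, frac t0) \<notin> passages n \<Gamma>" and "\<epsilon> > 0"
  obtains \<rho> where "\<rho> > 0" "\<And>w. w \<in> diagram_set n \<Gamma> \<Longrightarrow> dist (\<gamma> i t0) w < \<rho> \<Longrightarrow> w \<in> \<gamma> i ` ball t0 \<epsilon>"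
proof -
  obtain \<rho> where \<rho>: "\<rho> > 0" "\<And>w. w \<in> diagram_set n \<Gamma> \<Longrightarrow> dist (\<gamma> i t0) w < \<rho> \<Longrightarrow>
    \<exists>j t s. j < n \<and> \<gamma> j t = \<gamma> i t0 \<and> \<bar>s - t\<bar> < \<epsilon> \<and> w = \<gamma> j s"
    using near_diagram_point[OF assms(3)] by blast
  show thesis
  proof (rule that[OF \<rho>(1)])
    fix w assume "w \<in> diagram_set n \<Gamma>" "dist (\<gamma> i t0) w < \<rho>"
    then obtain j t s where j: "j < n" "\<gamma> j t = \<gamma> i t0" "\<bar>s - t\<bar> < \<epsilon>" "w = \<gamma> j s" using \<rho>(2) by blast
    have "(j, frac t) = (i, frac t0)"
    proof (rule ccontr)
      assume "(j, frac t) \<noteq> (i, frac t0)"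
      moreover have "plane_point \<Gamma> (i, frac t0) = plane_point \<Gamma> (j, frac t)"
        using j i by (simp add: plane_point_Pair link_frac)
      ultimately show False
        using double_point_passage[OF frac_param[OF i, of t0] frac_param[OF j(1), of t]] crossing_passages reg by metis
    qed
    then show "w \<in> \<gamma> i ` ball t0 \<epsilon>"
      using same_frac_shift[OF i _ j(3), of t0] j(4) by (metis Pair_inject image_eqI)
  qed
qed

lemma near_crossing_point:
  assumes pq: "(i, a) \<in> passages n \<Gamma>" "other_passage n \<Gamma> (i, a) = (j, b)" and "\<epsilon> > 0"
  obtains \<rho> where "\<rho> > 0" "\<And>w. w \<in> diagram_set n \<Gamma> \<Longrightarrow> dist (\<gamma> i a) w < \<rho> \<Longrightarrow>
    w \<in> \<gamma> i ` ball a \<epsilon> \<union> \<gamma> j ` ball b \<epsilon>"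
proof -
  have qP: "(j, b) \<in> passages n \<Gamma>" using other_passage(1)[OF pq(1)] pq(2) by simp
  have ij: "i < n" "j < n" and ab: "frac a = a" "frac b = b"
    using passages_param[OF pq(1)] passages_param[OF qP] by (auto simp: frac_eq)
  obtain \<rho> where \<rho>: "\<rho> > 0" "\<And>w. w \<in> diagram_set n \<Gamma> \<Longrightarrow> dist (\<gamma> i a) w < \<rho> \<Longrightarrow>
    \<exists>k t s. k < n \<and> \<gamma> k t = \<gamma> i a \<and> \<bar>s - t\<bar> < \<epsilon> \<and> w = \<gamma> k s"
    using near_diagram_point[OF assms(3)] by blast
  show thesis
  proof (rule that[OF \<rho>(1)])
    fix w assume "w \<in> diagram_set n \<Gamma>" "dist (\<gamma> i a) w < \<rho>"
    then obtain k t s where k: "k < n" "\<gamma> k t = \<gamma> i a" "\<bar>s - t\<bar> < \<epsilon>" "w = \<gamma> k s" using \<rho>(2) by blast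
    have "(k, frac t) = (i, a) \<or> (k, frac t) = (j, b)"
    proof (rule ccontr)
      assume *: "\<not> ((k, frac t) = (i, a) \<or> (k, frac t) = (j, b))"
      have "plane_point \<Gamma> (i, a) = plane_point \<Gamma> (k, frac t)"
        using k by (simp add: plane_point_Pair link_frac)
      then have "((i, a), (k, frac t)) \<in> crossings n \<Gamma> \<or> ((k, frac t), (i, a)) \<in> crossings n \<Gamma>"
        using double_point_passage[OF passages_param[OF pq(1)] frac_param[OF k(1), of t]] * by metis
      then have "other_passage n \<Gamma> (i, a) = (k, frac t)" using other_passage_crossing by metis
      then show False using * pq(2) by simp
    qed
    then show "w \<in> \<gamma> i ` ball a \<epsilon> \<union> \<gamma> j ` ball b \<epsilon>"
    proof (elim disjE)
      assume *: "(k, frac t) = (i, a)"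
      then have "frac t = frac a" using ab by simp
      from same_frac_shift[OF ij(1) this k(3)] show ?thesis using * k(4) by blast
    next
      assume *: "(k, frac t) = (j, b)"
      then have "frac t = frac b" using ab by simp
      from same_frac_shift[OF ij(2) this k(3)] show ?thesis using * k(4) by blast
    qed
  qed
qed

lemma connected_in_region:
  assumes "connected S" "S \<noteq> {}" "S \<inter> diagram_set n \<Gamma> = {}"
  obtains R where "R \<in> regions n \<Gamma>" "S \<subseteq> R"
proof -
  obtain x where x: "x \<in> S" using assms(2) by blast
  have "S \<subseteq> connected_component_set (- diagram_set n \<Gamma>) x"
    using connected_component_maximal[OF x assms(1)] assms(3) by blast
  moreover have "connected_component_set (- diagram_set n \<Gamma>) x \<in> regions n \<Gamma>"
    using x assms(3) by (auto simp: regions_def components_def)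
  ultimately show thesis using that by blast
qed

lemma regions_unique: "R \<in> regions n \<Gamma> \<Longrightarrow> R' \<in> regions n \<Gamma> \<Longrightarrow> x \<in> R \<Longrightarrow> x \<in> R' \<Longrightarrow> R = R'"
  unfolding regions_def by (metis components_nonoverlap disjoint_iff)

text \<open>Regions are disjoint and \<open>at_right 0\<close> is a proper filter, so any initial
  piece of the ray determines the region.\<close>

lemma region_towards_eqI:
  assumes "R \<in> regions n \<Gamma>" "\<epsilon> > 0" "\<And>e. 0 < e \<Longrightarrow> e < \<epsilon> \<Longrightarrow> z + of_real e * d \<in> R"
  shows "region_towards n \<Gamma> z d = R"
proof -
  have ev: "\<forall>\<^sub>F e in at_right (0::real). z + of_real e * d \<in> R"
    using assms(2,3) by (auto simp: eventually_at_right[of 0 1] intro!: exI[of _ \<epsilon>])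
  show ?thesis
    unfolding region_towards_def
  proof (rule the_equality)
    fix R' assume R': "R' \<in> regions n \<Gamma> \<and> (\<forall>\<^sub>F e in at_right (0::real). z + of_real e * d \<in> R')"
    then have "\<forall>\<^sub>F e in at_right (0::real). z + of_real e * d \<in> R \<and> z + of_real e * d \<in> R'"
      using ev by (auto intro: eventually_conj)
    then obtain e where "z + of_real e * d \<in> R" "z + of_real e * d \<in> R'"
      using eventually_happens[of _ "at_right (0::real)"] by fastforce
    then show "R' = R" using regions_unique assms(1) R' by blast
  qed (use assms(1) ev in blast)
qed

text \<open>Short displacements from a piece of the strand in the directions of \<open>K\<close>
  sweep out a connected set that misses the diagram. Having one region for all base points and all
  directions is what later allows both to vary.\<close>

lemma side_region:
  assumes i: "i < n" and reg: "(i, frac t0) \<notin> passages n \<Gamma>"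
    and K: "compact K" "connected K" "K \<noteq> {}" "\<And>w. w \<in> K \<Longrightarrow> cross (velocity i t0) w \<noteq> 0"
  obtains \<epsilon> R where "\<epsilon> > 0" "R \<in> regions n \<Gamma>"
    "\<And>s e w. s \<in> ball t0 \<epsilon> \<Longrightarrow> 0 < e \<Longrightarrow> e < \<epsilon> \<Longrightarrow> w \<in> K \<Longrightarrow> \<gamma> i s + of_real e * w \<in> R"
proof -
  obtain \<epsilon>1 where \<epsilon>1: "\<epsilon>1 > 0"
    "\<And>s s' w e. s \<in> ball t0 \<epsilon>1 \<Longrightarrow> s' \<in> ball t0 \<epsilon>1 \<Longrightarrow> w \<in> K \<Longrightarrow> e \<noteq> 0 \<Longrightarrow> \<gamma> i s + of_real e * w \<noteq> \<gamma> i s'"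
    using C1_transversal[OF velocity(1,2)[OF i] K(1,4)] by blast
  obtain \<rho> where \<rho>: "\<rho> > 0" "\<And>w. w \<in> diagram_set n \<Gamma> \<Longrightarrow> dist (\<gamma> i t0) w < \<rho> \<Longrightarrow> w \<in> \<gamma> i ` ball t0 \<epsilon>1"
    using near_regular_point[OF i reg \<epsilon>1(1)] by blast
  have "isCont (\<gamma> i) t0" using continuous_curve[OF i, of UNIV] by (simp add: continuous_on_eq_continuous_at)
  then obtain \<epsilon>2 where \<epsilon>2: "\<epsilon>2 > 0" "\<And>s. dist s t0 < \<epsilon>2 \<Longrightarrow> dist (\<gamma> i s) (\<gamma> i t0) < \<rho> / 2"
    using \<rho>(1) unfolding continuous_at_eps_delta by (meson half_gt_zero)
  obtain M where M: "M > 0" "\<And>w. w \<in> K \<Longrightarrow> norm w \<le> M"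
    using compact_imp_bounded[OF K(1)] bounded_pos by metis
  \<comment> \<open>\<open>\<epsilon>1\<close> serves transversality. The other two bounds keep the
    swept set within distance \<open>\<rho>\<close> of the point, where the diagram is covered by
    the piece of the strand over \<open>ball t0 \<epsilon>1\<close>.\<close>
  define \<epsilon> where "\<epsilon> = min \<epsilon>1 (min \<epsilon>2 (\<rho> / (2 * M)))"
  have \<epsilon>: "\<epsilon> > 0" "\<epsilon> \<le> \<epsilon>1" "\<epsilon> \<le> \<epsilon>2" "\<epsilon> * M \<le> \<rho> / 2"
  proof -
    show "\<epsilon> > 0" "\<epsilon> \<le> \<epsilon>1" "\<epsilon> \<le> \<epsilon>2" using \<epsilon>1(1) \<epsilon>2(1) \<rho>(1) M(1) by (auto simp: \<epsilon>_def)
    have "\<epsilon> \<le> \<rho> / (2 * M)" by (simp add: \<epsilon>_def)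
    then show "\<epsilon> * M \<le> \<rho> / 2" using M(1) by (simp add: field_simps)
  qed
  define S where "S = (\<lambda>(s, e, w). \<gamma> i s + of_real e * w) ` (ball t0 \<epsilon> \<times> {0<..<\<epsilon>} \<times> K)"
  have "continuous_on (ball t0 \<epsilon> \<times> {0<..<\<epsilon>} \<times> K) (\<lambda>x. \<gamma> i (fst x) + of_real (fst (snd x)) * snd (snd x))"
    by (intro continuous_intros continuous_on_compose2[OF continuous_link[OF i, of UNIV]]) auto
  then have "connected S"
    unfolding S_def case_prod_beta
    by (rule connected_continuous_image) (intro connected_Times K(2); simp add: convex_connected)
  moreover have "S \<noteq> {}" using \<epsilon>(1) K(3) by (auto simp: S_def)
  moreover have "S \<inter> diagram_set n \<Gamma> = {}"
  proof (rule ccontr)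
    assume "S \<inter> diagram_set n \<Gamma> \<noteq> {}"
    then obtain s e w where s: "s \<in> ball t0 \<epsilon>" "0 < e" "e < \<epsilon>" "w \<in> K"
      and D: "\<gamma> i s + of_real e * w \<in> diagram_set n \<Gamma>" by (auto simp: S_def)
    have "e * norm w \<le> \<epsilon> * M" using s M by (intro mult_mono) auto
    then have "norm (of_real e * w) \<le> \<rho> / 2" using \<epsilon>(4) s(2) by (simp add: norm_mult)
    moreover have "norm (\<gamma> i s - \<gamma> i t0) < \<rho> / 2"
      using \<epsilon>2(2)[of s] s(1) \<epsilon>(3) by (simp add: dist_norm dist_commute norm_minus_commute)
    moreover have "norm (\<gamma> i s + of_real e * w - \<gamma> i t0) \<le> norm (\<gamma> i s - \<gamma> i t0) + norm (of_real e * w)"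
      using norm_triangle_ineq[of "\<gamma> i s - \<gamma> i t0" "of_real e * w"] by (simp add: algebra_simps)
    ultimately have "dist (\<gamma> i t0) (\<gamma> i s + of_real e * w) < \<rho>"
      by (simp add: dist_norm norm_minus_commute)
    then obtain s' where "s' \<in> ball t0 \<epsilon>1" "\<gamma> i s + of_real e * w = \<gamma> i s'" using \<rho>(2)[OF D] by blast
    moreover have "s \<in> ball t0 \<epsilon>1" using s(1) \<epsilon>(2) by auto
    ultimately show False using \<epsilon>1(2)[of s s' w e] s by auto
  qed
  ultimately obtain R where R: "R \<in> regions n \<Gamma>" "S \<subseteq> R" by (rule connected_in_region)
  show thesis
  proof (rule that[OF \<epsilon>(1) R(1)])
    fix s e w assume "s \<in> ball t0 \<epsilon>" "0 < e" "e < \<epsilon>" "w \<in> K"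
    then have "\<gamma> i s + of_real e * w \<in> S" by (force simp: S_def)
    then show "\<gamma> i s + of_real e * w \<in> R" using R(2) by blast
  qed
qed

lemma side_region_locally_constant:
  assumes i: "i < n" and reg: "(i, frac t0) \<notin> passages n \<Gamma>" and c: "c \<noteq> 0"
  shows "\<forall>\<^sub>F s in at t0. region_towards n \<Gamma> (\<gamma> i t0) (of_real c * (\<i> * velocity i t0)) =
    region_towards n \<Gamma> (\<gamma> i s) (of_real c * (\<i> * velocity i s))"
proof -
  let ?d = "\<lambda>s. of_real c * (\<i> * velocity i s)"
  have v0: "velocity i t0 \<noteq> 0" by (rule velocity(3)[OF i])
  have "cross (velocity i t0) (?d t0) = c * (norm (velocity i t0))\<^sup>2"
    by (simp only: cross_scale_right cross_i_times)
  then have cr: "cross (velocity i t0) (?d t0) \<noteq> 0" using c v0 by simp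
  \<comment> \<open>A ball of directions absorbs the variation of the normal with the
    parameter.\<close>
  obtain r where r: "r > 0" "\<And>w'. w' \<in> cball (?d t0) r \<Longrightarrow> sgn (cross (velocity i t0) w') = sgn (cross (velocity i t0) (?d t0))"
    using cross_ne0_on_cball[OF cr] by blast
  have "cross (velocity i t0) w \<noteq> 0" if "w \<in> cball (?d t0) r" for w
    using r(2)[OF that] cr by (metis sgn_zero_iff)
  then obtain \<epsilon> R where \<epsilon>: "\<epsilon> > 0" "R \<in> regions n \<Gamma>"
    "\<And>s e w. s \<in> ball t0 \<epsilon> \<Longrightarrow> 0 < e \<Longrightarrow> e < \<epsilon> \<Longrightarrow> w \<in> cball (?d t0) r \<Longrightarrow> \<gamma> i s + of_real e * w \<in> R"
    using side_region[OF i reg compact_cball, of "?d t0" r] r(1)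
    by (metis cball_eq_empty convex_cball convex_connected less_asym)
  have R: "region_towards n \<Gamma> (\<gamma> i s) (?d s) = R" if "s \<in> ball t0 \<epsilon>" "dist (?d s) (?d t0) < r" for s
    using region_towards_eqI[OF \<epsilon>(2,1), of "\<gamma> i s" "?d s"] \<epsilon>(3)[OF that(1)] that(2)
    by (simp add: dist_commute less_imp_le)
  have "isCont ?d t0" by (intro continuous_intros velocity(2)[OF i])
  then have "\<forall>\<^sub>F s in at t0. dist (?d s) (?d t0) < r"
    using r(1) by (simp add: isCont_def tendsto_iff)
  moreover have "\<forall>\<^sub>F s in at t0. s \<in> ball t0 \<epsilon>"
    using \<epsilon>(1) by (intro eventually_at_topological[THEN iffD2] exI[of _ "ball t0 \<epsilon>"]) auto
  ultimately show ?thesis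
  proof eventually_elim
    case (elim s)
    then show ?case using R[of s] R[of t0] \<epsilon>(1) r(1) by simp
  qed
qed

lemma side_region_constant:
  assumes i: "i < n" and reg: "\<And>t. a < t \<Longrightarrow> t < b \<Longrightarrow> (i, frac t) \<notin> passages n \<Gamma>" and c: "c \<noteq> 0"
    and st: "s \<in> {a<..<b}" "t \<in> {a<..<b}"
  shows "region_towards n \<Gamma> (\<gamma> i s) (of_real c * (\<i> * velocity i s)) =
    region_towards n \<Gamma> (\<gamma> i t) (of_real c * (\<i> * velocity i t))"
proof (rule connected_local_const[of "{a<..<b}"])
  show "\<forall>s\<in>{a<..<b}. \<forall>\<^sub>F t in at s within {a<..<b}.
      region_towards n \<Gamma> (\<gamma> i s) (of_real c * (\<i> * velocity i s)) =
      region_towards n \<Gamma> (\<gamma> i t) (of_real c * (\<i> * velocity i t))"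
    using side_region_locally_constant[OF i reg c] by (auto intro: filter_leD[OF at_le])
qed (use st in auto)

end

text \<open>Cramer's rule in the frame \<open>v\<close>, \<open>w\<close>.\<close>

lemma complex_frame_expansion:
  "of_real (cross v w) * d = of_real (cross d w) * v + of_real (cross v d) * w"
  by (simp add: complex_eq_iff algebra_simps)

context link_diagram
begin

section \<open>The four sectors at a crossing\<close>

lemma crossing_frame:
  assumes pq: "(i, a) \<in> passages n \<Gamma>" "other_passage n \<Gamma> (i, a) = (j, b)"
  shows "i < n" "j < n" "\<gamma> j b = \<gamma> i a" "cross (velocity i a) (velocity j b) \<noteq> 0"
    "(j, b) \<in> passages n \<Gamma>" "other_passage n \<Gamma> (j, b) = (i, a)"
proof -
  show qP: "(j, b) \<in> passages n \<Gamma>" "other_passage n \<Gamma> (j, b) = (i, a)"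
    using other_passage(1,2)[OF pq(1)] pq(2) by simp_all
  show "i < n" "j < n" using passages_param[OF pq(1)] passages_param[OF qP(1)] by auto
  have tr: "cross (tangent \<Gamma> (fst c)) (tangent \<Gamma> (snd c)) \<noteq> 0" if "c \<in> crossings n \<Gamma>" for c
    using regular that unfolding regular_projection_def by (auto simp del: complex_cnj_mult)
  have c: "((i, a), (j, b)) \<in> crossings n \<Gamma> \<or> ((j, b), (i, a)) \<in> crossings n \<Gamma>"
    using pq(1) by (rule passage_cases) (use pq(2) other_passage_crossing in metis)+
  then show "\<gamma> j b = \<gamma> i a"
    using crossingsD(3) plane_point_Pair by metis
  show "cross (velocity i a) (velocity j b) \<noteq> 0"
    using c tr[of "((i, a), (j, b))"] tr[of "((j, b), (i, a))"] cross_eq_0_swap[of "velocity i a" "velocity j b"]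
    unfolding fst_conv snd_conv tangent_Pair by blast
qed

text \<open>
  The two strands through a crossing are the images of the axes under \<open>(x, y) \<mapsto> \<gamma> i (a + x) + \<gamma> j (b + y) - \<gamma> i a\<close>,
  so a sector between two half strands contains the image of a small open quadrant.
\<close>

lemma quadrant_image:
  assumes pq: "(i, a) \<in> passages n \<Gamma>" "other_passage n \<Gamma> (i, a) = (j, b)"
    and \<alpha>: "\<alpha> \<noteq> 0" and \<beta>: "\<beta> \<noteq> 0"
  obtains \<epsilon> R where "\<epsilon> > 0" "R \<in> regions n \<Gamma>"
    "\<And>x y. 0 < x \<Longrightarrow> x < \<epsilon> \<Longrightarrow> 0 < y \<Longrightarrow> y < \<epsilon> \<Longrightarrow> \<gamma> i (a + \<alpha> * x) + \<gamma> j (b + \<beta> * y) - \<gamma> i a \<in> R"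
proof -
  note F = crossing_frame[OF pq]
  define v w where "v = velocity i a" and "w = velocity j b"
  have vw: "cross v w \<noteq> 0" using F(4) by (simp add: v_def w_def)
  have wv: "cross w v \<noteq> 0" using vw cross_swap[of v w] by linarith
  obtain r where r: "r > 0" "\<And>w'. w' \<in> cball w r \<Longrightarrow> sgn (cross v w') = sgn (cross v w)"
    using cross_ne0_on_cball[OF vw] by blast
  obtain r' where r': "r' > 0" "\<And>v'. v' \<in> cball v r' \<Longrightarrow> sgn (cross w v') = sgn (cross w v)"
    using cross_ne0_on_cball[OF wv] by blast
  have K: "cross (velocity i a) w' \<noteq> 0" if "w' \<in> cball w r" for w'
    using r(2)[OF that] vw unfolding v_def by (metis sgn_zero_iff)
  have K': "cross (velocity j b) v' \<noteq> 0" if "v' \<in> cball v r'" for v'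
    using r'(2)[OF that] wv unfolding w_def by (metis sgn_zero_iff)
  obtain \<epsilon>1 where \<epsilon>1: "\<epsilon>1 > 0" "\<And>s s' w' e. s \<in> ball a \<epsilon>1 \<Longrightarrow> s' \<in> ball a \<epsilon>1 \<Longrightarrow> w' \<in> cball w r \<Longrightarrow> e \<noteq> 0 \<Longrightarrow>
      \<gamma> i s + of_real e * w' \<noteq> \<gamma> i s'"
    using C1_transversal[OF velocity(1,2)[OF F(1)] compact_cball K] by blast
  obtain \<epsilon>2 where \<epsilon>2: "\<epsilon>2 > 0" "\<And>s s' v' e. s \<in> ball b \<epsilon>2 \<Longrightarrow> s' \<in> ball b \<epsilon>2 \<Longrightarrow> v' \<in> cball v r' \<Longrightarrow> e \<noteq> 0 \<Longrightarrow>
      \<gamma> j s + of_real e * v' \<noteq> \<gamma> j s'"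
    using C1_transversal[OF velocity(1,2)[OF F(2)] compact_cball K'] by blast
  obtain \<epsilon>3 where \<epsilon>3: "\<epsilon>3 > 0" "\<And>s s'. s \<in> ball a \<epsilon>3 \<Longrightarrow> s' \<in> ball a \<epsilon>3 \<Longrightarrow>
      norm (\<gamma> i s' - \<gamma> i s - of_real (s' - s) * v) \<le> r' * \<bar>s' - s\<bar>"
    using C1_strict_derivative[OF velocity(1,2)[OF F(1)] r'(1)] unfolding v_def by blast
  obtain \<epsilon>4 where \<epsilon>4: "\<epsilon>4 > 0" "\<And>s s'. s \<in> ball b \<epsilon>4 \<Longrightarrow> s' \<in> ball b \<epsilon>4 \<Longrightarrow>
      norm (\<gamma> j s' - \<gamma> j s - of_real (s' - s) * w) \<le> r * \<bar>s' - s\<bar>"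
    using C1_strict_derivative[OF velocity(1,2)[OF F(2)] r(1)] unfolding w_def by blast
  define m where "m = min (min \<epsilon>1 \<epsilon>2) (min \<epsilon>3 \<epsilon>4)"
  have m: "m > 0" "m \<le> \<epsilon>1" "m \<le> \<epsilon>2" "m \<le> \<epsilon>3" "m \<le> \<epsilon>4"
    using \<epsilon>1(1) \<epsilon>2(1) \<epsilon>3(1) \<epsilon>4(1) by (auto simp: m_def)
  obtain \<rho> where \<rho>: "\<rho> > 0" "\<And>u. u \<in> diagram_set n \<Gamma> \<Longrightarrow> dist (\<gamma> i a) u < \<rho> \<Longrightarrow> u \<in> \<gamma> i ` ball a m \<union> \<gamma> j ` ball b m"
    using near_crossing_point[OF pq m(1)] by blast
  have "isCont (\<gamma> i) a" "isCont (\<gamma> j) b"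
    using continuous_curve[OF F(1), of UNIV] continuous_curve[OF F(2), of UNIV] by (simp_all add: continuous_on_eq_continuous_at)
  note cont = this[unfolded continuous_at_eps_delta]
  have "\<rho> / 2 > 0" using \<rho>(1) by simp
  obtain \<epsilon>5 where \<epsilon>5: "\<epsilon>5 > 0" "\<And>s. dist s a < \<epsilon>5 \<Longrightarrow> dist (\<gamma> i s) (\<gamma> i a) < \<rho> / 2"
    using cont(1) \<open>\<rho> / 2 > 0\<close> by blast
  obtain \<epsilon>6 where \<epsilon>6: "\<epsilon>6 > 0" "\<And>s. dist s b < \<epsilon>6 \<Longrightarrow> dist (\<gamma> j s) (\<gamma> j b) < \<rho> / 2"
    using cont(2) \<open>\<rho> / 2 > 0\<close> by blast
  define M where "M = min m (min \<epsilon>5 \<epsilon>6)"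
  have M: "M > 0" "M \<le> m" "M \<le> \<epsilon>5" "M \<le> \<epsilon>6" using m(1) \<epsilon>5(1) \<epsilon>6(1) by (auto simp: M_def)
  define \<epsilon> where "\<epsilon> = M / (\<bar>\<alpha>\<bar> + \<bar>\<beta>\<bar>)"
  have ab0: "\<bar>\<alpha>\<bar> + \<bar>\<beta>\<bar> > 0" using \<alpha> by simp
  have \<epsilon>: "\<epsilon> > 0" using M(1) ab0 by (simp add: \<epsilon>_def)
  have small: "\<bar>\<alpha> * x\<bar> < M" "\<bar>\<beta> * x\<bar> < M" if "0 < x" "x < \<epsilon>" for x
  proof -
    have "(\<bar>\<alpha>\<bar> + \<bar>\<beta>\<bar>) * x < M" using that ab0 by (simp add: \<epsilon>_def field_simps)
    moreover have "(\<bar>\<alpha>\<bar> + \<bar>\<beta>\<bar>) * x = \<bar>\<alpha> * x\<bar> + \<bar>\<beta> * x\<bar>"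
      using that(1) by (simp add: abs_mult distrib_right)
    ultimately show "\<bar>\<alpha> * x\<bar> < M" "\<bar>\<beta> * x\<bar> < M" by linarith+
  qed
  define \<Phi> where "\<Phi> x y = \<gamma> i (a + \<alpha> * x) + \<gamma> j (b + \<beta> * y) - \<gamma> i a" for x y
  define S where "S = (\<lambda>x. \<Phi> (fst x) (snd x)) ` ({0<..<\<epsilon>} \<times> {0<..<\<epsilon>})"
  have "continuous_on ({0<..<\<epsilon>} \<times> {0<..<\<epsilon>}) (\<lambda>x. \<Phi> (fst x) (snd x))"
    unfolding \<Phi>_def
    by (intro continuous_intros continuous_on_compose2[OF continuous_link[OF F(1), of UNIV]]
        continuous_on_compose2[OF continuous_link[OF F(2), of UNIV]]) auto
  then have "connected S"
    unfolding S_def by (rule connected_continuous_image) (simp add: connected_Times convex_connected)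
  moreover have "S \<noteq> {}" using \<epsilon> by (auto simp: S_def)
  moreover have "S \<inter> diagram_set n \<Gamma> = {}"
  proof (rule ccontr)
    assume "S \<inter> diagram_set n \<Gamma> \<noteq> {}"
    then obtain x y where x: "0 < x" "x < \<epsilon>" and y: "0 < y" "y < \<epsilon>" and D: "\<Phi> x y \<in> diagram_set n \<Gamma>"
      by (auto simp: S_def)
    define X Y where "X = \<alpha> * x" and "Y = \<beta> * y"
    have XY: "\<bar>X\<bar> < M" "\<bar>Y\<bar> < M" "X \<noteq> 0" "Y \<noteq> 0"
      using small(1)[OF x] small(2)[OF y] x y \<alpha> \<beta> by (auto simp: X_def Y_def)
    \<comment> \<open>Two readings of one point: displaced from the strand \<open>i\<close> by a
      chord of the strand \<open>j\<close>, and the other way round. The first one excludes a hit on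
      \<open>i\<close>, the second one a hit on \<open>j\<close>.\<close>
    have \<Phi>: "\<Phi> x y = \<gamma> i (a + X) + (\<gamma> j (b + Y) - \<gamma> j b)" "\<Phi> x y = \<gamma> j (b + Y) + (\<gamma> i (a + X) - \<gamma> i a)"
      by (simp_all add: \<Phi>_def X_def Y_def F(3))
    have "norm (\<gamma> i (a + X) - \<gamma> i a) < \<rho> / 2" "norm (\<gamma> j (b + Y) - \<gamma> j b) < \<rho> / 2"
      using \<epsilon>5(2)[of "a + X"] \<epsilon>6(2)[of "b + Y"] XY M by (simp_all add: dist_norm)
    moreover have "norm (\<Phi> x y - \<gamma> i a) \<le> norm (\<gamma> i (a + X) - \<gamma> i a) + norm (\<gamma> j (b + Y) - \<gamma> j b)"
      using norm_triangle_ineq[of "\<gamma> i (a + X) - \<gamma> i a" "\<gamma> j (b + Y) - \<gamma> j b"] by (simp add: \<Phi>(1) algebra_simps)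
    ultimately have "dist (\<gamma> i a) (\<Phi> x y) < \<rho>" by (simp add: dist_norm norm_minus_commute)
    then consider s where "s \<in> ball a m" "\<Phi> x y = \<gamma> i s" | s where "s \<in> ball b m" "\<Phi> x y = \<gamma> j s"
      using \<rho>(2)[OF D] by blast
    then show False
    proof cases
      case 1
      \<comment> \<open>The slope of the chord is close to \<open>w\<close>, hence transversal to
        the strand \<open>i\<close>.\<close>
      define w' where "w' = (\<gamma> j (b + Y) - \<gamma> j b) / of_real Y"
      have "norm (\<gamma> j (b + Y) - \<gamma> j b - of_real Y * w) \<le> r * \<bar>Y\<bar>"
        using \<epsilon>4(2)[of b "b + Y"] \<epsilon>4(1) XY M m by (simp add: dist_real_def)
      moreover have "\<gamma> j (b + Y) - \<gamma> j b - of_real Y * w = of_real Y * (w' - w)"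
        using XY(4) by (simp add: w'_def field_simps)
      ultimately have "norm (w' - w) \<le> r" using XY(4) by (simp add: norm_mult mult.commute)
      then have "w' \<in> cball w r" by (simp add: dist_norm norm_minus_commute)
      moreover have "\<gamma> i (a + X) + of_real Y * w' = \<gamma> i s" using 1(2) XY(4) by (simp add: \<Phi>(1) w'_def)
      ultimately show False
        using \<epsilon>1(2)[of "a + X" s w' Y] 1(1) XY M m by (simp add: dist_real_def)
    next
      case 2
      define v' where "v' = (\<gamma> i (a + X) - \<gamma> i a) / of_real X"
      have "norm (\<gamma> i (a + X) - \<gamma> i a - of_real X * v) \<le> r' * \<bar>X\<bar>"
        using \<epsilon>3(2)[of a "a + X"] \<epsilon>3(1) XY M m by (simp add: dist_real_def)
      moreover have "\<gamma> i (a + X) - \<gamma> i a - of_real X * v = of_real X * (v' - v)"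
        using XY(3) by (simp add: v'_def field_simps)
      ultimately have "norm (v' - v) \<le> r'" using XY(3) by (simp add: norm_mult mult.commute)
      then have "v' \<in> cball v r'" by (simp add: dist_norm norm_minus_commute)
      moreover have "\<gamma> j (b + Y) + of_real X * v' = \<gamma> j s" using 2(2) XY(3) by (simp add: \<Phi>(2) v'_def)
      ultimately show False
        using \<epsilon>2(2)[of "b + Y" s v' X] 2(1) XY M m by (simp add: dist_real_def)
    qed
  qed
  ultimately obtain R where R: "R \<in> regions n \<Gamma>" "S \<subseteq> R" by (rule connected_in_region)
  show thesis
  proof (rule that[OF \<epsilon> R(1)])
    fix x y assume "0 < x" "x < \<epsilon>" "0 < y" "y < \<epsilon>"
    then have "\<Phi> x y \<in> S" unfolding S_def by (intro image_eqI[of _ _ "(x, y)"]) auto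
    then show "\<gamma> i (a + \<alpha> * x) + \<gamma> j (b + \<beta> * y) - \<gamma> i a \<in> R" using R(2) by (auto simp: \<Phi>_def)
  qed
qed

text \<open>A straight ray between the two half strands has to enter the same region as the curved
  quadrant. A thin cone around the ray misses the diagram, and it contains a point of the quadrant
  whose parameters are small and proportional to \<open>x\<close> and \<open>y\<close>.\<close>

lemma sector_direction_region:
  assumes pq: "(i, a) \<in> passages n \<Gamma>" "other_passage n \<Gamma> (i, a) = (j, b)"
    and \<alpha>: "\<alpha> \<noteq> 0" and \<beta>: "\<beta> \<noteq> 0" and R: "R \<in> regions n \<Gamma>" and \<epsilon>: "\<epsilon> > 0"
    and quad: "\<And>x y. 0 < x \<Longrightarrow> x < \<epsilon> \<Longrightarrow> 0 < y \<Longrightarrow> y < \<epsilon> \<Longrightarrow> \<gamma> i (a + \<alpha> * x) + \<gamma> j (b + \<beta> * y) - \<gamma> i a \<in> R"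
    and xy: "x > 0" "y > 0"
  shows "region_towards n \<Gamma> (\<gamma> i a) (of_real (\<alpha> * x) * velocity i a + of_real (\<beta> * y) * velocity j b) = R"
proof -
  note F = crossing_frame[OF pq]
  define v w where "v = velocity i a" and "w = velocity j b"
  define X Y where "X = \<alpha> * x" and "Y = \<beta> * y"
  have XY: "X \<noteq> 0" "Y \<noteq> 0" using \<alpha> \<beta> xy by (auto simp: X_def Y_def)
  define d where "d = of_real X * v + of_real Y * w"
  have vw: "cross v w \<noteq> 0" using F(4) by (simp add: v_def w_def)
  have "cross v d = Y * cross v w" by (simp add: d_def algebra_simps)
  then have vd: "cross v d \<noteq> 0" using vw XY by simp
  have "cross w d = X * cross w v" by (simp add: d_def algebra_simps)
  then have wd: "cross w d \<noteq> 0" using vw cross_eq_0_swap[of v w] XY(1) by (metis mult_eq_0_iff)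
  obtain r1 where r1: "r1 > 0" "\<And>k. k \<in> cball d r1 \<Longrightarrow> sgn (cross v k) = sgn (cross v d)"
    using cross_ne0_on_cball[OF vd] by blast
  obtain r2 where r2: "r2 > 0" "\<And>k. k \<in> cball d r2 \<Longrightarrow> sgn (cross w k) = sgn (cross w d)"
    using cross_ne0_on_cball[OF wd] by blast
  define r where "r = min r1 r2"
  have r: "r > 0" using r1(1) r2(1) by (simp add: r_def)
  have K: "cross (velocity i a) k \<noteq> 0" if "k \<in> cball d r" for k
    using r1(2)[of k] vd that unfolding v_def r_def by (metis (no_types, lifting) mem_cball min.bounded_iff sgn_zero_iff)
  have K': "cross (velocity j b) k \<noteq> 0" if "k \<in> cball d r" for k
    using r2(2)[of k] wd that unfolding w_def r_def by (metis (no_types, lifting) mem_cball min.bounded_iff sgn_zero_iff)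
  obtain \<epsilon>1 where \<epsilon>1: "\<epsilon>1 > 0" "\<And>s s' k e. s \<in> ball a \<epsilon>1 \<Longrightarrow> s' \<in> ball a \<epsilon>1 \<Longrightarrow> k \<in> cball d r \<Longrightarrow> e \<noteq> 0 \<Longrightarrow>
      \<gamma> i s + of_real e * k \<noteq> \<gamma> i s'"
    using C1_transversal[OF velocity(1,2)[OF F(1)] compact_cball K] by blast
  obtain \<epsilon>2 where \<epsilon>2: "\<epsilon>2 > 0" "\<And>s s' k e. s \<in> ball b \<epsilon>2 \<Longrightarrow> s' \<in> ball b \<epsilon>2 \<Longrightarrow> k \<in> cball d r \<Longrightarrow> e \<noteq> 0 \<Longrightarrow>
      \<gamma> j s + of_real e * k \<noteq> \<gamma> j s'"
    using C1_transversal[OF velocity(1,2)[OF F(2)] compact_cball K'] by blast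
  obtain \<rho> where \<rho>: "\<rho> > 0" "\<And>u. u \<in> diagram_set n \<Gamma> \<Longrightarrow> dist (\<gamma> i a) u < \<rho> \<Longrightarrow>
      u \<in> \<gamma> i ` ball a (min \<epsilon>1 \<epsilon>2) \<union> \<gamma> j ` ball b (min \<epsilon>1 \<epsilon>2)"
    using near_crossing_point[OF pq, of "min \<epsilon>1 \<epsilon>2"] \<epsilon>1(1) \<epsilon>2(1) by (metis min_less_iff_conj)
  define M where "M = norm d + r"
  have M: "M > 0" "\<And>k. k \<in> cball d r \<Longrightarrow> norm k \<le> M"
  proof -
    show "M > 0" using r by (simp add: M_def add_nonneg_pos)
    fix k assume "k \<in> cball d r"
    then show "norm k \<le> M" using norm_triangle_ineq[of d "k - d"] by (simp add: M_def dist_norm norm_minus_commute)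
  qed
  define \<epsilon>' where "\<epsilon>' = \<rho> / M"
  have \<epsilon>': "\<epsilon>' > 0" using \<rho>(1) M(1) by (simp add: \<epsilon>'_def)
  define S where "S = (\<lambda>u. \<gamma> i a + of_real (fst u) * snd u) ` ({0<..<\<epsilon>'} \<times> cball d r)"
  have "connected S"
    unfolding S_def
    by (intro connected_continuous_image continuous_intros connected_Times) (auto simp: convex_connected)
  moreover have "S \<noteq> {}" using \<epsilon>' r by (auto simp: S_def)
  moreover have "S \<inter> diagram_set n \<Gamma> = {}"
  proof (rule ccontr)
    assume "S \<inter> diagram_set n \<Gamma> \<noteq> {}"
    then obtain e k where e: "0 < e" "e < \<epsilon>'" "k \<in> cball d r" and D: "\<gamma> i a + of_real e * k \<in> diagram_set n \<Gamma>"
      by (auto simp: S_def)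
    have "e * norm k \<le> e * M" using e M by (intro mult_left_mono) auto
    also have "\<dots> < \<rho>" using e M(1) by (simp add: \<epsilon>'_def field_simps)
    finally have "dist (\<gamma> i a) (\<gamma> i a + of_real e * k) < \<rho>" using e(1) by (simp add: dist_norm norm_mult)
    from \<rho>(2)[OF D this] show False
    proof
      assume "\<gamma> i a + of_real e * k \<in> \<gamma> i ` ball a (min \<epsilon>1 \<epsilon>2)"
      then obtain s where "s \<in> ball a (min \<epsilon>1 \<epsilon>2)" "\<gamma> i a + of_real e * k = \<gamma> i s" by blast
      then show False using \<epsilon>1(2)[of a s k e] \<epsilon>1(1) e by simp
    next
      assume "\<gamma> i a + of_real e * k \<in> \<gamma> j ` ball b (min \<epsilon>1 \<epsilon>2)"
      then obtain s where "s \<in> ball b (min \<epsilon>1 \<epsilon>2)" "\<gamma> i a + of_real e * k = \<gamma> j s" by blast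
      then show False using \<epsilon>2(2)[of b s k e] \<epsilon>2(1) e F(3) by simp
    qed
  qed
  ultimately obtain R2 where R2: "R2 \<in> regions n \<Gamma>" "S \<subseteq> R2" by (rule connected_in_region)
  have inS: "\<gamma> i a + of_real e * k \<in> R2" if "0 < e" "e < \<epsilon>'" "k \<in> cball d r" for e k
    using that R2(2) by (force simp: S_def)
  \<comment> \<open>At scale \<open>e\<close> the errors of the two chords add up to at most
    \<open>e * \<kappa> * (\<bar>X\<bar> + \<bar>Y\<bar>)\<close>, which is the radius
    \<open>e * r\<close> of the cone there.\<close>
  define \<kappa> where "\<kappa> = r / (\<bar>X\<bar> + \<bar>Y\<bar>)"
  have "\<bar>X\<bar> + \<bar>Y\<bar> > 0" using XY by simp
  then have \<kappa>: "\<kappa> > 0" "\<kappa> * (\<bar>X\<bar> + \<bar>Y\<bar>) = r" using r by (simp_all add: \<kappa>_def)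
  obtain \<epsilon>3 where \<epsilon>3: "\<epsilon>3 > 0" "\<And>s s'. s \<in> ball a \<epsilon>3 \<Longrightarrow> s' \<in> ball a \<epsilon>3 \<Longrightarrow>
      norm (\<gamma> i s' - \<gamma> i s - of_real (s' - s) * v) \<le> \<kappa> * \<bar>s' - s\<bar>"
    using C1_strict_derivative[OF velocity(1,2)[OF F(1)] \<kappa>(1)] unfolding v_def by blast
  obtain \<epsilon>4 where \<epsilon>4: "\<epsilon>4 > 0" "\<And>s s'. s \<in> ball b \<epsilon>4 \<Longrightarrow> s' \<in> ball b \<epsilon>4 \<Longrightarrow>
      norm (\<gamma> j s' - \<gamma> j s - of_real (s' - s) * w) \<le> \<kappa> * \<bar>s' - s\<bar>"
    using C1_strict_derivative[OF velocity(1,2)[OF F(2)] \<kappa>(1)] unfolding w_def by blast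
  define m where "m = min (min \<epsilon>' (min (\<epsilon> / x) (\<epsilon> / y))) (min (\<epsilon>3 / \<bar>X\<bar>) (\<epsilon>4 / \<bar>Y\<bar>))"
  define e where "e = m / 2"
  have m: "m > 0" using \<epsilon>' \<epsilon> xy \<epsilon>3(1) \<epsilon>4(1) XY by (simp add: m_def)
  then have e0: "e > 0" "e < m" by (simp_all add: e_def)
  have "m \<le> \<epsilon>'" "m \<le> \<epsilon> / x" "m \<le> \<epsilon> / y" "m \<le> \<epsilon>3 / \<bar>X\<bar>" "m \<le> \<epsilon>4 / \<bar>Y\<bar>"
    by (auto simp: m_def)
  then have "e < \<epsilon>'" "e < \<epsilon> / x" "e < \<epsilon> / y" "e < \<epsilon>3 / \<bar>X\<bar>" "e < \<epsilon>4 / \<bar>Y\<bar>"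
    using e0(2) by linarith+
  then have e: "e < \<epsilon>'" "e * x < \<epsilon>" "e * y < \<epsilon>" "\<bar>e * X\<bar> < \<epsilon>3" "\<bar>e * Y\<bar> < \<epsilon>4"
    using xy XY e0 by (simp_all add: field_simps abs_mult)
  define P where "P = \<gamma> i (a + \<alpha> * (e * x)) + \<gamma> j (b + \<beta> * (e * y)) - \<gamma> i a"
  have PR: "P \<in> R" unfolding P_def using e e0 xy by (intro quad) auto
  have P: "P = \<gamma> i (a + e * X) + \<gamma> j (b + e * Y) - \<gamma> i a" by (simp add: P_def X_def Y_def mult.left_commute)
  have "norm (\<gamma> i (a + e * X) - \<gamma> i a - of_real (e * X) * v) \<le> \<kappa> * \<bar>e * X\<bar>"
    using \<epsilon>3(2)[of a "a + e * X"] \<epsilon>3(1) e(4) by (simp add: dist_real_def)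
  moreover have "norm (\<gamma> j (b + e * Y) - \<gamma> j b - of_real (e * Y) * w) \<le> \<kappa> * \<bar>e * Y\<bar>"
    using \<epsilon>4(2)[of b "b + e * Y"] \<epsilon>4(1) e(5) by (simp add: dist_real_def)
  moreover have "norm (P - \<gamma> i a - of_real e * d) \<le> norm (\<gamma> i (a + e * X) - \<gamma> i a - of_real (e * X) * v) +
      norm (\<gamma> j (b + e * Y) - \<gamma> j b - of_real (e * Y) * w)"
    by (rule order_trans[OF _ norm_triangle_ineq]) (simp add: P d_def F(3) algebra_simps)
  ultimately have "norm (P - \<gamma> i a - of_real e * d) \<le> \<kappa> * \<bar>e * X\<bar> + \<kappa> * \<bar>e * Y\<bar>" by linarith
  also have "\<dots> = e * r" using e0 by (simp add: \<kappa>(2)[symmetric] abs_mult algebra_simps)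
  finally have "norm (P - \<gamma> i a - of_real e * d) \<le> e * r" .
  moreover have "P - \<gamma> i a - of_real e * d = of_real e * ((P - \<gamma> i a) / of_real e - d)"
    using e0 by (simp add: field_simps)
  ultimately have "norm ((P - \<gamma> i a) / of_real e - d) \<le> r" using e0 by (simp add: norm_mult)
  then have "(P - \<gamma> i a) / of_real e \<in> cball d r" by (simp add: dist_norm norm_minus_commute)
  from inS[OF e0(1) e(1) this] have "P \<in> R2" using e0 by simp
  then have "R2 = R" using regions_unique[OF R2(1) R] PR by blast
  moreover have "region_towards n \<Gamma> (\<gamma> i a) d = R2"
    by (rule region_towards_eqI[OF R2(1) \<epsilon>']) (use inS r in auto)
  ultimately show ?thesis by (simp add: d_def X_def Y_def v_def w_def)
qed

text \<open>The sector also has to be recognized from the strand \<open>i\<close>, through its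
  normal. The normal with sign and the chords of the half strand of \<open>j\<close> point to the
  same side of the strand \<open>i\<close>, so one connected set of transversal directions contains
  both, and \<open>side_region\<close> applies to it.\<close>

lemma strand_region:
  assumes pq: "(i, a) \<in> passages n \<Gamma>" "other_passage n \<Gamma> (i, a) = (j, b)"
    and \<alpha>: "\<alpha> \<noteq> 0" and \<beta>: "\<beta> \<noteq> 0" and R: "R \<in> regions n \<Gamma>" and \<epsilon>: "\<epsilon> > 0"
    and quad: "\<And>x y. 0 < x \<Longrightarrow> x < \<epsilon> \<Longrightarrow> 0 < y \<Longrightarrow> y < \<epsilon> \<Longrightarrow> \<gamma> i (a + \<alpha> * x) + \<gamma> j (b + \<beta> * y) - \<gamma> i a \<in> R"
    and x: "0 < x" "x < \<epsilon>" and reg: "(i, frac (a + \<alpha> * x)) \<notin> passages n \<Gamma>"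
    and side: "sgn (cross (velocity i (a + \<alpha> * x)) (velocity j b)) = sgn (cross (velocity i a) (velocity j b))"
  shows "region_towards n \<Gamma> (\<gamma> i (a + \<alpha> * x))
     (of_real (sgn (\<beta> * cross (velocity i a) (velocity j b))) * (\<i> * velocity i (a + \<alpha> * x))) = R"
proof -
  note F = crossing_frame[OF pq]
  define t v w \<sigma> where "t = a + \<alpha> * x" and "v = velocity i t" and "w = of_real \<beta> * velocity j b"
    and "\<sigma> = sgn (\<beta> * cross (velocity i a) (velocity j b))"
  have "\<beta> * cross (velocity i a) (velocity j b) \<noteq> 0" using \<beta> F(4) by (metis mult_eq_0_iff)
  then have \<sigma>: "\<sigma> = 1 \<or> \<sigma> = -1" unfolding \<sigma>_def by (metis sgn_real_def)
  have cvw: "cross v w = \<beta> * cross v (velocity j b)"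
    unfolding w_def by (rule cross_scale_right)
  have sw: "sgn (cross v w) = \<sigma>"
    unfolding cvw \<sigma>_def sgn_mult using side by (simp only: v_def t_def)
  then have vw: "cross v w \<noteq> 0" using \<sigma> by (metis sgn_zero zero_neq_one zero_neq_neg_one)
  obtain r where r: "r > 0" "\<And>k. k \<in> cball w r \<Longrightarrow> sgn (cross v k) = sgn (cross v w)"
    using cross_ne0_on_cball[OF vw] by blast
  define d where "d = of_real \<sigma> * (\<i> * v)"
  have v0: "norm v > 0" using velocity(3)[OF F(1)] by (simp add: v_def)
  have "cross v d = \<sigma> * (norm v)\<^sup>2" unfolding d_def by (simp only: cross_scale_right cross_i_times)
  then have sd: "\<sigma> * cross v d > 0" using \<sigma> v0 by (auto simp del: complex_cnj_mult)
  have sw': "\<sigma> * cross v k > 0" if "k \<in> cball w r" for k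
  proof -
    have "sgn (cross v k) = \<sigma>" using r(2)[OF that] sw by simp
    then show ?thesis using \<sigma> by (metis mult_sgn_abs abs_sgn mult.commute zero_less_abs_iff sgn_zero zero_neq_one zero_neq_neg_one)
  qed
  \<comment> \<open>The segment joins the signed normal to the direction of the other half strand,
    and by convexity determinants with \<open>v\<close> keep their sign along it. The ball leaves
    room for chords.\<close>
  define K where "K = closed_segment d w \<union> cball w r"
  have "compact K" by (simp add: K_def compact_Un)
  moreover have "connected K"
    unfolding K_def using r(1) by (intro connected_Un) (auto simp: convex_connected)
  moreover have "K \<noteq> {}" by (auto simp: K_def)
  moreover have "cross (velocity i t) k \<noteq> 0" if "k \<in> K" for k
  proof -
    have "\<sigma> * cross v k > 0"
    proof (cases "k \<in> cball w r")
      case False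
      then have "k \<in> closed_segment d w" using that unfolding K_def by blast
      then obtain u where u: "0 \<le> u" "u \<le> 1" "k = (1 - u) *\<^sub>R d + u *\<^sub>R w"
        by (auto simp: in_segment)
      have "\<sigma> * cross v k = (1 - u) * (\<sigma> * cross v d) + u * (\<sigma> * cross v w)"
        unfolding u(3) by (simp add: algebra_simps)
      moreover have "w \<in> cball w r" using r(1) by simp
      then have "\<sigma> * cross v w > 0" by (rule sw')
      ultimately show ?thesis
        using u sd by (cases "u = 0") (auto intro!: add_nonneg_pos simp del: complex_cnj_mult)
    qed (rule sw')
    then show ?thesis by (auto simp: v_def simp del: complex_cnj_mult)
  qed
  ultimately obtain \<epsilon>1 R1 where \<epsilon>1: "\<epsilon>1 > 0" "R1 \<in> regions n \<Gamma>"
    "\<And>s e k. s \<in> ball t \<epsilon>1 \<Longrightarrow> 0 < e \<Longrightarrow> e < \<epsilon>1 \<Longrightarrow> k \<in> K \<Longrightarrow> \<gamma> i s + of_real e * k \<in> R1"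
    using side_region[OF F(1), of t K] reg unfolding t_def by blast
  have R1: "region_towards n \<Gamma> (\<gamma> i t) d = R1"
    by (rule region_towards_eqI[OF \<epsilon>1(2,1)]) (use \<epsilon>1 in \<open>auto simp: K_def\<close>)
  have \<kappa>: "r / \<bar>\<beta>\<bar> > 0" using r(1) \<beta> by simp
  obtain \<epsilon>2 where \<epsilon>2: "\<epsilon>2 > 0" "\<And>s s'. s \<in> ball b \<epsilon>2 \<Longrightarrow> s' \<in> ball b \<epsilon>2 \<Longrightarrow>
      norm (\<gamma> j s' - \<gamma> j s - of_real (s' - s) * velocity j b) \<le> r / \<bar>\<beta>\<bar> * \<bar>s' - s\<bar>"
    using C1_strict_derivative[OF velocity(1,2)[OF F(2)] \<kappa>] by blast
  define m where "m = min (min \<epsilon> \<epsilon>1) (\<epsilon>2 / \<bar>\<beta>\<bar>)"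
  define y where "y = m / 2"
  have "m > 0" using \<epsilon> \<epsilon>1(1) \<epsilon>2(1) \<beta> by (simp add: m_def)
  then have y0: "y > 0" and "y < m" by (simp_all add: y_def)
  moreover have "m \<le> \<epsilon>" "m \<le> \<epsilon>1" "m \<le> \<epsilon>2 / \<bar>\<beta>\<bar>" by (auto simp: m_def)
  ultimately have "y < \<epsilon>" "y < \<epsilon>1" "y < \<epsilon>2 / \<bar>\<beta>\<bar>" by linarith+
  then have y: "y < \<epsilon>" "y < \<epsilon>1" "\<bar>\<beta> * y\<bar> < \<epsilon>2" using y0 \<beta> by (simp_all add: field_simps abs_mult)
  \<comment> \<open>A displacement from the strand \<open>i\<close> by \<open>y * k\<close> is
    exactly a point of the quadrant.\<close>
  define k where "k = (\<gamma> j (b + \<beta> * y) - \<gamma> j b) / of_real y"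
  have "norm (\<gamma> j (b + \<beta> * y) - \<gamma> j b - of_real (\<beta> * y) * velocity j b) \<le> r / \<bar>\<beta>\<bar> * \<bar>\<beta> * y\<bar>"
    using \<epsilon>2(2)[of b "b + \<beta> * y"] \<epsilon>2(1) y(3) by (simp add: dist_real_def)
  also have "\<dots> = y * r" using \<beta> y0 by (simp add: abs_mult)
  finally have "norm (\<gamma> j (b + \<beta> * y) - \<gamma> j b - of_real (\<beta> * y) * velocity j b) \<le> y * r" .
  moreover have "\<gamma> j (b + \<beta> * y) - \<gamma> j b - of_real (\<beta> * y) * velocity j b = of_real y * (k - w)"
    using y0 by (simp add: k_def w_def field_simps)
  ultimately have "norm (k - w) \<le> r" using y0 by (simp add: norm_mult)
  then have "k \<in> K" by (simp add: K_def dist_norm norm_minus_commute)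
  then have "\<gamma> i t + of_real y * k \<in> R1" using \<epsilon>1 y0 y by simp
  moreover have "\<gamma> i t + of_real y * k = \<gamma> i (a + \<alpha> * x) + \<gamma> j (b + \<beta> * y) - \<gamma> i a"
    using y0 by (simp add: k_def t_def F(3))
  ultimately have "R1 = R" using quad[OF x y0 y(1)] regions_unique[OF \<epsilon>1(2) R] by simp
  then show ?thesis using R1 by (simp add: d_def t_def v_def \<sigma>_def)
qed

lemma eventually_regular:
  assumes "(i, a) \<in> passages n \<Gamma>" "\<alpha> \<noteq> 0"
  shows "\<forall>\<^sub>F x in at_right 0. (i, frac (a + \<alpha> * x)) \<notin> passages n \<Gamma>"
proof -
  \<comment> \<open>Parameters at distance less than 1 from \<open>a\<close> have their floor in
    this range, so finitely many lifts of passages suffice.\<close>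
  have F: "finite ((\<lambda>(q, k). (snd q + real_of_int k)) ` (passages n \<Gamma> \<times> {\<lfloor>a\<rfloor> - 1..\<lfloor>a\<rfloor> + 2}))" (is "finite ?F")
    by (intro finite_imageI finite_cartesian_product finite_passages) simp
  then have "\<forall>\<^sub>F s in at a. s \<notin> ?F"
    using finite_imp_closed[OF F] islimpt_finite[OF F, of a] by (simp add: islimpt_iff_eventually)
  moreover have "filterlim (\<lambda>x. a + \<alpha> * x) (at a) (at_right 0)"
    unfolding filterlim_at
  proof
    show "\<forall>\<^sub>F x in at_right 0. a + \<alpha> * x \<in> UNIV \<and> a + \<alpha> * x \<noteq> a"
      using assms(2) by (simp add: eventually_at_filter)
    have "((\<lambda>x. a + \<alpha> * x) \<longlongrightarrow> a + \<alpha> * 0) (at_right 0)" by (intro tendsto_add tendsto_mult tendsto_const tendsto_ident_at)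
    then show "((\<lambda>x. a + \<alpha> * x) \<longlongrightarrow> a) (at_right 0)" by simp
  qed
  ultimately have 1: "\<forall>\<^sub>F x in at_right 0. a + \<alpha> * x \<notin> ?F" by (rule eventually_compose_filterlim)
  have "((\<lambda>x. a + \<alpha> * x) \<longlongrightarrow> a + \<alpha> * 0) (at_right 0)" by (intro tendsto_add tendsto_mult tendsto_const tendsto_ident_at)
  then have 2: "\<forall>\<^sub>F x in at_right 0. dist (a + \<alpha> * x) a < 1" by (auto simp: tendsto_iff)
  show ?thesis
    using 1 2
  proof eventually_elim
    case (elim x)
    show ?case
    proof
      assume P: "(i, frac (a + \<alpha> * x)) \<in> passages n \<Gamma>"
      have "\<lfloor>a + \<alpha> * x\<rfloor> \<in> {\<lfloor>a\<rfloor> - 1..\<lfloor>a\<rfloor> + 2}"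
        using elim(2) by (simp add: dist_real_def) linarith
      then have "a + \<alpha> * x \<in> ?F"
        using P by (intro image_eqI[of _ _ "((i, frac (a + \<alpha> * x)), \<lfloor>a + \<alpha> * x\<rfloor>)"]) (simp_all add: frac_def)
      then show False using elim(1) by blast
    qed
  qed
qed

text \<open>The signs of \<open>\<alpha>\<close> and \<open>\<beta>\<close> select one of the four
  sectors. Its region is seen beside the strand \<open>i\<close>, beside the strand \<open>j\<close>
  and from the crossing point; the factors \<open>sgn\<close> tell on which side of a strand the
  sector lies.\<close>

lemma crossing_sector:
  assumes pq: "(i, a) \<in> passages n \<Gamma>" "other_passage n \<Gamma> (i, a) = (j, b)"
    and \<alpha>: "\<alpha> \<noteq> 0" and \<beta>: "\<beta> \<noteq> 0"
  shows "\<exists>R.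
    (\<forall>\<^sub>F x in at_right 0. (i, frac (a + \<alpha> * x)) \<notin> passages n \<Gamma> \<and> region_towards n \<Gamma> (\<gamma> i (a + \<alpha> * x))
       (of_real (sgn (\<beta> * cross (velocity i a) (velocity j b))) * (\<i> * velocity i (a + \<alpha> * x))) = R) \<and>
    (\<forall>\<^sub>F y in at_right 0. (j, frac (b + \<beta> * y)) \<notin> passages n \<Gamma> \<and> region_towards n \<Gamma> (\<gamma> j (b + \<beta> * y))
       (of_real (sgn (\<alpha> * cross (velocity j b) (velocity i a))) * (\<i> * velocity j (b + \<beta> * y))) = R) \<and>
    (\<forall>x>0. \<forall>y>0.
       region_towards n \<Gamma> (\<gamma> i a) (of_real (\<alpha> * x) * velocity i a + of_real (\<beta> * y) * velocity j b) = R)"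
proof -
  note F = crossing_frame[OF pq]
  obtain \<epsilon> R where R: "\<epsilon> > 0" "R \<in> regions n \<Gamma>"
    "\<And>x y. 0 < x \<Longrightarrow> x < \<epsilon> \<Longrightarrow> 0 < y \<Longrightarrow> y < \<epsilon> \<Longrightarrow> \<gamma> i (a + \<alpha> * x) + \<gamma> j (b + \<beta> * y) - \<gamma> i a \<in> R"
    using quadrant_image[OF pq \<alpha> \<beta>] by blast
  have R': "\<gamma> j (b + \<beta> * y) + \<gamma> i (a + \<alpha> * x) - \<gamma> j b \<in> R" if "0 < y" "y < \<epsilon>" "0 < x" "x < \<epsilon>" for x y
    using R(3)[OF that(3,4,1,2)] F(3) by (simp add: add.commute)
  have sgn_ev: "\<forall>\<^sub>F x in at_right 0. sgn (cross (velocity k (c + \<mu> * x)) u) = sgn (cross (velocity k c) u)"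
    if "k < n" "cross (velocity k c) u \<noteq> 0" for k c \<mu> u
  proof -
    have "((\<lambda>x. c + \<mu> * x) \<longlongrightarrow> c + \<mu> * 0) (at_right 0)" by (intro tendsto_add tendsto_mult tendsto_const tendsto_ident_at)
    then have "((\<lambda>x. c + \<mu> * x) \<longlongrightarrow> c) (at_right 0)" by simp
    then have "((\<lambda>x. velocity k (c + \<mu> * x)) \<longlongrightarrow> velocity k c) (at_right 0)"
      by (rule isCont_tendsto_compose[OF velocity(2)[OF that(1)]])
    then have T: "((\<lambda>x. cross (velocity k (c + \<mu> * x)) u) \<longlongrightarrow> cross (velocity k c) u) (at_right 0)"
      by (intro tendsto_Im tendsto_mult tendsto_cnj tendsto_const)
    show ?thesis
    proof (cases "cross (velocity k c) u > 0")
      case True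
      then show ?thesis using order_tendstoD(1)[OF T True] by (auto elim!: eventually_mono simp del: complex_cnj_mult)
    next
      case False
      then have neg: "cross (velocity k c) u < 0" using that(2) by linarith
      then show ?thesis using order_tendstoD(2)[OF T neg] by (auto elim!: eventually_mono simp del: complex_cnj_mult)
    qed
  qed
  have small: "\<forall>\<^sub>F x in at_right 0. 0 < x \<and> x < \<epsilon>"
    using R(1) by (auto simp: eventually_at_right[of 0 1] intro!: exI[of _ \<epsilon>])
  have F': "cross (velocity j b) (velocity i a) \<noteq> 0" using F(4) cross_eq_0_swap by blast
  show ?thesis
  proof (intro exI[of _ R] conjI allI impI)
    show "\<forall>\<^sub>F x in at_right 0. (i, frac (a + \<alpha> * x)) \<notin> passages n \<Gamma> \<and> region_towards n \<Gamma> (\<gamma> i (a + \<alpha> * x))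
       (of_real (sgn (\<beta> * cross (velocity i a) (velocity j b))) * (\<i> * velocity i (a + \<alpha> * x))) = R"
      using small eventually_regular[OF pq(1) \<alpha>] sgn_ev[OF F(1,4), of \<alpha>]
    proof eventually_elim
      case (elim x)
      then show ?case using strand_region[OF pq \<alpha> \<beta> R(2,1,3)] by blast
    qed
    show "\<forall>\<^sub>F y in at_right 0. (j, frac (b + \<beta> * y)) \<notin> passages n \<Gamma> \<and> region_towards n \<Gamma> (\<gamma> j (b + \<beta> * y))
       (of_real (sgn (\<alpha> * cross (velocity j b) (velocity i a))) * (\<i> * velocity j (b + \<beta> * y))) = R"
      using small eventually_regular[OF F(5) \<beta>] sgn_ev[OF F(2) F', of \<beta>]
    proof eventually_elim
      case (elim y)
      then show ?case using strand_region[OF F(5,6) \<beta> \<alpha> R(2,1) R'] by blast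
    qed
    show "region_towards n \<Gamma> (\<gamma> i a) (of_real (\<alpha> * x) * velocity i a + of_real (\<beta> * y) * velocity j b) = R"
      if "x > 0" "y > 0" for x y :: real
      by (rule sector_direction_region[OF pq \<alpha> \<beta> R(2,1,3) that])
  qed
qed

end

section \<open>Labels of semi-edges\<close>

lemma complex_Re_gt_minus_norm:
  assumes "Im z \<noteq> 0"
  shows "- cmod z < Re z"
proof -
  have "(Re z)\<^sup>2 < (cmod z)\<^sup>2" using assms by (simp add: cmod_power2)
  then have "\<bar>Re z\<bar> < cmod z" by (metis abs_norm_cancel power2_less_imp_less power2_abs norm_ge_zero)
  then show ?thesis by linarith
qed

text \<open>The unit normal of \<open>v\<close> contributes \<open>- norm v\<close>. The other unit
  normal contributes less than \<open>norm v\<close>, by the strict Cauchy-Schwarz inequality for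
  vectors that are not parallel.\<close>

lemma cross_normal_sum_neg:
  assumes "cross v w \<noteq> 0"
  shows "cross v (- (sgn (\<i> * v) + sgn (\<i> * w))) < 0"
proof -
  have vw: "norm v > 0" "norm w > 0" using assms by auto
  have i: "sgn (\<i> * z) = \<i> * sgn z" for z :: complex by (simp add: sgn_eq norm_mult)
  have "cross v (- (sgn (\<i> * v) + sgn (\<i> * w))) = - (Re (cnj v * sgn v) + Re (cnj v * sgn w))"
    unfolding i by (simp add: algebra_simps)
  moreover have "Re (cnj v * sgn v) = norm v"
  proof -
    have "cnj v * sgn v = of_real (norm v)"
      using vw(1) by (simp add: sgn_eq mult.commute[of "cnj v"] complex_norm_square[symmetric] power2_eq_square)
    then show ?thesis by simp
  qed
  moreover have "Re (cnj v * sgn w) > - norm v"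
  proof -
    have "- (norm v * norm w) < Re (cnj v * w)"
      using complex_Re_gt_minus_norm[OF assms] by (simp add: norm_mult)
    then have "- norm v < Re (cnj v * w) / norm w" using vw(2) by (simp add: field_simps)
    moreover have "cnj v * sgn w = (cnj v * w) / of_real (norm w)" by (simp add: sgn_eq)
    ultimately show ?thesis by (simp only: Re_divide_of_real)
  qed
  ultimately show ?thesis by linarith
qed

context link_diagram
begin

section \<open>Arcs along an edge\<close>

lemma curve_in_cut_link_iff:
  assumes "i < n"
  shows "\<Gamma> i t \<in> cut_link n \<Gamma> \<longleftrightarrow> (i, frac t) \<notin> snd ` crossings n \<Gamma>"
proof -
  have inj: "inj_on (\<lambda>(i, t). \<Gamma> i t) ({..<n} \<times> {0..<1})" using link by (simp add: oriented_link_def)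
  have sp: "space_point \<Gamma> (i, frac t) = \<Gamma> i t" using link_frac[OF assms] by (simp add: space_point_def)
  have "(i, frac t) \<in> snd ` crossings n \<Gamma>" if u: "\<Gamma> i t \<in> space_point \<Gamma> ` snd ` crossings n \<Gamma>"
  proof -
    obtain c where c: "c \<in> crossings n \<Gamma>" "\<Gamma> i t = space_point \<Gamma> (snd c)" using u by blast
    have m: "snd c \<in> {..<n} \<times> {0..<1}" using crossingsD(2)[of "fst c" "snd c"] c(1) by simp
    have "(\<lambda>(i, t). \<Gamma> i t) (snd c) = (\<lambda>(i, t). \<Gamma> i t) (i, frac t)"
      using c(2) sp by (simp add: space_point_def case_prod_beta)
    from inj_onD[OF inj this m frac_param[OF assms]] have "snd c = (i, frac t)" .
    then show ?thesis using c(1) by force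
  qed
  moreover have "\<Gamma> i t \<in> space_point \<Gamma> ` snd ` crossings n \<Gamma>" if "(i, frac t) \<in> snd ` crossings n \<Gamma>"
    using imageI[OF that, of "space_point \<Gamma>"] sp by simp
  moreover have "\<Gamma> i t \<in> link_set n \<Gamma>" using assms by (auto simp: link_set_def)
  ultimately show ?thesis unfolding cut_link_def by blast
qed

lemma arcs_unique: "A \<in> arcs n \<Gamma> \<Longrightarrow> B \<in> arcs n \<Gamma> \<Longrightarrow> x \<in> A \<Longrightarrow> x \<in> B \<Longrightarrow> A = B"
  unfolding arcs_def by (metis components_nonoverlap disjoint_iff)

text \<open>An arc runs through an over passage without ending there, so both ends at an over
  passage lie on one arc.\<close>

definition semi_edge_arc :: "passage \<Rightarrow> bool \<Rightarrow> (complex \<times> real) set" where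
  "semi_edge_arc p e =
     (if p \<in> fst ` crossings n \<Gamma> then arc_through n \<Gamma> p else if e then arc_out n \<Gamma> p else arc_in n \<Gamma> p)"

lemma arc_limit_eqI:
  assumes "A \<in> arcs n \<Gamma>" "\<forall>\<^sub>F t in F. f t \<in> A" "F \<noteq> bot"
  shows "(THE B. B \<in> arcs n \<Gamma> \<and> (\<forall>\<^sub>F t in F. f t \<in> B)) = A"
proof (rule the_equality)
  fix B assume B: "B \<in> arcs n \<Gamma> \<and> (\<forall>\<^sub>F t in F. f t \<in> B)"
  then have "\<forall>\<^sub>F t in F. f t \<in> A \<and> f t \<in> B" using assms(2) by (auto intro: eventually_conj)
  then obtain t where "f t \<in> A" "f t \<in> B" using eventually_happens assms(3) by blast
  then show "B = A" using arcs_unique B assms(1) by blast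
qed (use assms in blast)

text \<open>There is no passage in the interior of an edge, so the edge stays in one component of
  the cut link.\<close>

lemma edge_arc:
  assumes p: "p \<in> passages n \<Gamma>"
  shows "semi_edge_arc p True = semi_edge_arc (next_on_link n \<Gamma> p) False" "semi_edge_arc p True \<in> arcs n \<Gamma>"
proof -
  define i s t q where "i = fst p" and "s = snd p" and "t = next_time p" and "q = next_on_link n \<Gamma> p"
  have p_eq: "p = (i, s)" and q_eq: "q = (i, frac t)"
    by (simp_all add: i_def s_def q_def t_def next_on_link_next_time)
  have q: "q \<in> passages n \<Gamma>" unfolding q_def by (rule next_on_link_in[OF p])
  have i: "i < n" and s01: "frac s = s" using passages_param[OF p] by (auto simp: p_eq frac_eq)
  have st: "s < t" and free: "\<And>u. s < u \<Longrightarrow> u < t \<Longrightarrow> (i, frac u) \<notin> passages n \<Gamma>"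
    using next_time(1,4)[OF p] by (simp_all add: i_def s_def t_def)
  have under: "r \<notin> snd ` crossings n \<Gamma>" if "r \<in> fst ` crossings n \<Gamma>" for r
    using that over_not_under(3)[of r] by (metis imageE prod.collapse)
  define po qo where "po \<longleftrightarrow> p \<in> fst ` crossings n \<Gamma>" and "qo \<longleftrightarrow> q \<in> fst ` crossings n \<Gamma>"
  \<comment> \<open>An end of the edge belongs to the cut link if and only if it is an over
    passage.\<close>
  define J where "J = (if po then if qo then {s..t} else {s..<t} else if qo then {s<..t} else {s<..<t})"
  have J: "{s<..<t} \<subseteq> J" "J \<subseteq> {s..t}" "s \<in> J \<longleftrightarrow> po" "t \<in> J \<longleftrightarrow> qo"
    using st by (auto simp: J_def)
  have "connected J" by (simp add: J_def)
  then have "connected (\<Gamma> i ` J)" by (rule connected_continuous_image[OF continuous_link[OF i]])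
  moreover have "\<Gamma> i ` J \<subseteq> cut_link n \<Gamma>"
  proof (intro image_subsetI)
    fix u assume u: "u \<in> J"
    then consider "u = s" "po" | "u = t" "qo" | "s < u" "u < t" using J by force
    then have "(i, frac u) \<notin> snd ` crossings n \<Gamma>"
    proof cases
      case 1 then show ?thesis using under[of p] s01 by (simp add: po_def p_eq)
    next
      case 2 then show ?thesis using under[of q] by (simp add: qo_def q_eq)
    next
      case 3 then show ?thesis using free by (simp add: passages_def)
    qed
    then show "\<Gamma> i u \<in> cut_link n \<Gamma>" using curve_in_cut_link_iff[OF i] by simp
  qed
  moreover have "(s + t) / 2 \<in> J" using J(1) st by auto
  ultimately obtain A where A: "A \<in> arcs n \<Gamma>" "\<Gamma> i ` J \<subseteq> A"
    using exists_component_superset[of "\<Gamma> i ` J" "cut_link n \<Gamma>"] unfolding arcs_def by blast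
  have 1: "semi_edge_arc p True = A"
  proof (cases po)
    case True
    then have "space_point \<Gamma> p \<in> A" using A(2) J(3) by (auto simp: space_point_def p_eq)
    then have "arc_through n \<Gamma> p = A"
      unfolding arc_through_def using A(1) arcs_unique by (intro the_equality) blast+
    then show ?thesis using True by (simp add: semi_edge_arc_def po_def)
  next
    case False
    have "\<Gamma> i u \<in> A" if "s < u" "u < t" for u
      using A(2) J(1) that by (metis greaterThanLessThan_iff image_subset_iff subsetD)
    then have "\<forall>\<^sub>F u in at_right s. \<Gamma> i u \<in> A" using st by (auto simp: eventually_at_right[OF st])
    from arc_limit_eqI[OF A(1) this] have "arc_out n \<Gamma> p = A" by (simp add: arc_out_def p_eq)
    then show ?thesis using False by (simp add: semi_edge_arc_def po_def)
  qed
  have 2: "semi_edge_arc q False = A"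
  proof (cases qo)
    case True
    then have "space_point \<Gamma> q \<in> A" using A(2) J(4) link_frac[OF i, of t] by (auto simp: space_point_def q_eq)
    then have "arc_through n \<Gamma> q = A"
      unfolding arc_through_def using A(1) arcs_unique by (intro the_equality) blast+
    then show ?thesis using True by (simp add: semi_edge_arc_def qo_def)
  next
    case False
    \<comment> \<open>The arrival is recorded at \<open>frac t\<close>, so parameters just before it
      are shifted by an integer into \<open>J\<close>.\<close>
    have lt: "frac t - (t - s) < frac t" using st by simp
    have "\<Gamma> i u \<in> A" if "frac t - (t - s) < u" "u < frac t" for u
    proof -
      have "u + of_int \<lfloor>t\<rfloor> \<in> J" using that J(1) by (auto simp: frac_def)
      then show ?thesis using A(2) link_periodic[OF i, of u "\<lfloor>t\<rfloor>"] by (metis image_subset_iff)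
    qed
    then have "\<forall>\<^sub>F u in at_left (frac t). \<Gamma> i u \<in> A" unfolding eventually_at_left[OF lt] using lt by blast
    from arc_limit_eqI[OF A(1) this] have "arc_in n \<Gamma> q = A" by (simp add: arc_in_def q_eq)
    then show ?thesis using False by (simp add: semi_edge_arc_def qo_def)
  qed
  show "semi_edge_arc p True = semi_edge_arc (next_on_link n \<Gamma> p) False" "semi_edge_arc p True \<in> arcs n \<Gamma>"
    using 1 2 A(1) by (simp_all add: q_def)
qed

lemma semi_edge_arc_in_arcs:
  assumes p: "p \<in> passages n \<Gamma>"
  shows "semi_edge_arc p e \<in> arcs n \<Gamma>"
proof (cases e)
  case False
  obtain q where "q \<in> passages n \<Gamma>" "next_on_link n \<Gamma> q = p" using next_on_link_surj[OF p] .
  then show ?thesis using edge_arc[of q] False by simp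
qed (use edge_arc(2)[OF p] in simp)

section \<open>Colors of the regions along an edge\<close>

definition region_coloring :: "(complex set \<Rightarrow> int) \<Rightarrow> bool" where
  "region_coloring \<R> \<longleftrightarrow>
     (\<forall>p \<in> {..<n} \<times> {0..<1}. p \<notin> fst ` crossings n \<Gamma> \<union> snd ` crossings n \<Gamma> \<longrightarrow>
        \<R> (region_towards n \<Gamma> (plane_point \<Gamma> p) (normal \<Gamma> p)) =
        \<R> (region_towards n \<Gamma> (plane_point \<Gamma> p) (- normal \<Gamma> p)) + 1)"

text \<open>\<open>c = 1\<close> stands for the left side, into which the normal points, and
  \<open>c = - 1\<close> for the right side.\<close>

definition side_color :: "(complex set \<Rightarrow> int) \<Rightarrow> real \<Rightarrow> nat \<Rightarrow> real \<Rightarrow> int" where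
  "side_color \<R> c i t = \<R> (region_towards n \<Gamma> (\<gamma> i t) (of_real c * (\<i> * velocity i t)))"

lemma side_color_step:
  assumes "region_coloring \<R>" "i < n" "(i, frac t) \<notin> passages n \<Gamma>"
  shows "side_color \<R> 1 i t = side_color \<R> (- 1) i t + 1"
proof -
  have "\<R> (region_towards n \<Gamma> (plane_point \<Gamma> (i, frac t)) (normal \<Gamma> (i, frac t))) =
      \<R> (region_towards n \<Gamma> (plane_point \<Gamma> (i, frac t)) (- normal \<Gamma> (i, frac t))) + 1"
    using assms frac_param[OF assms(2), of t] unfolding region_coloring_def passages_def by blast
  then show ?thesis
    using assms(2) by (simp add: side_color_def plane_point_Pair normal_Pair link_frac velocity_frac)
qed

text \<open>Exchanging over and under strand reverses the frame that defines the crossing sign, and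
  the exception for over passages in \<open>positive_side\<close> compensates this. What remains
  depends on the two tangents and the end only.\<close>

lemma positive_side_cross:
  assumes "(i, a) \<in> passages n \<Gamma>" "other_passage n \<Gamma> (i, a) = (j, b)"
  shows "positive_side (i, a) e \<longleftrightarrow> e \<noteq> (cross (velocity i a) (velocity j b) > 0)"
  using assms(1)
proof (cases rule: passage_cases)
  case (1 q)
  then have "q = (j, b)" using other_passage_crossing(1) assms(2) by metis
  then have c: "((i, a), (j, b)) \<in> crossings n \<Gamma>" using 1 by simp
  show ?thesis
    using crossing_of_crossing(1)[OF c] over_not_under(1)[OF c]
    by (auto simp: positive_side_def crossing_sign_def tangent_Pair simp del: complex_cnj_mult)
next
  case (2 q)
  then have "q = (j, b)" using other_passage_crossing(2) assms(2) by metis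
  then have c: "((j, b), (i, a)) \<in> crossings n \<Gamma>" using 2 by simp
  have "cross (velocity j b) (velocity i a) > 0 \<longleftrightarrow> \<not> cross (velocity i a) (velocity j b) > 0"
    using crossing_frame(4)[OF assms] cross_swap[of "velocity i a" "velocity j b"] by linarith
  then show ?thesis
    using crossing_of_crossing(2)[OF c] over_not_under(2)[OF c]
    by (auto simp: positive_side_def crossing_sign_def tangent_Pair simp del: complex_cnj_mult)
qed

lemma source_region_conv:
  assumes "(i, a) \<in> passages n \<Gamma>" "other_passage n \<Gamma> (i, a) = (j, b)"
  shows "source_region n \<Gamma> (crossing_of n \<Gamma> (i, a)) =
    region_towards n \<Gamma> (\<gamma> i a) (- (sgn (\<i> * velocity i a) + sgn (\<i> * velocity j b)))"
  using assms(1)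
proof (cases rule: passage_cases)
  case (1 q)
  then have "q = (j, b)" using other_passage_crossing(1) assms(2) by metis
  then have c: "((i, a), (j, b)) \<in> crossings n \<Gamma>" using 1 by simp
  show ?thesis
    by (simp add: crossing_of_crossing(1)[OF c] source_region_def plane_point_Pair normal_Pair)
next
  case (2 q)
  then have "q = (j, b)" using other_passage_crossing(2) assms(2) by metis
  then have c: "((j, b), (i, a)) \<in> crossings n \<Gamma>" using 2 by simp
  show ?thesis
    using crossing_frame(3)[OF assms]
    by (simp add: crossing_of_crossing(2)[OF c] source_region_def plane_point_Pair normal_Pair add.commute)
qed

text \<open>The source region is on the right of both strands. Crossing the outgoing half of
  \<open>i\<close> or the incoming half of \<open>j\<close> from there raises the color by 1, and
  the three sectors met in this way contain the right sides of all four half strands.\<close>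

lemma positive_crossing_sides:
  assumes pq: "(i, a) \<in> passages n \<Gamma>" "other_passage n \<Gamma> (i, a) = (j, b)"
    and pos: "cross (velocity i a) (velocity j b) > 0" and rc: "region_coloring \<R>"
  defines "u \<equiv> \<R> (source_region n \<Gamma> (crossing_of n \<Gamma> (i, a)))"
  shows "\<forall>\<^sub>F x in at_right 0. side_color \<R> (- 1) i (a + 1 * x) = u"
    "\<forall>\<^sub>F x in at_right 0. side_color \<R> (- 1) j (b + - 1 * x) = u"
    "\<forall>\<^sub>F x in at_right 0. side_color \<R> (- 1) j (b + 1 * x) = u + 1"
    "\<forall>\<^sub>F x in at_right 0. side_color \<R> (- 1) i (a + - 1 * x) = u + 1"
proof -
  note F = crossing_frame[OF pq]
  define v w where "v = velocity i a" and "w = velocity j b"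
  have vw: "cross v w > 0" using pos by (simp add: v_def w_def)
  have wv: "cross w v < 0" using vw cross_swap[of v w] by linarith
  have sg: "sgn (1 * cross v w) = 1" "sgn (- 1 * cross v w) = - 1" "sgn (1 * cross w v) = - 1" "sgn (- 1 * cross w v) = 1"
    using vw wv by (simp_all del: complex_cnj_mult add: sgn_if)
  have nz: "(1::real) \<noteq> 0" "(- 1::real) \<noteq> 0" by simp_all
  have ev0: "\<exists>x. P x" if "\<forall>\<^sub>F x in at_right (0::real). P x" for P
    using eventually_happens[OF that] by simp
  have sector: "\<exists>R.
    (\<forall>\<^sub>F x in at_right 0. (i, frac (a + \<alpha> * x)) \<notin> passages n \<Gamma> \<and>
      region_towards n \<Gamma> (\<gamma> i (a + \<alpha> * x)) (of_real s * (\<i> * velocity i (a + \<alpha> * x))) = R) \<and>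
    (\<forall>\<^sub>F y in at_right 0. (j, frac (b + \<beta> * y)) \<notin> passages n \<Gamma> \<and>
      region_towards n \<Gamma> (\<gamma> j (b + \<beta> * y)) (of_real s' * (\<i> * velocity j (b + \<beta> * y))) = R) \<and>
    (\<forall>x>0. \<forall>y>0. region_towards n \<Gamma> (\<gamma> i a) (of_real (\<alpha> * x) * v + of_real (\<beta> * y) * w) = R)"
    if "\<alpha> \<noteq> 0" "\<beta> \<noteq> 0" "sgn (\<beta> * cross v w) = s" "sgn (\<alpha> * cross w v) = s'" for \<alpha> \<beta> s s' :: real
    unfolding that(3,4)[symmetric] v_def w_def by (rule crossing_sector[OF pq that(1,2)])
  obtain R1 where R1:
    "\<forall>\<^sub>F x in at_right 0. (i, frac (a + 1 * x)) \<notin> passages n \<Gamma> \<and>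
      region_towards n \<Gamma> (\<gamma> i (a + 1 * x)) (of_real (- 1) * (\<i> * velocity i (a + 1 * x))) = R1"
    "\<forall>\<^sub>F y in at_right 0. (j, frac (b + - 1 * y)) \<notin> passages n \<Gamma> \<and>
      region_towards n \<Gamma> (\<gamma> j (b + - 1 * y)) (of_real (- 1) * (\<i> * velocity j (b + - 1 * y))) = R1"
    "\<forall>x>0. \<forall>y>0. region_towards n \<Gamma> (\<gamma> i a) (of_real (1 * x) * v + of_real (- 1 * y) * w) = R1"
    using sector[OF nz(1,2) sg(2,3)] by blast
  obtain R2 where R2:
    "\<forall>\<^sub>F x in at_right 0. (i, frac (a + 1 * x)) \<notin> passages n \<Gamma> \<and>
      region_towards n \<Gamma> (\<gamma> i (a + 1 * x)) (of_real 1 * (\<i> * velocity i (a + 1 * x))) = R2"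
    "\<forall>\<^sub>F y in at_right 0. (j, frac (b + 1 * y)) \<notin> passages n \<Gamma> \<and>
      region_towards n \<Gamma> (\<gamma> j (b + 1 * y)) (of_real (- 1) * (\<i> * velocity j (b + 1 * y))) = R2"
    using sector[OF nz(1,1) sg(1,3)] by blast
  obtain R3 where R3:
    "\<forall>\<^sub>F x in at_right 0. (i, frac (a + - 1 * x)) \<notin> passages n \<Gamma> \<and>
      region_towards n \<Gamma> (\<gamma> i (a + - 1 * x)) (of_real (- 1) * (\<i> * velocity i (a + - 1 * x))) = R3"
    "\<forall>\<^sub>F y in at_right 0. (j, frac (b + - 1 * y)) \<notin> passages n \<Gamma> \<and>
      region_towards n \<Gamma> (\<gamma> j (b + - 1 * y)) (of_real 1 * (\<i> * velocity j (b + - 1 * y))) = R3"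
    using sector[OF nz(2,2) sg(2,4)] by blast
  have u: "\<R> R1 = u"
  proof -
    \<comment> \<open>By Cramer's rule the direction \<open>d\<close> of the source region has a
      positive coefficient at \<open>v\<close> and a negative one at \<open>w\<close>, so it points
      into the sector of \<open>R1\<close>.\<close>
    define d where "d = - (sgn (\<i> * v) + sgn (\<i> * w))"
    have vd: "cross v d < 0" unfolding d_def by (rule cross_normal_sum_neg) (use vw in simp)
    have wd: "cross w d < 0"
      using cross_normal_sum_neg[of w v] wv unfolding d_def by (simp add: add.commute del: complex_cnj_mult)
    define x y where "x = cross d w / cross v w" and "y = - cross v d / cross v w"
    have "cross d w > 0" using wd cross_swap[of d w] by linarith
    then have xy: "x > 0" "y > 0" using vw vd by (simp_all add: x_def y_def divide_neg_pos del: complex_cnj_mult)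
    have "of_real (cross v w) * d = of_real (cross v w) * (of_real (1 * x) * v + of_real (- 1 * y) * w)"
    proof -
      have g: "of_real c * (of_real X * v + of_real Y * w) = of_real (c * X) * v + of_real (c * Y) * w" for c X Y :: real
        by (simp add: algebra_simps)
      have "cross v w * (1 * x) = cross d w" "cross v w * (- 1 * y) = cross v d"
        using vw by (simp_all add: x_def y_def del: complex_cnj_mult)
      then show ?thesis
        unfolding g using complex_frame_expansion[of v w d] by simp
    qed
    then have "d = of_real (1 * x) * v + of_real (- 1 * y) * w"
      using vw by (metis mult_left_cancel of_real_eq_0_iff less_irrefl)
    then show ?thesis
      using R1(3) xy source_region_conv[OF pq] by (simp add: u_def d_def v_def w_def)
  qed
  show "\<forall>\<^sub>F x in at_right 0. side_color \<R> (- 1) i (a + 1 * x) = u"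
    using R1(1) by eventually_elim (simp only: side_color_def u)
  show "\<forall>\<^sub>F x in at_right 0. side_color \<R> (- 1) j (b + - 1 * x) = u"
    using R1(2) by eventually_elim (simp only: side_color_def u)
  obtain x where x: "(i, frac (a + 1 * x)) \<notin> passages n \<Gamma>"
      "region_towards n \<Gamma> (\<gamma> i (a + 1 * x)) (of_real (- 1) * (\<i> * velocity i (a + 1 * x))) = R1"
      "region_towards n \<Gamma> (\<gamma> i (a + 1 * x)) (of_real 1 * (\<i> * velocity i (a + 1 * x))) = R2"
    using ev0[OF eventually_conj[OF R1(1) R2(1)]] by blast
  have u2: "\<R> R2 = u + 1"
    using side_color_step[OF rc F(1) x(1)] unfolding side_color_def x(2,3) u .
  obtain y where y: "(j, frac (b + - 1 * y)) \<notin> passages n \<Gamma>"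
      "region_towards n \<Gamma> (\<gamma> j (b + - 1 * y)) (of_real (- 1) * (\<i> * velocity j (b + - 1 * y))) = R1"
      "region_towards n \<Gamma> (\<gamma> j (b + - 1 * y)) (of_real 1 * (\<i> * velocity j (b + - 1 * y))) = R3"
    using ev0[OF eventually_conj[OF R1(2) R3(2)]] by blast
  have u3: "\<R> R3 = u + 1"
    using side_color_step[OF rc F(2) y(1)] unfolding side_color_def y(2,3) u .
  show "\<forall>\<^sub>F x in at_right 0. side_color \<R> (- 1) j (b + 1 * x) = u + 1"
    using R2(2) by eventually_elim (simp only: side_color_def u2)
  show "\<forall>\<^sub>F x in at_right 0. side_color \<R> (- 1) i (a + - 1 * x) = u + 1"
    using R3(1) by eventually_elim (simp only: side_color_def u3)
qed

text \<open>The negative of the exponent of \<open>\<phi>\<close> in the triangle that contains the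
  semi-edge. \<open>semi_edge_index_side\<close> recognizes it as the color of the region on the
  right, which makes it comparable between two crossings.\<close>

definition semi_edge_index :: "(complex set \<Rightarrow> int) \<Rightarrow> passage \<Rightarrow> bool \<Rightarrow> int" where
  "semi_edge_index \<R> p e =
     \<R> (source_region n \<Gamma> (crossing_of n \<Gamma> p)) + (if positive_side p e then 1 else 0)"

lemma semi_edge_index_side:
  assumes p: "(i, a) \<in> passages n \<Gamma>" and rc: "region_coloring \<R>"
  shows "\<forall>\<^sub>F x in at_right 0. side_color \<R> (- 1) i (a + (if e then 1 else - 1) * x) = semi_edge_index \<R> (i, a) e"
proof -
  obtain j b where q: "other_passage n \<Gamma> (i, a) = (j, b)" by (metis surj_pair)
  note F = crossing_frame[OF p q]
  show ?thesis
  proof (cases "cross (velocity i a) (velocity j b) > 0")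
    case True
    show ?thesis
      using positive_crossing_sides(1,4)[OF p q True rc] positive_side_cross[OF p q, of e] True
      by (cases e) (simp_all add: semi_edge_index_def del: complex_cnj_mult)
  next
    case False
    then have neg: "cross (velocity j b) (velocity i a) > 0"
      using F(4) cross_swap[of "velocity i a" "velocity j b"] by linarith
    have c: "crossing_of n \<Gamma> (j, b) = crossing_of n \<Gamma> (i, a)" using other_passage(4)[OF p] q by simp
    show ?thesis
      using positive_crossing_sides(2,3)[OF F(5,6) neg rc] positive_side_cross[OF p q, of e] False
      by (cases e) (simp_all add: semi_edge_index_def c del: complex_cnj_mult)
  qed
qed

lemma edge_index:
  assumes p: "p \<in> passages n \<Gamma>" and rc: "region_coloring \<R>"
  shows "semi_edge_index \<R> p True = semi_edge_index \<R> (next_on_link n \<Gamma> p) False"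
proof -
  define i s t where "i = fst p" and "s = snd p" and "t = next_time p"
  have p_eq: "p = (i, s)" and q_eq: "next_on_link n \<Gamma> p = (i, frac t)"
    by (simp_all add: i_def s_def t_def next_on_link_next_time)
  have i: "i < n" using passages_param[OF p] by (simp add: p_eq)
  have st: "s < t" and free: "\<And>u. s < u \<Longrightarrow> u < t \<Longrightarrow> (i, frac u) \<notin> passages n \<Gamma>"
    using next_time(1,4)[OF p] by (simp_all add: i_def s_def t_def)
  have small: "\<forall>\<^sub>F x in at_right 0. 0 < x \<and> x < t - s"
    using st by (auto simp: eventually_at_right[of 0 1] intro!: exI[of _ "t - s"])
  obtain x where x: "0 < x" "x < t - s" "side_color \<R> (- 1) i (s + x) = semi_edge_index \<R> p True"
    using eventually_happens[OF eventually_conj[OF small semi_edge_index_side[OF p[unfolded p_eq] rc, of True]]] p_eq by auto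
  obtain y where y: "0 < y" "y < t - s" "side_color \<R> (- 1) i (frac t - y) = semi_edge_index \<R> (next_on_link n \<Gamma> p) False"
    using eventually_happens[OF eventually_conj[OF small semi_edge_index_side[OF next_on_link_in[OF p, unfolded q_eq] rc, of False]]]
      q_eq by auto
  \<comment> \<open>The next passage is recorded at \<open>frac t\<close>, whereas the edge is the
    interval from \<open>s\<close> to \<open>t\<close>; the parameters differ by an integer.\<close>
  have fr: "frac (t - y) = frac (frac t - y)"
  proof -
    have "frac (u - of_int k) = frac u" for u :: real and k by (simp add: frac_def)
    moreover have "frac t - y = (t - y) - of_int \<lfloor>t\<rfloor>" by (simp add: frac_def)
    ultimately show ?thesis by metis
  qed
  then have "\<gamma> i (frac t - y) = \<gamma> i (t - y)" "velocity i (frac t - y) = velocity i (t - y)"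
    using link_frac[OF i] velocity_frac[OF i] by metis+
  then have "side_color \<R> (- 1) i (frac t - y) = side_color \<R> (- 1) i (t - y)" by (simp add: side_color_def)
  also have "\<dots> = side_color \<R> (- 1) i (s + x)"
    unfolding side_color_def
    by (rule arg_cong[OF side_region_constant[OF i free]]) (use x y in auto)
  finally show ?thesis using x(3) y(3) by simp
qed

end

section \<open>The chain of the coloring\<close>

lemma auto_closed: "f \<in> auto G \<Longrightarrow> x \<in> carrier G \<Longrightarrow> f x \<in> carrier G"
  by (rule auto_mult(2))

lemma AutoGroup_pow_auto:
  assumes "group G" "\<phi> \<in> auto G"
  shows "\<phi> [^]\<^bsub>AutoGroup G\<^esub> (k::int) \<in> auto G"
proof -
  have "\<phi> \<in> carrier (AutoGroup G)" using assms(2) by (simp add: AutoGroup_def)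
  then have "\<phi> [^]\<^bsub>AutoGroup G\<^esub> k \<in> carrier (AutoGroup G)"
    by (rule group.int_pow_closed[OF group.AutoGroup[OF assms(1)]])
  then show ?thesis by (simp add: AutoGroup_def)
qed

lemma AutoGroup_pow_step:
  assumes "group G" "\<phi> \<in> auto G" "x \<in> carrier G"
  shows "(\<phi> [^]\<^bsub>AutoGroup G\<^esub> (k::int)) (\<phi> x) = (\<phi> [^]\<^bsub>AutoGroup G\<^esub> (k + 1)) x"
proof -
  note A = group.AutoGroup[OF assms(1)]
  have c: "\<phi> \<in> carrier (AutoGroup G)" using assms(2) by (simp add: AutoGroup_def)
  have m: "f \<otimes>\<^bsub>AutoGroup G\<^esub> f' = compose (carrier G) f f'" if "f \<in> auto G" "f' \<in> auto G" for f f'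
    using that by (simp add: AutoGroup_def BijGroup_def auto_def)
  have "\<phi> [^]\<^bsub>AutoGroup G\<^esub> (k + 1) = (\<phi> [^]\<^bsub>AutoGroup G\<^esub> k) \<otimes>\<^bsub>AutoGroup G\<^esub> \<phi>"
    using group.int_pow_mult[OF A c, of k 1] group.int_pow_1[OF A c] by simp
  then show ?thesis
    using m[OF AutoGroup_pow_auto[OF assms(1,2), of k] assms(2)] assms(3) by (simp add: compose_eq)
qed

lemma shifted_coset_in_lcosets:
  assumes "group G" "\<phi> \<in> auto G" "x \<in> carrier G"
  shows "shifted_coset G H \<phi> k x \<in> lcosets\<^bsub>G\<^esub> H"
  using group.inv_closed[OF assms(1) auto_closed[OF AutoGroup_pow_auto[OF assms(1,2), of k] assms(3)]]
  unfolding shifted_coset_def LCOSETS_def by blast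

text \<open>Right multiplication by \<open>c\<close> permutes the group, hence it only reindexes the
  set of translates.\<close>

lemma tuple_class_translate:
  assumes G: "group G" and c: "c \<in> carrier G" and xs: "\<And>A. A \<in> set xs \<Longrightarrow> A \<subseteq> carrier G"
  shows "tuple_class G (map (\<lambda>A. c <#\<^bsub>G\<^esub> A) xs) = tuple_class G xs"
proof -
  interpret group G by (rule G)
  have *: "map (\<lambda>A. k <#\<^bsub>G\<^esub> A) (map (\<lambda>A. c <#\<^bsub>G\<^esub> A) xs) = map (\<lambda>A. (k \<otimes>\<^bsub>G\<^esub> c) <#\<^bsub>G\<^esub> A) xs" if "k \<in> carrier G" for k
    using lcos_m_assoc[OF xs that c] by simp
  have "\<exists>k'. ys = map (\<lambda>A. k' <#\<^bsub>G\<^esub> A) (map (\<lambda>A. c <#\<^bsub>G\<^esub> A) xs) \<and> k' \<in> carrier G"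
    if "ys = map (\<lambda>A. k <#\<^bsub>G\<^esub> A) xs" "k \<in> carrier G" for ys k
  proof (intro exI conjI)
    show k': "k \<otimes>\<^bsub>G\<^esub> inv\<^bsub>G\<^esub> c \<in> carrier G" using that(2) c by simp
    have "k \<otimes>\<^bsub>G\<^esub> inv\<^bsub>G\<^esub> c \<otimes>\<^bsub>G\<^esub> c = k" using that(2) c by (simp add: m_assoc)
    then show "ys = map (\<lambda>A. (k \<otimes>\<^bsub>G\<^esub> inv\<^bsub>G\<^esub> c) <#\<^bsub>G\<^esub> A) (map (\<lambda>A. c <#\<^bsub>G\<^esub> A) xs)"
      unfolding *[OF k'] that(1) by simp
  qed
  moreover have "\<exists>k'. ys = map (\<lambda>A. k' <#\<^bsub>G\<^esub> A) xs \<and> k' \<in> carrier G"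
    if "ys = map (\<lambda>A. k <#\<^bsub>G\<^esub> A) (map (\<lambda>A. c <#\<^bsub>G\<^esub> A) xs)" "k \<in> carrier G" for ys k
    using *[OF that(2)] that c m_closed by metis
  ultimately show ?thesis
    unfolding tuple_class_def by blast
qed

text \<open>Let \<open>F\<close> and \<open>F'\<close> be the powers of \<phi> with exponents
  \<open>- u\<close> and \<open>- u - 1\<close>, so that \<open>F'\<close> after \<phi> is
  \<open>F\<close>. Then \<open>F'\<close> sends the new first representative to F(a) F(b)^-1 F'(b).
  The inverses for both vertices therefore change by the same left factor F'(b)^-1 F(b), which the
  diagonal action absorbs.\<close>

lemma shared_side_class:
  assumes G: "group G" and \<phi>: "\<phi> \<in> auto G" and H: "subgroup H G" and ab: "a \<in> carrier G" "b \<in> carrier G"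
  shows "tuple_class G [shifted_coset G H \<phi> (- u) a, shifted_coset G H \<phi> (- u) b] =
    tuple_class G [shifted_coset G H \<phi> (- u - 1) (\<phi> (a \<otimes>\<^bsub>G\<^esub> inv\<^bsub>G\<^esub> b) \<otimes>\<^bsub>G\<^esub> b), shifted_coset G H \<phi> (- u - 1) b]"
proof -
  interpret group G by (rule G)
  define F F' where "F = \<phi> [^]\<^bsub>AutoGroup G\<^esub> (- u)" and "F' = \<phi> [^]\<^bsub>AutoGroup G\<^esub> (- u - 1)"
  have FF: "F \<in> auto G" "F' \<in> auto G"
    unfolding F_def F'_def by (rule AutoGroup_pow_auto[OF G \<phi>])+
  note FH = auto_mult[OF FF(1)] auto_mult[OF FF(2)]
  have cl: "F a \<in> carrier G" "F b \<in> carrier G" "F' b \<in> carrier G" "a \<otimes>\<^bsub>G\<^esub> inv\<^bsub>G\<^esub> b \<in> carrier G"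
    using ab auto_closed[OF FF(1)] auto_closed[OF FF(2)] by simp_all
  have Hs: "H \<subseteq> carrier G" using H by (rule subgroup.subset)
  define c where "c = inv\<^bsub>G\<^esub> (F' b) \<otimes>\<^bsub>G\<^esub> F b"
  have c: "c \<in> carrier G" using cl by (simp add: c_def)
  have "F' (\<phi> (a \<otimes>\<^bsub>G\<^esub> inv\<^bsub>G\<^esub> b)) = F (a \<otimes>\<^bsub>G\<^esub> inv\<^bsub>G\<^esub> b)"
    using AutoGroup_pow_step[OF G \<phi> cl(4), of "- u - 1"] by (simp add: F_def F'_def)
  also have "\<dots> = F a \<otimes>\<^bsub>G\<^esub> F (inv\<^bsub>G\<^esub> b)" using ab by (simp add: FH)
  also have "F (inv\<^bsub>G\<^esub> b) = inv\<^bsub>G\<^esub> (F b)"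
  proof -
    interpret group_hom G G F
      using FF(1) by unfold_locales (simp add: auto_def)
    show ?thesis using ab(2) by simp
  qed
  finally have "F' (\<phi> (a \<otimes>\<^bsub>G\<^esub> inv\<^bsub>G\<^esub> b) \<otimes>\<^bsub>G\<^esub> b) = F a \<otimes>\<^bsub>G\<^esub> inv\<^bsub>G\<^esub> (F b) \<otimes>\<^bsub>G\<^esub> F' b"
    using FH(3)[OF auto_closed[OF \<phi> cl(4)] ab(2)] by simp
  then have "inv\<^bsub>G\<^esub> (F' (\<phi> (a \<otimes>\<^bsub>G\<^esub> inv\<^bsub>G\<^esub> b) \<otimes>\<^bsub>G\<^esub> b)) = c \<otimes>\<^bsub>G\<^esub> inv\<^bsub>G\<^esub> (F a)"
    using cl by (simp add: c_def inv_mult_group m_assoc)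
  moreover have "inv\<^bsub>G\<^esub> (F' b) = c \<otimes>\<^bsub>G\<^esub> inv\<^bsub>G\<^esub> (F b)"
    using cl by (simp add: c_def m_assoc)
  ultimately have eq: "[shifted_coset G H \<phi> (- u - 1) (\<phi> (a \<otimes>\<^bsub>G\<^esub> inv\<^bsub>G\<^esub> b) \<otimes>\<^bsub>G\<^esub> b), shifted_coset G H \<phi> (- u - 1) b] =
      map (\<lambda>A. c <#\<^bsub>G\<^esub> A) [shifted_coset G H \<phi> (- u) a, shifted_coset G H \<phi> (- u) b]"
    using c cl Hs by (simp add: shifted_coset_def F_def[symmetric] F'_def[symmetric] lcos_m_assoc)
  have "shifted_coset G H \<phi> (- u) a \<subseteq> carrier G" "shifted_coset G H \<phi> (- u) b \<subseteq> carrier G"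
    using l_coset_subset_G[OF Hs inv_closed[OF cl(1)]] l_coset_subset_G[OF Hs inv_closed[OF cl(2)]]
    by (simp_all add: shifted_coset_def F_def[symmetric])
  then have "tuple_class G (map (\<lambda>A. c <#\<^bsub>G\<^esub> A) [shifted_coset G H \<phi> (- u) a, shifted_coset G H \<phi> (- u) b]) =
      tuple_class G [shifted_coset G H \<phi> (- u) a, shifted_coset G H \<phi> (- u) b]"
    by (intro tuple_class_translate[OF G c]) auto
  then show ?thesis unfolding eq by (rule sym)
qed

lemma coset_rep_in_carrier:
  assumes G: "group G" and H: "subgroup H G" and A: "A \<in> rcosets\<^bsub>G\<^esub> H"
  shows "coset_rep A \<in> carrier G"
proof -
  obtain x where x: "x \<in> carrier G" "A = H #>\<^bsub>G\<^esub> x" using A by (auto simp: RCOSETS_def)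
  obtain h where "h \<in> H" "coset_rep A = h \<otimes>\<^bsub>G\<^esub> x"
    using coset_rep_rcoset[OF G H x(1)] x(2) by blast
  then show ?thesis
    using x(1) G H by (simp add: monoid.m_closed[OF group.is_monoid] subgroup.mem_carrier)
qed

lemma tuple_face_triangle:
  "tuple_face 0 [x, y, z] = [y, z]" "tuple_face 1 [x, y, z] = [x, z]" "tuple_face 2 [x, y, z] = [x, y]"
  "tuple_face (Suc 0) [x, y, z] = [x, z]"
  by (simp_all add: tuple_face_def numeral_2_eq_2)

lemma frag_cmul_uminus_add: "frag_cmul k (- x + y) = frag_cmul (- k) x + frag_cmul k y"
  using frag_cmul_cmul[of k "- 1" x] by (simp only: frag_cmul_distrib2 frag_cmul_minus_one mult_minus1_right)

lemma psi_coloring_cycle: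
  assumes "finite (crossings n \<Gamma>)"
  shows "psi G H \<phi> g (coloring_cycle n \<Gamma> \<A> \<R>) =
    (\<Sum>t\<in>crossings n \<Gamma> \<times> UNIV. frag_cmul (expanded_sign \<Gamma> t)
       (frag_of (tuple_class G (expanded_triangle G H \<phi> g n \<Gamma> \<A> \<R> t))))"
proof -
  let ?f = "\<lambda>t. frag_cmul (expanded_sign \<Gamma> t) (frag_of (tuple_class G (expanded_triangle G H \<phi> g n \<Gamma> \<A> \<R> t)))"
  have "psi G H \<phi> g (coloring_cycle n \<Gamma> \<A> \<R>) = (\<Sum>c\<in>crossings n \<Gamma>. ?f (c, False) + ?f (c, True))"
    unfolding coloring_cycle_def psi_def frag_extend_sum[OF assms] comp_def
    by (intro sum.cong refl)
      (simp only: frag_extend_cmul frag_extend_of frag_cmul_uminus_add expanded_sign.simps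
        expanded_triangle.simps if_True if_False)
  also have "\<dots> = (\<Sum>c\<in>crossings n \<Gamma>. \<Sum>b\<in>UNIV. ?f (c, b))"
    by (simp add: UNIV_bool)
  also have "\<dots> = (\<Sum>t\<in>crossings n \<Gamma> \<times> UNIV. ?f t)"
    by (simp only: sum.cartesian_product case_prod_unfold prod.collapse)
  finally show ?thesis .
qed

context link_diagram
begin

section \<open>Labels and signs of the triangles at a crossing\<close>

text \<open>The inner product of the under tangent with the over normal is the determinant of the
  over and the under tangent. The choice of the source arc is thus a test of the crossing
  sign.\<close>

lemma arcs_at_crossing:
  assumes c: "(p, q) \<in> crossings n \<Gamma>"
  shows "over_arc n \<Gamma> (p, q) = semi_edge_arc p e"
    "under_arc_source n \<Gamma> (p, q) = semi_edge_arc q (crossing_sign \<Gamma> (p, q) \<noteq> 1)"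
    "under_arc_target n \<Gamma> (p, q) = semi_edge_arc q (crossing_sign \<Gamma> (p, q) = 1)"
proof -
  have s: "tangent \<Gamma> q \<bullet> normal \<Gamma> p > 0 \<longleftrightarrow> crossing_sign \<Gamma> (p, q) = 1"
    unfolding normal_def inner_i_times crossing_sign_def by (simp del: complex_cnj_mult)
  show "over_arc n \<Gamma> (p, q) = semi_edge_arc p e"
    "under_arc_source n \<Gamma> (p, q) = semi_edge_arc q (crossing_sign \<Gamma> (p, q) \<noteq> 1)"
    "under_arc_target n \<Gamma> (p, q) = semi_edge_arc q (crossing_sign \<Gamma> (p, q) = 1)"
    using over_not_under(1,2)[OF c] s
    by (simp_all add: over_arc_def under_arc_source_def under_arc_target_def semi_edge_arc_def)
qed

text \<open>The side has number 1 for an over passage and 2 for an under passage; the resulting sign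
  is cancelled by the exception for over passages in \<open>positive_side\<close>.\<close>

lemma semi_edge_sign:
  assumes p: "p \<in> passages n \<Gamma>"
  shows "expanded_sign \<Gamma> (crossing_of n \<Gamma> p, positive_side p e) * (- 1) ^ (3 - capping_vertex p) = (if e then 1 else - 1)"
proof -
  have "crossing_sign \<Gamma> (crossing_of n \<Gamma> p) = 1 \<or> crossing_sign \<Gamma> (crossing_of n \<Gamma> p) = - 1"
    by (simp add: crossing_sign_def)
  then show ?thesis
    by (cases e) (auto simp: positive_side_def capping_vertex_def)
qed

context
  fixes G :: "('g, 'm) monoid_scheme" and H \<phi> g \<A> \<R>
  assumes G: "group G" and \<phi>: "\<phi> \<in> auto G" and H: "subgroup H G" and \<phi>H: "\<forall>h\<in>H. \<phi> h = h"
    and g: "g \<in> carrier G" and col: "XZ_coloring G H \<phi> n \<Gamma> \<A> \<R>"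
begin

abbreviation triangle :: "(passage \<times> passage) \<times> bool \<Rightarrow> 'g set list" where
  "triangle \<equiv> expanded_triangle G H \<phi> g n \<Gamma> \<A> \<R>"

lemma region_coloring: "region_coloring \<R>"
  using col unfolding XZ_coloring_def region_coloring_def by blast

lemma color_in_rcosets: "p \<in> passages n \<Gamma> \<Longrightarrow> \<A> (semi_edge_arc p e) \<in> rcosets\<^bsub>G\<^esub> H"
  using col semi_edge_arc_in_arcs unfolding XZ_coloring_def by blast

lemma color_rep: "p \<in> passages n \<Gamma> \<Longrightarrow> coset_rep (\<A> (semi_edge_arc p e)) \<in> carrier G"
  by (rule coset_rep_in_carrier[OF G H color_in_rcosets])

definition semi_edge_label :: "passage \<Rightarrow> bool \<Rightarrow> 'g set list" where
  "semi_edge_label p e =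
     [shifted_coset G H \<phi> (- semi_edge_index \<R> p e) g,
      shifted_coset G H \<phi> (- semi_edge_index \<R> p e) (coset_rep (\<A> (semi_edge_arc p e)))]"

text \<open>The coloring condition turns the middle vertex of the positive triangle into the color
  of the target arc. Both triangles then have one form, in which only the exponent and the end of
  the under strand depend on \<open>b\<close>. At the over passage either end \<open>e\<close> may
  be named.\<close>

lemma triangle_at_crossing:
  assumes c: "(p, q) \<in> crossings n \<Gamma>" and k: "k = - (\<R> (source_region n \<Gamma> (p, q)) + (if b then 1 else 0))"
  shows "triangle ((p, q), b) =
    [shifted_coset G H \<phi> k g,
     shifted_coset G H \<phi> k (coset_rep (\<A> (semi_edge_arc q (b = (crossing_sign \<Gamma> (p, q) = 1))))),
     shifted_coset G H \<phi> k (coset_rep (\<A> (semi_edge_arc p e)))]"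
proof -
  note P = crossing_passages[OF c]
  define A B where "A = \<A> (under_arc_source n \<Gamma> (p, q))" and "B = \<A> (over_arc n \<Gamma> (p, q))"
  have AB: "coset_rep A \<in> carrier G" "coset_rep B \<in> carrier G"
    unfolding A_def B_def arcs_at_crossing(2)[OF c] arcs_at_crossing(1)[OF c, of True] using color_rep P by blast+
  define m where "m = \<phi> (coset_rep A \<otimes>\<^bsub>G\<^esub> inv\<^bsub>G\<^esub> coset_rep B) \<otimes>\<^bsub>G\<^esub> coset_rep B"
  have m: "m \<in> carrier G"
    unfolding m_def using AB auto_closed[OF \<phi>] G
    by (simp add: group.inv_closed monoid.m_closed[OF group.is_monoid])
  have "quandle_op G H \<phi> A B = \<A> (under_arc_target n \<Gamma> (p, q))"
    using col c unfolding XZ_coloring_def A_def B_def by blast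
  then have t: "\<A> (under_arc_target n \<Gamma> (p, q)) = H #>\<^bsub>G\<^esub> m" by (simp add: quandle_op_def m_def)
  \<comment> \<open>The color of the target arc comes with a representative of its own, which gives
    the same vertex because \<phi> fixes \<open>H\<close> pointwise.\<close>
  have tm: "shifted_coset G H \<phi> k (coset_rep (\<A> (under_arc_target n \<Gamma> (p, q)))) = shifted_coset G H \<phi> k m" for k
    unfolding t by (rule shifted_coset_coset_rep[OF G H \<phi> _ m]) (use \<phi>H in blast)
  have over: "\<A> (semi_edge_arc p e) = B" by (simp only: B_def arcs_at_crossing(1)[OF c, of e])
  show ?thesis
  proof (cases b)
    case True
    have "semi_edge_arc q (b = (crossing_sign \<Gamma> (p, q) = 1)) = under_arc_target n \<Gamma> (p, q)"
      using True by (simp add: arcs_at_crossing(3)[OF c])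
    then show ?thesis
      using True over by (simp add: crossing_generator_def tm k flip: A_def B_def m_def)
  next
    case False
    have "semi_edge_arc q (b = (crossing_sign \<Gamma> (p, q) = 1)) = under_arc_source n \<Gamma> (p, q)"
      using False by (simp add: arcs_at_crossing(2)[OF c])
    then show ?thesis
      using False over by (simp add: crossing_generator_def k flip: A_def B_def)
  qed
qed

lemma semi_edge_side_label:
  assumes p: "p \<in> passages n \<Gamma>"
  shows "tuple_face (3 - capping_vertex p) (triangle (crossing_of n \<Gamma> p, positive_side p e)) = semi_edge_label p e"
  using p
proof (cases rule: passage_cases)
  case (1 q)
  have k: "- semi_edge_index \<R> p e = - (\<R> (source_region n \<Gamma> (p, q)) + (if positive_side p e then 1 else 0))"
    by (simp add: semi_edge_index_def crossing_of_crossing(1)[OF 1])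
  show ?thesis
    unfolding crossing_of_crossing(1)[OF 1] triangle_at_crossing[OF 1 k, of e] semi_edge_label_def
    using over_not_under(1)[OF 1] by (simp add: capping_vertex_def tuple_face_triangle)
next
  case (2 q)
  have k: "- semi_edge_index \<R> p e = - (\<R> (source_region n \<Gamma> (q, p)) + (if positive_side p e then 1 else 0))"
    by (simp add: semi_edge_index_def crossing_of_crossing(2)[OF 2])
  \<comment> \<open>At an under passage, comparing with the crossing sign undoes
    \<open>positive_side\<close> and gives back the end.\<close>
  have "(positive_side p e = (crossing_sign \<Gamma> (q, p) = 1)) = e"
    using over_not_under(2)[OF 2] by (auto simp: positive_side_def crossing_of_crossing(2)[OF 2])
  then show ?thesis
    unfolding crossing_of_crossing(2)[OF 2] triangle_at_crossing[OF 2 k, of e] semi_edge_label_def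
    using over_not_under(2)[OF 2] by (simp add: capping_vertex_def tuple_face_triangle)
qed

lemma next_semi_edge_label:
  assumes "(p, e) \<in> semi_edges" "next_semi_edge (p, e) = (p', e')"
  shows "semi_edge_label p' e' = semi_edge_label p e"
proof -
  have step: "semi_edge_label (next_on_link n \<Gamma> q) False = semi_edge_label q True" if "q \<in> passages n \<Gamma>" for q
    using edge_index[OF that region_coloring] edge_arc(1)[OF that] by (simp add: semi_edge_label_def)
  show ?thesis
  proof (cases e)
    case True
    then show ?thesis using assms step[of p] by (auto simp: semi_edges_def)
  next
    case False
    then have "next_semi_edge (p', e') = (p, e)" "e'" "p' \<in> passages n \<Gamma>"
      using assms next_semi_edge_next_semi_edge[OF assms(1)] next_semi_edge_in[OF assms(1)]
      by (auto simp: semi_edges_def)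
    then show ?thesis using step[of p'] by auto
  qed
qed

lemma triangle_vertices:
  assumes "t \<in> crossings n \<Gamma> \<times> UNIV"
  shows "length (triangle t) = 3" "set (triangle t) \<subseteq> lcosets\<^bsub>G\<^esub> H"
proof -
  obtain p q b where t: "t = ((p, q), b)" by (metis surj_pair)
  have c: "(p, q) \<in> crossings n \<Gamma>" using assms t by simp
  note P = crossing_passages[OF c]
  show "length (triangle t) = 3" "set (triangle t) \<subseteq> lcosets\<^bsub>G\<^esub> H"
    unfolding t triangle_at_crossing[OF c refl, of b True]
    using shifted_coset_in_lcosets[OF G \<phi> g] shifted_coset_in_lcosets[OF G \<phi> color_rep[OF P(1)]]
      shifted_coset_in_lcosets[OF G \<phi> color_rep[OF P(2)]] by auto
qed

lemma shared_side_label: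
  assumes "c \<in> crossings n \<Gamma>"
  shows "tuple_class G (tuple_face 0 (triangle (c, b))) = tuple_class G (tuple_face 0 (triangle (c, \<not> b)))"
proof -
  obtain p q where c: "c = (p, q)" by (cases c)
  note P = crossing_passages[OF assms[unfolded c]]
  have "coset_rep (\<A> (under_arc_source n \<Gamma> c)) \<in> carrier G" "coset_rep (\<A> (over_arc n \<Gamma> c)) \<in> carrier G"
    unfolding c arcs_at_crossing(2)[OF assms[unfolded c]] arcs_at_crossing(1)[OF assms[unfolded c], of True]
    using color_rep P by blast+
  from shared_side_class[OF G \<phi> H this, of "\<R> (source_region n \<Gamma> c)"] show ?thesis
    by (cases b) (simp_all add: crossing_generator_def tuple_face_triangle)
qed

lemma paired_sides:
  assumes "s \<in> (crossings n \<Gamma> \<times> UNIV) \<times> {0, 1, 2}" "s = (t, i)" "side_pairing s = (t', j)"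
  shows "tuple_class G (tuple_face i (triangle t)) = tuple_class G (tuple_face j (triangle t')) \<and>
    expanded_sign \<Gamma> t * (- 1) ^ i = - (expanded_sign \<Gamma> t' * (- 1) ^ j)"
  using assms(1)
proof (cases rule: side_cases)
  case (1 c b)
  then have "t = (c, b)" "i = 0" "t' = (c, \<not> b)" "j = 0" using assms(2,3) by auto
  then show ?thesis using shared_side_label[OF 1(1), of b] by simp
next
  case (2 h)
  obtain p e p' e' where h: "h = (p, e)" "next_semi_edge h = (p', e')" by (metis surj_pair)
  have h': "(p, e) \<in> semi_edges" "(p', e') \<in> semi_edges"
    using 2(1) next_semi_edge_in[OF 2(1), unfolded h(2)] h(1) by simp_all
  then have P: "p \<in> passages n \<Gamma>" "p' \<in> passages n \<Gamma>" by (simp_all add: semi_edges_def)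
  have e': "e' = (\<not> e)" using h by (auto split: if_splits)
  have "(t', j) = semi_edge_side (p', e')"
    using side_pairing_semi_edge_side[OF 2(1)] assms(3) 2(2) h by simp
  then have t: "t = (crossing_of n \<Gamma> p, positive_side p e)" "i = 3 - capping_vertex p"
    "t' = (crossing_of n \<Gamma> p', positive_side p' e')" "j = 3 - capping_vertex p'"
    using assms(2) 2(2) h(1) by simp_all
  show ?thesis
    unfolding t semi_edge_side_label[OF P(1)] semi_edge_side_label[OF P(2)]
      semi_edge_sign[OF P(1)] semi_edge_sign[OF P(2)]
    using next_semi_edge_label[OF h'(1), of p' e'] h e' by simp
qed

end

end

theorem theorem6p1:
  fixes n :: nat and \<Gamma> :: link_param
    and G :: "('g, 'm) monoid_scheme" and H :: "'g set" and \<phi> :: "'g \<Rightarrow> 'g" and g :: 'g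
    and \<A> :: "(complex \<times> real) set \<Rightarrow> 'g set" and \<R> :: "complex set \<Rightarrow> int"
  assumes "oriented_link n \<Gamma>" and "regular_projection n \<Gamma>"
    and "connected (diagram_set n \<Gamma>)" and "crossings n \<Gamma> \<noteq> {}"
    and "group G" and "\<phi> \<in> auto G" and "subgroup H G" and "\<forall>h\<in>H. \<phi> h = h"
    and "g \<in> carrier G"
    and "XZ_coloring G H \<phi> n \<Gamma> \<A> \<R>"
  shows "represents_triangulation G H
           (psi G H \<phi> g (coloring_cycle n \<Gamma> \<A> \<R>))
           (crossings n \<Gamma> \<times> UNIV)
           (expanded_sign \<Gamma>)
           (expanded_triangle G H \<phi> g n \<Gamma> \<A> \<R>)
           (closed_seifert_surface n \<Gamma>)"
proof -
  interpret link_diagram n \<Gamma> by unfold_locales fact+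
  have col: "group G" "\<phi> \<in> auto G" "subgroup H G" "\<forall>h\<in>H. \<phi> h = h" "g \<in> carrier G" "XZ_coloring G H \<phi> n \<Gamma> \<A> \<R>"
    using assms by blast+
  show ?thesis
    unfolding represents_triangulation_def
  proof (intro conjI exI[of _ side_pairing])
    show "finite (crossings n \<Gamma> \<times> (UNIV :: bool set))"
      by (intro finite_cartesian_product finite_crossings) simp
    have "expanded_sign \<Gamma> t \<in> {- 1, 1}" for t
      by (cases t) (simp add: crossing_sign_def)
    then show "\<forall>t\<in>crossings n \<Gamma> \<times> UNIV. expanded_sign \<Gamma> t \<in> {- 1, 1} \<and>
        length (expanded_triangle G H \<phi> g n \<Gamma> \<A> \<R> t) = 3 \<and>
        set (expanded_triangle G H \<phi> g n \<Gamma> \<A> \<R> t) \<subseteq> lcosets\<^bsub>G\<^esub> H"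
      using triangle_vertices[OF col] by blast
    show "psi G H \<phi> g (coloring_cycle n \<Gamma> \<A> \<R>) =
      (\<Sum>t\<in>crossings n \<Gamma> \<times> UNIV. frag_cmul (expanded_sign \<Gamma> t)
         (frag_of (tuple_class G (expanded_triangle G H \<phi> g n \<Gamma> \<A> \<R> t))))"
      by (rule psi_coloring_cycle[OF finite_crossings])
    show "\<forall>s\<in>(crossings n \<Gamma> \<times> UNIV) \<times> {0, 1, 2}. side_pairing s \<in> (crossings n \<Gamma> \<times> UNIV) \<times> {0, 1, 2} \<and>
        side_pairing s \<noteq> s \<and> side_pairing (side_pairing s) = s"
      using side_pairing_involution by blast
    show "\<forall>t\<in>crossings n \<Gamma> \<times> UNIV. \<forall>i\<in>{0, 1, 2}. \<forall>t' j. side_pairing (t, i) = (t', j) \<longrightarrow>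
        tuple_class G (tuple_face i (expanded_triangle G H \<phi> g n \<Gamma> \<A> \<R> t)) =
        tuple_class G (tuple_face j (expanded_triangle G H \<phi> g n \<Gamma> \<A> \<R> t')) \<and>
        expanded_sign \<Gamma> t * (- 1) ^ i = - (expanded_sign \<Gamma> t' * (- 1) ^ j)"
      using paired_sides[OF col _ refl] by (meson SigmaI)
    show "glued_triangles (crossings n \<Gamma> \<times> UNIV) side_pairing homeomorphic_space closed_seifert_surface n \<Gamma>"
      by (rule glued_triangles_homeomorphic_closed_seifert_surface)
  qed
qed

end
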